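(* Let $\ell\geq 2$. Almost every connected planar labelled graph has a Braess $K_\ell$. That is, the proportion of connected planar graphs on the labelled vertex set $\{1,\dots,n\}$ that have a Braess $K_\ell$, among all connected planar graphs on $\{1,\dots,n\}$, tends to $1$ as $n\to\infty$.
   Context: Graphs are finite, simple and undirected. For a connected graph $G$ with at least one edge, the random walk on $G$ has transition matrix $D^{-1}A$ ($A$ adjacency matrix, $D$ diagonal degree matrix), with stationary distribution $w_i=\deg(v_i)/(2|E(G)|)$ and mean first passage times $m_{i,j}$ ($i\ne j$). Kemeny's constant is $\mathcal{K}(G)=\sum_{j\neq i} w_j m_{i,j}$, which is independent of $i$; equivalently $\mathcal{K}(G)=\sum_{j\ge2}\frac{1}{1-\lambda_j}$ over the eigenvalues of $D^{-1}A$ other than the simple eigenvalue $\lambda_1=1$. A connected graph $G$ has a Braess $K_\ell$ (Braess clique of order $\ell$) if there is an independent set of $\ell$ vertices of $G$ such that the graph $\widetilde{G}$ obtained by adding all edges between these $\ell$ vertices satisfies $\mathcal{K}(\widetilde{G})>\mathcal{K}(G)$. The graph $\widetilde{G}$ is not required to be planar. *)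

theory Defs
  imports "HOL-Analysis.Analysis"
begin

text \<open>A finite simple undirected graph is given by its vertex set \<open>V\<close> and its edge set \<open>E\<close>, an edge
  being the two-element set of its ends.\<close>

definition simple_graph :: "'a set \<Rightarrow> 'a set set \<Rightarrow> bool" where
  "simple_graph V E \<longleftrightarrow> finite V \<and> (\<forall>e\<in>E. e \<subseteq> V \<and> card e = 2)"

definition connected_graph :: "'a set \<Rightarrow> 'a set set \<Rightarrow> bool" where
  "connected_graph V E \<longleftrightarrow> V \<noteq> {} \<and> (\<forall>u\<in>V. \<forall>v\<in>V. (u, v) \<in> {(x, y). {x, y} \<in> E}\<^sup>*)"

text \<open>Drawings use arbitrary topological arcs in the plane, which is represented by the type
  \<open>complex\<close>.  An arc meets the vertices only in its two ends, and two arcs meet only in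
  common ends.\<close>

definition planar_drawing ::
    "'a set \<Rightarrow> 'a set set \<Rightarrow> ('a \<Rightarrow> complex) \<Rightarrow> ('a set \<Rightarrow> real \<Rightarrow> complex) \<Rightarrow> bool" where
  "planar_drawing V E p \<gamma> \<longleftrightarrow>
     inj_on p V \<and>
     (\<forall>e\<in>E. arc (\<gamma> e) \<and> {pathstart (\<gamma> e), pathfinish (\<gamma> e)} = p ` e \<and>
             path_image (\<gamma> e) \<inter> p ` V = p ` e) \<and>
     (\<forall>e\<in>E. \<forall>e'\<in>E. e \<noteq> e' \<longrightarrow> path_image (\<gamma> e) \<inter> path_image (\<gamma> e') = p ` (e \<inter> e'))"

definition planar_graph :: "'a set \<Rightarrow> 'a set set \<Rightarrow> bool" where
  "planar_graph V E \<longleftrightarrow> (\<exists>p \<gamma>. planar_drawing V E p \<gamma>)"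

definition vertex_degree :: "'a set set \<Rightarrow> 'a \<Rightarrow> nat" where
  "vertex_degree E v = card {e \<in> E. v \<in> e}"

definition transition_prob :: "'a set set \<Rightarrow> 'a \<Rightarrow> 'a \<Rightarrow> real" where
  "transition_prob E u v = (if {u, v} \<in> E then 1 / real (vertex_degree E u) else 0)"

definition stationary_prob :: "'a set set \<Rightarrow> 'a \<Rightarrow> real" where
  "stationary_prob E v = real (vertex_degree E v) / (2 * real (card E))"

text \<open>The probability that the random walk started at \<open>i\<close> is at \<open>j\<close> at step \<open>t\<close> and at none of the
  steps \<open>1, \<dots>, t - 1\<close>, obtained by conditioning on the first step.\<close>

fun first_passage_prob :: "'a set \<Rightarrow> 'a set set \<Rightarrow> 'a \<Rightarrow> 'a \<Rightarrow> nat \<Rightarrow> real" where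
  "first_passage_prob V E i j 0 = 0"
| "first_passage_prob V E i j (Suc 0) = transition_prob E i j"
| "first_passage_prob V E i j (Suc (Suc t)) =
     (\<Sum>k\<in>V - {j}. transition_prob E i k * first_passage_prob V E k j (Suc t))"

text \<open>The expected first passage time.  On a finite connected graph, \<open>j\<close> is reached from
  \<open>i \<noteq> j\<close> almost surely and the series converges.\<close>

definition mean_first_passage :: "'a set \<Rightarrow> 'a set set \<Rightarrow> 'a \<Rightarrow> 'a \<Rightarrow> real" where
  "mean_first_passage V E i j = (\<Sum>t. real t * first_passage_prob V E i j t)"

text \<open>Kemeny's constant is the common value, over all starting vertices \<open>i\<close>, of the sum below; on a
  connected graph with an edge this sum does not depend on \<open>i\<close>.\<close>

definition kemeny_constant :: "'a set \<Rightarrow> 'a set set \<Rightarrow> real" where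
  "kemeny_constant V E =
     (THE k. \<forall>i\<in>V. k = (\<Sum>j\<in>V - {i}. stationary_prob E j * mean_first_passage V E i j))"

definition independent_vertices :: "'a set set \<Rightarrow> 'a set \<Rightarrow> bool" where
  "independent_vertices E S \<longleftrightarrow> (\<forall>u\<in>S. \<forall>v\<in>S. {u, v} \<notin> E)"

definition add_clique :: "'a set set \<Rightarrow> 'a set \<Rightarrow> 'a set set" where
  "add_clique E S = E \<union> {e. e \<subseteq> S \<and> card e = 2}"

definition has_Braess_clique :: "nat \<Rightarrow> 'a set \<Rightarrow> 'a set set \<Rightarrow> bool" where
  "has_Braess_clique l V E \<longleftrightarrow>
     (\<exists>S\<subseteq>V. card S = l \<and> independent_vertices E S \<and>
            kemeny_constant V (add_clique E S) > kemeny_constant V E)"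

definition connected_planar_graphs :: "nat \<Rightarrow> nat set set set" where
  "connected_planar_graphs n =
     {E. simple_graph {1..n} E \<and> connected_graph {1..n} E \<and> planar_graph {1..n} E}"

end

theory Submission
  imports Defs "HOL-Complex_Analysis.Complex_Analysis"
begin

text \<open>A clique on \<open>l\<close> leaves with a common neighbour \<open>v\<close> raises Kemeny's constant as soon as the graph
  is large, so it suffices that almost every connected planar graph has a vertex with at least \<open>l\<close>
  leaf neighbours.  Let \<open>C\<^sub>n\<close> count the connected planar graphs on \<open>n\<close> labelled vertices and \<open>B\<^sub>n\<close>
  those without such a vertex.  Attaching \<open>l\<close> new leaves to a vertex of a graph counted by \<open>B\<^sub>n\<close> is an
  almost reversible operation, whence \<open>(n + l choose l) n B\<^sub>n \<le> 4\<^sup>l C\<^bsub>n+l\<^esub>\<close>.  On the other hand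
  \<open>C\<^sub>n \<le> K n C\<^bsub>n-1\<^esub>\<close>: a positive fraction of the vertices of a planar graph either have a neighbour
  such that both degrees are bounded, or share their neighbourhood with another vertex;
  contracting the edge, or deleting the twin, can be undone from the partner and a bounded
  amount of information.  Hence \<open>B\<^sub>n / C\<^sub>n = O(1/n)\<close>.

  Planarity is used through three facts: it survives contracting an edge and attaching a leaf, and
  \<open>K\<^bsub>3,3\<^esub>\<close> is not planar.\<close>

section \<open>Arcs in the plane\<close>

text \<open>Edges are arbitrary arcs, which may be wild, so a drawing cannot be rerouted near a
  vertex. Contraction is therefore induced by a continuous map of the whole plane that collapses one
  arc to a point and is injective off it. In the count, each of the \<open>l\<close> steps from C_n
  to C_(n+l) costs a factor of order n, and the choice of \<open>l\<close> labels for the new leaves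
  wins these factors back up to a constant. The choice of the vertex that carries the leaves gives
  one more factor n, which nothing compensates; this is the whole gain. Kemeny's constant is
  computed from hitting times regarded as potentials: each solves a Laplace equation, and two
  solutions with the same data differ by a constant. Started at \<open>v\<close>, the
  \<open>l\<close> leaves contribute about \<open>l\<close> before the clique is added and about 2
  l^2 / (l + 1) afterwards, while the contribution of the other vertices does not decrease.\<close>

lemma Riemann_map_fixing_zero:
  fixes S :: "complex set"
  assumes "open S" "simply_connected S" "0 \<in> S" "S \<noteq> UNIV"
  obtains f g where "continuous_on S f" "continuous_on (ball 0 1) g"
    "\<And>z. z \<in> S \<Longrightarrow> f z \<in> ball 0 1 \<and> g (f z) = z"
    "\<And>w. w \<in> ball 0 1 \<Longrightarrow> g w \<in> S \<and> f (g w) = w" "f 0 = (0::complex)"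
proof -
  obtain f g where fg: "f holomorphic_on S" "g holomorphic_on ball 0 1"
    "\<forall>z\<in>S. f z \<in> ball 0 1 \<and> g (f z) = z" "\<forall>z\<in>ball 0 1. g z \<in> S \<and> f (g z) = z"
    using Riemann_mapping_theorem[of S] assms by auto
  have "f 0 \<in> ball 0 1" using fg assms by auto
  \<comment> \<open>Normalisation by a disc automorphism: in \<open>collapse_arc\<close> the point 0
    stands for infinity and has to land on the centre.\<close>
  from ball_biholomorphism_exists[OF this] obtain m m' where m: "m (f 0) = 0"
    "m holomorphic_on ball 0 1" "m ` ball 0 1 \<subseteq> ball 0 1"
    "m' holomorphic_on ball 0 1" "m' ` ball 0 1 \<subseteq> ball 0 1"
    "\<And>z. z \<in> ball 0 1 \<Longrightarrow> m (m' z) = z" "\<And>z. z \<in> ball 0 1 \<Longrightarrow> m' (m z) = z"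
    by metis
  show thesis
  proof (rule that[of "m \<circ> f" "g \<circ> m'"])
    have "f ` S \<subseteq> ball 0 1" using fg by auto
    then show "continuous_on S (m \<circ> f)"
      using holomorphic_on_imp_continuous_on[OF fg(1)] holomorphic_on_imp_continuous_on[OF m(2)]
      by (meson continuous_on_compose continuous_on_subset)
    show "continuous_on (ball 0 1) (g \<circ> m')"
      using holomorphic_on_imp_continuous_on[OF fg(2)] holomorphic_on_imp_continuous_on[OF m(4)] m(5)
      by (meson continuous_on_compose continuous_on_subset)
  next
    fix z assume "z \<in> S"
    then have "f z \<in> ball 0 1" "g (f z) = z" using fg by auto
    then show "(m \<circ> f) z \<in> ball 0 1 \<and> (g \<circ> m') ((m \<circ> f) z) = z"
      using m(3,7) by (metis comp_apply image_subset_iff)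
  next
    fix w :: complex assume w: "w \<in> ball 0 1"
    then have "m' w \<in> ball 0 1" using m(5) by blast
    then show "(g \<circ> m') w \<in> S \<and> (m \<circ> f) ((g \<circ> m') w) = w"
      using fg m(6)[OF w] by simp
  qed (use m in auto)
qed

text \<open>The complement of the arc in the sphere is simply connected, so a Riemann map takes it to a disc;
  reflecting the punctured disc turns its boundary circle into the single point \<open>0\<close>.\<close>

lemma collapse_arc:
  fixes g :: "real \<Rightarrow> complex"
  assumes "arc g"
  obtains H where "continuous_on UNIV H" "\<And>z. H z = (0::complex) \<longleftrightarrow> z \<in> path_image g"
    "inj_on H (- path_image g)"
proof -
  define K where "K = path_image g"
  define c where "c = pathstart g"
  have K: "compact K" "connected K" "connected (- K)" "c \<in> K"
    using assms by (auto simp: K_def c_def compact_arc_image connected_arc_image connected_arc_complement)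
  have cl: "closed K" using K(1) compact_imp_closed by blast
  obtain d where d: "d \<in> K" "d \<noteq> c"
    using assms arc_distinct_ends[of g] by (metis K_def c_def pathfinish_in_path_image)
  have limpt: "c islimpt K"
    using connected_imp_perfect[OF K(2)] K(4) d by blast
  obtain B where B: "B > 0" "\<And>z. z \<in> K \<Longrightarrow> norm (z - c) < B"
  proof -
    obtain e where e: "K \<subseteq> ball c e" using bounded_subset_ballD compact_imp_bounded[OF K(1)] by blast
    then have "0 < e" using K(4) by fastforce
    moreover have "norm (z - c) < e" if "z \<in> K" for z
      using e that by (auto simp: dist_norm norm_minus_commute)
    ultimately show thesis using that by blast
  qed
  \<comment> \<open>Inversion at an end \<open>c\<close> of the arc: \<open>c\<close> goes to
    infinity, infinity goes to 0, and \<Omega> is the sphere minus the arc seen in this chart. An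
    end is chosen so that \<open>K - {c}\<close>, and with it the complement of \<Omega>, stays
    connected.\<close>
  define \<iota> where "\<iota> = (\<lambda>z. inverse (z - c))"
  define \<Omega> where "\<Omega> = insert 0 {w. c + inverse w \<notin> K}"
  have compl: "- \<Omega> = {w. w \<noteq> 0 \<and> c + inverse w \<in> K}" by (auto simp: \<Omega>_def)
  have out: "inverse B < norm w" if "w \<in> - \<Omega>" for w
  proof -
    have "norm (inverse w) < B" using that B(2)[of "c + inverse w"] compl by auto
    moreover have "0 < norm w" using that compl by auto
    ultimately show ?thesis using B(1) by (simp add: norm_inverse norm_divide field_simps)
  qed
  \<comment> \<open>Since \<open>inverse 0 = 0\<close>, the default value of \<iota> at
    \<open>c\<close> is 0, which lies in \<Omega>; hence the exception.\<close>
  have \<iota>\<Omega>: "\<iota> z \<in> \<Omega> \<longleftrightarrow> z \<notin> K \<or> z = c" for z by (auto simp: \<iota>_def \<Omega>_def)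
  have image1: "- \<Omega> = \<iota> ` (K - {c})"
  proof
    show "- \<Omega> \<subseteq> \<iota> ` (K - {c})"
    proof
      fix w assume "w \<in> - \<Omega>"
      then show "w \<in> \<iota> ` (K - {c})" using compl
        by (intro image_eqI[of _ _ "c + inverse w"]) (auto simp: \<iota>_def)
    qed
  qed (auto simp: \<iota>\<Omega>)
  have image2: "\<Omega> = insert 0 (\<iota> ` (- K))"
  proof
    show "\<Omega> \<subseteq> insert 0 (\<iota> ` (- K))"
    proof
      fix w assume "w \<in> \<Omega>"
      then show "w \<in> insert 0 (\<iota> ` (- K))"
        by (cases "w = 0") (auto simp: \<iota>_def \<Omega>_def intro!: image_eqI[of _ _ "c + inverse w"])
    qed
  qed (use \<iota>\<Omega> in \<open>auto simp: \<Omega>_def\<close>)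
  have "- \<Omega> = {w \<in> - ball 0 (inverse B). c + inverse w \<in> K}"
  proof (intro set_eqI iffI)
    fix w assume "w \<in> - \<Omega>"
    then show "w \<in> {w \<in> - ball 0 (inverse B). c + inverse w \<in> K}"
      using out[of w] compl by auto
  next
    fix w assume w: "w \<in> {w \<in> - ball 0 (inverse B). c + inverse w \<in> K}"
    have "0 < inverse B" using B(1) by simp
    with w have "w \<noteq> 0" by auto
    with w show "w \<in> - \<Omega>" using compl by auto
  qed
  moreover have "closed {w \<in> - ball 0 (inverse B). c + inverse w \<in> K}"
  proof -
    have "continuous_on (- ball 0 (inverse B)) (\<lambda>w. c + inverse w)"
      using B(1) by (intro continuous_intros) auto
    from continuous_closed_preimage[OF this _ cl] show ?thesis
      by (simp add: vimage_def Int_def closed_Compl)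
  qed
  ultimately have "open \<Omega>" by (simp add: open_closed)
  have "connected (K - {c})"
  proof -
    have "K - {c} = g ` {0<..1}"
    proof -
      have "g t = g 0 \<longleftrightarrow> t = 0" if "t \<in> {0..1}" for t
        using assms that by (auto simp: arc_def inj_on_def)
      then show ?thesis
        by (force simp: K_def path_image_def c_def pathstart_def)
    qed
    moreover have "continuous_on {0<..1} g"
      using assms by (auto simp: arc_def path_def intro: continuous_on_subset)
    ultimately show ?thesis using connected_continuous_image by (metis connected_Ioc)
  qed
  moreover have "continuous_on (K - {c}) \<iota>"
    unfolding \<iota>_def by (intro continuous_intros) auto
  ultimately have conn1: "connected (- \<Omega>)"
    unfolding image1 by (rule connected_continuous_image[rotated])
  have unb: "\<not> bounded (- \<Omega>)"
  proof
    assume "bounded (- \<Omega>)"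
    then obtain M where M: "M > 0" "\<And>w. w \<in> - \<Omega> \<Longrightarrow> norm w \<le> M"
      by (meson bounded_pos)
    obtain z where z: "z \<in> K" "z \<noteq> c" "dist z c < inverse M"
      using limpt M(1) by (metis islimpt_approachable positive_imp_inverse_positive)
    have "norm (\<iota> z) \<le> M" using M(2) z image1 by blast
    moreover have "M < norm (\<iota> z)"
      using z M(1) by (simp add: \<iota>_def norm_inverse norm_divide dist_norm field_simps)
    ultimately show False by simp
  qed
  have conn2: "connected \<Omega>"
  proof (rule connected_intermediate_closure[of "\<iota> ` (- K)"])
    have "continuous_on (- K) \<iota>"
      unfolding \<iota>_def using K(4) by (intro continuous_intros) auto
    then show "connected (\<iota> ` (- K))" using K(3) connected_continuous_image by blast
    have "0 \<in> closure (\<iota> ` (- K))"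
      unfolding closure_approachable
    proof safe
      fix e :: real assume "e > 0"
      define w where "w = complex_of_real (min (e/2) (inverse B))"
      have w: "norm w = min (e/2) (inverse B)" "w \<noteq> 0"
        using \<open>e > 0\<close> B(1) by (auto simp: w_def min_def)
      have "w \<in> \<Omega>" using out[of w] w by force
      then have "w \<in> \<iota> ` (- K)" using image2 w by auto
      then show "\<exists>y\<in>\<iota> ` (- K). dist y 0 < e" using w \<open>e > 0\<close> by (intro bexI[of _ w]) auto
    qed
    then show "\<Omega> \<subseteq> closure (\<iota> ` (- K))" using image2 closure_subset[of "\<iota> ` (- K)"] by auto
  qed (use image2 in auto)
  have "simply_connected \<Omega>"
    unfolding simply_connected_eq_unbounded_complement_components[OF \<open>open \<Omega>\<close>]
    using conn1 conn2 unb by (metis bounded_empty components_eq_sing_iff singletonD)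
  then obtain F G :: "complex \<Rightarrow> complex" where FG: "continuous_on \<Omega> F" "continuous_on (ball 0 1) G"
    "\<And>z. z \<in> \<Omega> \<Longrightarrow> F z \<in> ball 0 1 \<and> G (F z) = z"
    "\<And>w. w \<in> ball 0 1 \<Longrightarrow> G w \<in> \<Omega> \<and> F (G w) = w" "F 0 = 0"
  proof -
    have "0 \<in> \<Omega>" "\<Omega> \<noteq> UNIV" using unb by (auto simp: \<Omega>_def)
    from Riemann_map_fixing_zero[OF \<open>open \<Omega>\<close> \<open>simply_connected \<Omega>\<close> this] that show thesis by blast
  qed
  define w where "w = (\<lambda>z. F (\<iota> z))"
  \<comment> \<open>Radially, r becomes 1/r - 1: the boundary circle shrinks to 0 and the centre,
    which represents infinity, is sent out to infinity.\<close>
  define H where "H = (\<lambda>z. if z \<in> K then 0 else (1 / norm (w z) - 1) *\<^sub>R sgn (w z))"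
  have w: "w z \<noteq> 0" "norm (w z) < 1" "G (w z) = \<iota> z" if "z \<notin> K" for z
  proof -
    have "\<iota> z \<in> \<Omega>" "\<iota> z \<noteq> 0" using that K(4) \<iota>\<Omega> by (auto simp: \<iota>_def)
    then show "norm (w z) < 1" "G (w z) = \<iota> z" using FG(3)[of "\<iota> z"] by (auto simp: w_def)
    show "w z \<noteq> 0"
      using FG(3)[of "\<iota> z"] FG(3)[of 0] FG(5) \<open>\<iota> z \<in> \<Omega>\<close> \<open>\<iota> z \<noteq> 0\<close> by (auto simp: w_def \<Omega>_def)
  qed
  have nH: "norm (H z) = 1 / norm (w z) - 1" if "z \<notin> K" for z
    using w[OF that] that by (simp add: H_def norm_sgn)
  have zero: "H z = 0 \<longleftrightarrow> z \<in> K" for z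
  proof (cases "z \<in> K")
    case False
    then have "1 / norm (w z) > 1" using w[OF False] by simp
    then have "norm (H z) > 0" using nH[OF False] by simp
    then show ?thesis using False by auto
  qed (simp add: H_def)
  have inj: "inj_on H (- K)"
  proof (rule inj_onI)
    fix a b assume ab: "a \<in> - K" "b \<in> - K" "H a = H b"
    then have *: "norm (w a) = norm (w b)" using nH[of a] nH[of b] by simp
    have "1 / norm (w a) - 1 \<noteq> 0" using zero[of a] nH[of a] ab by auto
    moreover have "(1 / norm (w a) - 1) *\<^sub>R sgn (w a) = (1 / norm (w a) - 1) *\<^sub>R sgn (w b)"
      using ab * by (simp add: H_def)
    ultimately have "sgn (w a) = sgn (w b)" by (metis scaleR_left_imp_eq)
    then have "w a = w b" using * w(1)[of a] w(1)[of b] ab by (simp add: sgn_div_norm)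
    then have "\<iota> a = \<iota> b" using w(3) ab by (metis ComplD)
    then show "a = b" by (simp add: \<iota>_def)
  qed
  have cont: "isCont H z" for z
  proof (cases "z \<in> K")
    case False
    have "continuous_on (- K) \<iota>"
      unfolding \<iota>_def using K(4) by (intro continuous_intros) auto
    then have "continuous_on (- K) w"
      unfolding w_def using FG(1) \<iota>\<Omega> by (auto intro!: continuous_on_compose2[of \<Omega> F])
    then have "continuous_on (- K) (\<lambda>z. (1 / norm (w z) - 1) *\<^sub>R sgn (w z))"
      using w(1) by (intro continuous_intros) auto
    then have "continuous_on (- K) H"
      by (rule continuous_on_eq) (auto simp: H_def)
    then show ?thesis using False cl continuous_on_eq_continuous_at open_Compl by blast
  next
    case True
    have "eventually (\<lambda>x. norm (H x) < e) (at z)" if "e > 0" for e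
    proof -
      \<comment> \<open>For \<open>x\<close> off the arc, \<open>norm (H x) < e\<close> means
        \<open>norm (w x) > r\<close>. So it is enough that \<iota> x leaves the compact set
        \<open>Q\<close>: near \<open>z \<noteq> c\<close> because \<iota> z lies outside \<Omega>,
        near \<open>c\<close> because \<iota> x tends to infinity.\<close>
      define r where "r = 1 / (1 + e)"
      have r: "0 < r" "r < 1" using that by (auto simp: r_def)
      define Q where "Q = G ` cball 0 r"
      have "cball 0 r \<subseteq> ball (0::complex) 1" using r by auto
      then have Q: "compact Q" "Q \<subseteq> \<Omega>"
        using FG(2,4) unfolding Q_def
        by (meson compact_cball compact_continuous_image continuous_on_subset, blast)
      have inQ: "norm (H x) < e" if "\<iota> x \<notin> Q" for x
      proof (cases "x \<in> K")
        case True then show ?thesis using \<open>e > 0\<close> by (simp add: H_def)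
      next
        case False
        then have "\<not> norm (w x) \<le> r"
          using w(3)[OF False] that by (metis Q_def image_eqI mem_cball_0)
        then have "1 / norm (w x) < 1 / r" using r by (simp add: frac_less2)
        then show ?thesis using nH[OF False] by (simp add: r_def)
      qed
      have "eventually (\<lambda>x. \<iota> x \<notin> Q) (at z)"
      proof (cases "z = c")
        case False
        have "isCont \<iota> z" unfolding \<iota>_def using False by (intro continuous_intros) auto
        moreover have "\<iota> z \<in> - Q" using True False \<iota>\<Omega> Q by blast
        moreover have "open (- Q)" using Q(1) compact_imp_closed by blast
        ultimately show ?thesis
          by (auto simp: isCont_def dest: topological_tendstoD)
      next
        case zc: True
        obtain M where M: "M > 0" "\<And>w. w \<in> Q \<Longrightarrow> norm w \<le> M"
          using compact_imp_bounded[OF Q(1)] by (meson bounded_pos)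
        have "\<iota> x \<notin> Q" if "x \<noteq> z" "dist x z < inverse M" for x
        proof -
          have "M < norm (\<iota> x)"
            using that M(1) zc by (simp add: \<iota>_def norm_inverse norm_divide dist_norm field_simps)
          then show ?thesis using M(2) by force
        qed
        then show ?thesis
          unfolding eventually_at using M(1) by (intro exI[of _ "inverse M"]) auto
      qed
      then show ?thesis by (rule eventually_mono) (use inQ in auto)
    qed
    moreover have "H z = 0" using True by (simp add: H_def)
    ultimately show ?thesis
      unfolding isCont_def by (auto simp: tendsto_iff dist_norm)
  qed
  show thesis
    using that[of H] cont zero inj by (auto simp: K_def continuous_at_imp_continuous_on)
qed

text \<open>By invariance of dimension no nonempty open subset of the plane embeds into an interval.
  This yields points off an edge arbitrarily near to it, where a leaf can be placed.\<close>

lemma interior_arc_image: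
  fixes g :: "real \<Rightarrow> complex"
  assumes "arc g"
  shows "interior (path_image g) = {}"
proof (rule ccontr)
  assume ne: "interior (path_image g) \<noteq> {}"
  obtain f where f: "homeomorphism (path_image g) {0..1::real} f g"
    using homeomorphism_arc[OF assms] by (metis homeomorphism_symD)
  have "DIM(complex) \<le> DIM(real)"
  proof (rule invariance_of_dimension[of "interior (path_image g)" f])
    show "continuous_on (interior (path_image g)) f"
      using f interior_subset by (metis continuous_on_subset homeomorphism_cont1)
    show "inj_on f (interior (path_image g))"
      using f interior_subset by (metis homeomorphism_def inj_on_inverseI inj_on_subset)
  qed (use ne in auto)
  then show False by simp
qed

text \<open>Inside and outside are forgotten on purpose: \<open>U\<close> is the Jordan domain that
  contains \<open>X\<close> and \<open>D\<close> the other one. This makes the three pairs of arcs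
  of a theta curve interchangeable.\<close>

lemma Jordan_pair:
  fixes P Q :: "real \<Rightarrow> complex"
  assumes "arc P" "arc Q" "pathstart P = a" "pathfinish P = b" "pathstart Q = a" "pathfinish Q = b"
    and "path_image P \<inter> path_image Q = {a, b}"
    and X: "connected X" "X \<noteq> {}" "X \<inter> (path_image P \<union> path_image Q) = {}"
  obtains U D where "open U" "connected U" "open D" "connected D" "D \<noteq> {}" "U \<inter> D = {}"
    "U \<union> D = - (path_image P \<union> path_image Q)" "frontier D = path_image P \<union> path_image Q" "X \<subseteq> U"
proof -
  define c where "c = P +++ reversepath Q"
  have c: "simple_path c" "pathfinish c = pathstart c"
    proof -
    show "simple_path c" unfolding c_def
      by (rule simple_path_join_loop) (use assms in \<open>simp_all add: arc_reversepath\<close>)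
  qed (simp add: c_def assms)
  have im: "path_image c = path_image P \<union> path_image Q"
    unfolding c_def using assms by (simp add: path_image_join)
  note J = Jordan_inside_outside[OF c, unfolded im]
  let ?C = "path_image P \<union> path_image Q"
  have "X \<subseteq> inside ?C \<union> outside ?C" using J X(3) by blast
  moreover from this have "inside ?C \<inter> X = {} \<or> outside ?C \<inter> X = {}"
    using J by (intro connectedD[OF X(1)]) auto
  ultimately have "X \<subseteq> inside ?C \<or> X \<subseteq> outside ?C" by blast
  then show thesis
  proof
    assume "X \<subseteq> inside ?C"
    with J show thesis by (intro that[of "inside ?C" "outside ?C"]) blast+
  next
    assume "X \<subseteq> outside ?C"
    with J show thesis by (intro that[of "outside ?C" "inside ?C"]) blast+
  qed
qed

text \<open>If \<open>Z\<close> reached all three arcs of a theta curve, the side of \<open>P\<^sub>0 \<union> P\<^sub>1\<close> avoiding \<open>Z\<close> would not be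
  separated from \<open>Z\<close> by \<open>P\<^sub>0 \<union> P\<^sub>2\<close> nor by \<open>P\<^sub>1 \<union> P\<^sub>2\<close>, hence by Janiszewski's theorem not by their
  union, which contains \<open>P\<^sub>0 \<union> P\<^sub>1\<close>.\<close>

lemma no_theta_tripod:
  fixes P :: "nat \<Rightarrow> real \<Rightarrow> complex"
  assumes arc: "\<And>i. i < 3 \<Longrightarrow> arc (P i)"
    and ends: "\<And>i. i < 3 \<Longrightarrow> pathstart (P i) = a" "\<And>i. i < 3 \<Longrightarrow> pathfinish (P i) = b"
    and int: "\<And>i j. i < 3 \<Longrightarrow> j < 3 \<Longrightarrow> i \<noteq> j \<Longrightarrow> path_image (P i) \<inter> path_image (P j) = {a, b}"
    and Z: "Z \<noteq> {}" "\<And>i. i < 3 \<Longrightarrow> Z \<inter> path_image (P i) = {}"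
    and conn: "\<And>i. i < 3 \<Longrightarrow> connected (Z \<union> (path_image (P i) - {a, b}))"
  shows False
proof -
  let ?p = "\<lambda>i. path_image (P i)"
  have ne: "?p i - {a, b} \<noteq> {}" if "i < 3" for i
    using nonempty_simple_path_endless[OF arc_imp_simple_path[OF arc[OF that]]] ends that by auto
  have sides: "\<exists>U D. open U \<and> connected U \<and> open D \<and> connected D \<and> D \<noteq> {} \<and> U \<inter> D = {} \<and>
      U \<union> D = - (?p i \<union> ?p j) \<and> frontier D = ?p i \<union> ?p j \<and> Z \<union> (?p k - {a, b}) \<subseteq> U"
    if "i < 3" "j < 3" "k < 3" "i \<noteq> j" "i \<noteq> k" "j \<noteq> k" for i j k
  proof -
    have "(?p k - {a, b}) \<inter> (?p i \<union> ?p j) = {}" using int[of i k] int[of j k] that by auto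
    then have "(Z \<union> (?p k - {a, b})) \<inter> (?p i \<union> ?p j) = {}" using Z(2)[of i] Z(2)[of j] that by blast
    from Jordan_pair[OF arc[OF that(1)] arc[OF that(2)] ends(1)[OF that(1)] ends(2)[OF that(1)]
        ends(1)[OF that(2)] ends(2)[OF that(2)] int[OF that(1,2,4)] conn[OF that(3)] _ this]
    show ?thesis using Z(1) by (metis Un_empty)
  qed
  obtain U D where UD: "open U" "connected U" "open D" "connected D" "D \<noteq> {}" "U \<inter> D = {}"
     "U \<union> D = - (?p 0 \<union> ?p 1)" "frontier D = ?p 0 \<union> ?p 1" "Z \<union> (?p 2 - {a, b}) \<subseteq> U"
    using sides[of 0 1 2] by auto
  \<comment> \<open>The inner points of \<open>P j\<close> lie in the frontier of \<open>D\<close>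
    and in the open set \<open>U'\<close>, the side of \<open>Z\<close> for the arcs
    \<open>P i\<close> and \<open>P 2\<close>. So \<open>D\<close> meets \<open>U'\<close>, and
    being connected and disjoint from both arcs it lies in \<open>U'\<close>.\<close>
  have side2: "\<exists>U'. connected U' \<and> Z \<subseteq> U' \<and> D \<subseteq> U' \<and> U' \<subseteq> - (?p i \<union> ?p 2)"
    if ij: "i < 2" "j < 2" "i \<noteq> j" for i j
  proof -
    obtain U' D' where U': "open U'" "connected U'" "open D'" "connected D'" "U' \<inter> D' = {}"
      "U' \<union> D' = - (?p i \<union> ?p 2)" "Z \<union> (?p j - {a, b}) \<subseteq> U'"
      using sides[of i 2 j] ij by auto
    have "?p i \<union> ?p j = ?p 0 \<union> ?p 1" using ij by (auto simp: less_2_cases_iff)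
    then have D: "D \<inter> (?p i \<union> ?p j) = {}" "?p j \<subseteq> closure D"
      using UD(7,8) frontier_subset_closed[of "closure D"] by (auto simp: frontier_def)
    have "{a, b} \<subseteq> ?p i" using int[of i 2] ij by auto
    then have "D \<inter> ?p 2 = {}" using UD(6,9) D(1) by blast
    then have "D \<subseteq> U' \<union> D'" using D(1) U'(6) by blast
    obtain z where z: "z \<in> ?p j - {a, b}" using ne[of j] ij by auto
    then have "z \<in> closure D" "z \<in> U'" using D(2) U'(7) by auto
    then have "U' \<inter> D \<noteq> {}" using U'(1) open_Int_closure_eq_empty by blast
    then have "D \<subseteq> U'"
      using connectedD[OF UD(4) U'(1,3)] U'(5) \<open>D \<subseteq> U' \<union> D'\<close> by blast
    then show ?thesis using U' by (intro exI[of _ U']) auto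
  qed
  obtain q q' where q: "q \<in> Z" "q' \<in> D" using Z(1) UD(5) by blast
  have cc: "connected_component (- (?p i \<union> ?p 2)) q q'" if "i < 2" for i
  proof -
    obtain U' where "connected U'" "Z \<subseteq> U'" "D \<subseteq> U'" "U' \<subseteq> - (?p i \<union> ?p 2)"
    proof -
      obtain j :: nat where "j < 2" "i \<noteq> j" by (metis pos2 one_less_numeral_iff semiring_norm(76) zero_neq_one)
      then show thesis using side2[OF \<open>i < 2\<close>] that by blast
    qed
    then show ?thesis using q unfolding connected_component_def by blast
  qed
  have "?p 0 \<inter> ?p 1 = {a, b}" using int[of 0 1] by simp
  moreover have "{a, b} \<subseteq> ?p 2" using int[of 0 2] by auto
  \<comment> \<open>Janiszewski's theorem asks for a connected intersection; here it is the single
    arc \<open>P 2\<close>.\<close>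
  ultimately have "(?p 0 \<union> ?p 2) \<inter> (?p 1 \<union> ?p 2) = ?p 2" by blast
  then have "connected ((?p 0 \<union> ?p 2) \<inter> (?p 1 \<union> ?p 2))"
    using arc[of 2] by (simp add: connected_arc_image)
  moreover have "compact (?p i \<union> ?p 2)" if "i < 2" for i
    using arc[of i] arc[of 2] that by (simp add: compact_Un compact_arc_image)
  ultimately have "connected_component (- ((?p 0 \<union> ?p 2) \<union> (?p 1 \<union> ?p 2))) q q'"
  proof (rule_tac Janiszewski)
    assume *: "\<And>i. i < 2 \<Longrightarrow> compact (?p i \<union> ?p 2)"
    show "compact (?p 0 \<union> ?p 2)" "closed (?p 1 \<union> ?p 2)"
      using *[of 0] compact_imp_closed[OF *[of 1]] by simp_all
    show "connected_component (- (?p 0 \<union> ?p 2)) q q'" "connected_component (- (?p 1 \<union> ?p 2)) q q'"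
      using cc[of 0] cc[of 1] by simp_all
  qed
  then obtain T where T: "connected T" "T \<subseteq> - ((?p 0 \<union> ?p 2) \<union> (?p 1 \<union> ?p 2))" "q \<in> T" "q' \<in> T"
    unfolding connected_component_def by auto
  then have "T \<subseteq> U \<union> D" using UD(7) by blast
  then show False
    using connectedD[OF T(1) UD(1,3)] T q UD(6,9) by blast
qed

lemma arc_orient:
  fixes c :: "real \<Rightarrow> complex"
  assumes "arc c" "{pathstart c, pathfinish c} = {a, b}"
  obtains g where "arc g" "pathstart g = a" "pathfinish g = b" "path_image g = path_image c"
proof (cases "pathstart c = a")
  case True
  then have "pathfinish c = b" using assms by (auto simp: doubleton_eq_iff)
  then show ?thesis using that[of c] assms True by auto
next
  case False
  then have "pathstart c = b" "pathfinish c = a" using assms by (auto simp: doubleton_eq_iff)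
  then show ?thesis using that[of "reversepath c"] assms by (auto simp: arc_reversepath)
qed

lemma connected_arc_minus_finish:
  fixes c :: "real \<Rightarrow> complex"
  assumes "arc c"
  shows "connected (path_image c - {pathfinish c})"
proof -
  have "c t = c 1 \<longleftrightarrow> t = 1" if "t \<in> {0..1}" for t
    using assms that by (auto simp: arc_def inj_on_def)
  then have "path_image c - {pathfinish c} = c ` {0..<1}"
    by (force simp: path_image_def pathfinish_def)
  moreover have "continuous_on {0..<1} c"
    using assms by (auto simp: arc_def path_def intro: continuous_on_subset)
  ultimately show ?thesis using connected_continuous_image by (metis connected_Ico)
qed

text \<open>The six edges at \<open>x\<close> and \<open>y\<close> form a theta curve with one arc
  through each \<open>b i\<close>, and the three edges at \<open>v\<close> form a tripod that
  reaches all three arcs. The feet \<open>b i\<close> are removed from the tripod so that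
  \<open>Z\<close> is disjoint from the theta curve, as \<open>no_theta_tripod\<close>
  demands.\<close>

lemma K33_not_planar:
  assumes pl: "planar_graph V E" and sg: "simple_graph V E"
    and dist: "distinct [x, y, v]" "inj_on b {..<3}" "\<And>i. i < (3::nat) \<Longrightarrow> b i \<notin> {x, y, v}"
    and E: "\<And>i s. i < 3 \<Longrightarrow> s \<in> {x, y, v} \<Longrightarrow> {s, b i} \<in> E"
  shows False
proof -
  obtain p \<gamma> where d: "planar_drawing V E p \<gamma>" using pl planar_graph_def by blast
  have inV: "s \<in> V" "b i \<in> V" if "i < 3" "s \<in> {x, y, v}" for s i
    using E[OF that] sg by (auto simp: simple_graph_def)
  have inj: "inj_on p V" using d by (simp add: planar_drawing_def)
  have "\<exists>g. arc g \<and> pathstart g = p s \<and> pathfinish g = p (b i) \<and> path_image g = path_image (\<gamma> {s, b i})"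
    if "i < 3" "s \<in> {x, y, v}" for s i
  proof -
    have "arc (\<gamma> {s, b i})" "{pathstart (\<gamma> {s, b i}), pathfinish (\<gamma> {s, b i})} = {p s, p (b i)}"
      using d E[OF that] by (auto simp: planar_drawing_def)
    from arc_orient[OF this] show ?thesis by blast
  qed
  note ex = this
  define c where "c = (\<lambda>s i. SOME g. arc g \<and> pathstart g = p s \<and>
      pathfinish g = p (b i) \<and> path_image g = path_image (\<gamma> {s, b i}))"
  have c: "arc (c s i) \<and> pathstart (c s i) = p s \<and>
      pathfinish (c s i) = p (b i) \<and> path_image (c s i) = path_image (\<gamma> {s, b i})"
    if "i < 3" "s \<in> {x, y, v}" for i s
    unfolding c_def by (rule someI_ex[OF ex[OF that]])
  have dd: "path_image (\<gamma> e) \<inter> path_image (\<gamma> e') = p ` (e \<inter> e')" if "e \<in> E" "e' \<in> E" "e \<noteq> e'" for e e'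
    using d that unfolding planar_drawing_def by blast
  have int: "path_image (c s i) \<inter> path_image (c t j) = p ` ({s, b i} \<inter> {t, b j})"
    if "i < 3" "s \<in> {x, y, v}" "j < 3" "t \<in> {x, y, v}" "(s, i) \<noteq> (t, j)" for s i t j
  proof -
    have "{s, b i} \<noteq> {t, b j}"
      using that dist(3) dist(2) by (auto simp: doubleton_eq_iff inj_on_def)
    then have "path_image (\<gamma> {s, b i}) \<inter> path_image (\<gamma> {t, b j}) = p ` ({s, b i} \<inter> {t, b j})"
      using dd E that by simp
    then show ?thesis using c that by simp
  qed
  have bne: "b i \<noteq> b j" if "i < 3" "j < 3" "i \<noteq> j" for i j using dist(2) that by (auto simp: inj_on_def)
  define P where "P = (\<lambda>i. c x i +++ reversepath (c y i))"
  define Z where "Z = (\<Union>i\<in>{..<3}. path_image (c v i) - {p (b i)})"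
  have imP: "path_image (P i) = path_image (c x i) \<union> path_image (c y i)" if "i < 3" for i
    using c[OF that] by (auto simp: P_def path_image_join)
  have arcP: "arc (P i)" if "i < 3" for i
  proof -
    have "path_image (c x i) \<inter> path_image (c y i) = {p (b i)}"
      using int[of i x i y] that dist by auto
    then show ?thesis unfolding P_def using c[OF that]
      by (intro arc_join) (auto simp: arc_reversepath)
  qed
  have ZP: "Z \<inter> path_image (P i) = {}" if "i < 3" for i
  proof -
    have "path_image (c v j) \<inter> path_image (P i) \<subseteq> {p (b j)}" if "j < 3" for j
      using int[of j v i x] int[of j v i y] \<open>i < 3\<close> that dist(1) dist(3)[of i] dist(3)[of j]
      by (auto simp: imP)
    then show ?thesis by (auto simp: Z_def)
  qed
  have con1: "connected (path_image (c v i) - {p (b i)})" if "i < 3" for i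
    using connected_arc_minus_finish c[OF that] by (metis insertI1 insertI2)
  have pv: "p v \<in> path_image (c v i) - {p (b i)}" if "i < 3" for i
  proof -
    have "p v \<noteq> p (b i)" using inj inV[OF that, of v] dist(3)[OF that] by (auto simp: inj_on_def)
    then show ?thesis using c[OF that, of v] by (metis DiffI insertI1 insertI2 pathstart_in_path_image singletonD)
  qed
  have conZ: "connected Z" unfolding Z_def
  proof (rule connected_Union)
    show "(\<Inter>i\<in>{..<3}. path_image (c v i) - {p (b i)}) \<noteq> {}" using pv by blast
  qed (use con1 in auto)
  have ends: "p x \<noteq> p (b i)" "p y \<noteq> p (b i)" if "i < 3" for i
    using inj inV[OF that, of x] inV[OF that, of y] dist(3)[OF that] unfolding inj_on_def
    by (metis insert_iff)+
  show False
  proof (rule no_theta_tripod[of P "p x" "p y" Z])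
    show "path_image (P i) \<inter> path_image (P j) = {p x, p y}" if "i < 3" "j < 3" "i \<noteq> j" for i j
      using int[of i x j x] int[of i x j y] int[of i y j x] int[of i y j y] that bne[OF that] dist(1)
        dist(3)[of i] dist(3)[of j] by (auto simp: imP)
    show "connected (Z \<union> (path_image (P i) - {p x, p y}))" if "i < 3" for i
    proof -
      let ?Pi = "path_image (P i) - {p x, p y}"
      have "p (b i) \<in> ?Pi" using ends[OF that] c[OF that, of x] imP[OF that]
        by (metis DiffI UnI1 insertE insertI1 pathfinish_in_path_image singletonD)
      have "connected ?Pi"
        using connected_simple_path_endless[OF arc_imp_simple_path[OF arcP[OF that]]] c[OF that]
        by (simp add: P_def)
      moreover have "connected (Z \<union> path_image (c v i))"
      proof (rule connected_Un)
        show "connected (path_image (c v i))" using c[OF that, of v] by (metis connected_arc_image insertCI)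
        show "Z \<inter> path_image (c v i) \<noteq> {}" using pv[OF that] that by (auto simp: Z_def)
      qed (rule conZ)
      ultimately have "connected ((Z \<union> path_image (c v i)) \<union> ?Pi)"
      proof (rule_tac connected_Un)
        have "p (b i) \<in> path_image (c v i)" using c[OF that, of v] by (metis insertCI pathfinish_in_path_image)
        then show "(Z \<union> path_image (c v i)) \<inter> ?Pi \<noteq> {}" using \<open>p (b i) \<in> ?Pi\<close> by blast
      qed
      moreover have "(Z \<union> path_image (c v i)) \<union> ?Pi = Z \<union> ?Pi"
        using \<open>p (b i) \<in> ?Pi\<close> that by (auto simp: Z_def)
      ultimately show ?thesis by simp
    qed
    show "Z \<noteq> {}" using pv[of 0] by (auto simp: Z_def)
    show "pathstart (P i) = p x" "pathfinish (P i) = p y" if "i < 3" for i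
      using c[OF that] by (auto simp: P_def)
  qed (use arcP ZP in auto)
qed

section \<open>Operations on planar graphs\<close>

lemma planar_drawing_edge:
  assumes "planar_drawing V E p \<gamma>" "e \<in> E"
  shows "arc (\<gamma> e)" "{pathstart (\<gamma> e), pathfinish (\<gamma> e)} = p ` e" "path_image (\<gamma> e) \<inter> p ` V = p ` e"
    "p ` e \<subseteq> path_image (\<gamma> e)"
proof -
  show "path_image (\<gamma> e) \<inter> p ` V = p ` e" using assms by (simp add: planar_drawing_def)
  then show "p ` e \<subseteq> path_image (\<gamma> e)" by blast
qed (use assms in \<open>simp_all add: planar_drawing_def\<close>)

lemma planar_drawing_edges_Int:
  assumes "planar_drawing V E p \<gamma>" "e \<in> E" "e' \<in> E" "e \<noteq> e'"
  shows "path_image (\<gamma> e) \<inter> path_image (\<gamma> e') = p ` (e \<inter> e')"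
  using assms unfolding planar_drawing_def by blast

lemma planar_drawing_insert_edge:
  assumes "planar_drawing V E p \<gamma>" "f \<notin> E" "arc c" "{pathstart c, pathfinish c} = p ` f"
    "path_image c \<inter> p ` V = p ` f" "\<And>e. e \<in> E \<Longrightarrow> path_image (\<gamma> e) \<inter> path_image c = p ` (e \<inter> f)"
  shows "planar_drawing V (insert f E) p (\<gamma>(f := c))"
proof -
  have "path_image c \<inter> path_image (\<gamma> e) = p ` (f \<inter> e)" if "e \<in> E" for e
    using assms(6)[OF that] by (simp add: Int_commute)
  then show ?thesis using assms unfolding planar_drawing_def by auto
qed

lemma planar_drawing_subgraph:
  assumes "planar_drawing V E p \<gamma>" "V' \<subseteq> V" "E' \<subseteq> E" "\<And>e. e \<in> E' \<Longrightarrow> e \<subseteq> V'"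
  shows "planar_drawing V' E' p \<gamma>"
  unfolding planar_drawing_def
proof (intro conjI ballI impI)
  show "inj_on p V'" using assms(1,2) inj_on_subset by (auto simp: planar_drawing_def)
  fix e assume e: "e \<in> E'"
  with assms(3) have "e \<in> E" by blast
  note d = planar_drawing_edge[OF assms(1) this]
  show "arc (\<gamma> e)" "{pathstart (\<gamma> e), pathfinish (\<gamma> e)} = p ` e" by (fact d)+
  show "path_image (\<gamma> e) \<inter> p ` V' = p ` e" using d(3) assms(2) assms(4)[OF e] by blast
  fix e' assume "e' \<in> E'" "e \<noteq> e'"
  then show "path_image (\<gamma> e) \<inter> path_image (\<gamma> e') = p ` (e \<inter> e')"
    using planar_drawing_edges_Int[OF assms(1) \<open>e \<in> E\<close>, of e'] assms(3) by blast
qed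

lemma planar_graph_subgraph:
  assumes "planar_graph V E" "V' \<subseteq> V" "E' \<subseteq> E" "\<And>e. e \<in> E' \<Longrightarrow> e \<subseteq> V'"
  shows "planar_graph V' E'"
  using assms planar_drawing_subgraph unfolding planar_graph_def by metis

lemma planar_graph_image:
  assumes "planar_graph V E" "inj_on f V" "\<And>e. e \<in> E \<Longrightarrow> e \<subseteq> V"
  shows "planar_graph (f ` V) ((`) f ` E)"
proof -
  obtain p \<gamma> where d: "planar_drawing V E p \<gamma>" using assms(1) unfolding planar_graph_def by blast
  define g where "g = inv_into V f"
  have g: "g (f v) = v" if "v \<in> V" for v using that assms(2) by (simp add: g_def)
  have gi: "g ` f ` e = e" if "e \<subseteq> V" for e using g that by (auto simp: image_image subset_iff)
  have gE: "g ` f ` e = e" if "e \<in> E" for e using gi assms(3) that by blast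
  have "planar_drawing (f ` V) ((`) f ` E) (p \<circ> g) (\<lambda>e. \<gamma> (g ` e))"
    unfolding planar_drawing_def
  proof (intro conjI ballI impI)
    show "inj_on (p \<circ> g) (f ` V)"
      using d g by (auto simp: planar_drawing_def inj_on_def)
    fix e' assume "e' \<in> (`) f ` E"
    then obtain e where e: "e \<in> E" "e' = f ` e" by blast
    note dd = planar_drawing_edge[OF d e(1)]
    have im: "(p \<circ> g) ` e' = p ` e" by (metis e gE image_comp)
    show "arc (\<gamma> (g ` e'))" "{pathstart (\<gamma> (g ` e')), pathfinish (\<gamma> (g ` e'))} = (p \<circ> g) ` e'"
      using dd gE[OF e(1)] im by (simp_all add: e(2))
    have "(p \<circ> g) ` f ` V = p ` V" by (metis gi image_comp order_refl)
    then show "path_image (\<gamma> (g ` e')) \<inter> (p \<circ> g) ` f ` V = (p \<circ> g) ` e'"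
      using dd(3) gE[OF e(1)] im by (simp add: e(2))
    fix e2' assume "e2' \<in> (`) f ` E" "e' \<noteq> e2'"
    then obtain e2 where e2: "e2 \<in> E" "e2' = f ` e2" "e \<noteq> e2" using e by blast
    have "e' \<inter> e2' = f ` (e \<inter> e2)"
      unfolding e e2 using inj_on_image_Int[OF assms(2)] assms(3) e e2 by metis
    then have "(p \<circ> g) ` (e' \<inter> e2') = p ` g ` f ` (e \<inter> e2)" by (simp add: image_comp)
    moreover have "g ` f ` (e \<inter> e2) = e \<inter> e2" using gi[of "e \<inter> e2"] assms(3)[OF e(1)] by blast
    ultimately have "(p \<circ> g) ` (e' \<inter> e2') = p ` (e \<inter> e2)" by simp
    then show "path_image (\<gamma> (g ` e')) \<inter> path_image (\<gamma> (g ` e2')) = (p \<circ> g) ` (e' \<inter> e2')"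
      using planar_drawing_edges_Int[OF d e(1) e2(1,3)] gE[OF e(1)] gE[OF e2(1)] by (simp add: e e2)
  qed
  then show ?thesis unfolding planar_graph_def by blast
qed

text \<open>The vertex \<open>y\<close> is merged into \<open>x\<close> and disappears.\<close>

definition contract :: "'a set set \<Rightarrow> 'a \<Rightarrow> 'a \<Rightarrow> 'a set set" where
  "contract E x y = {e \<in> E. y \<notin> e} \<union> {{x, z} | z. {y, z} \<in> E \<and> z \<noteq> x}"

text \<open>The drawing is pushed forward by the map \<open>H\<close> that collapses the arc of
  \<open>{x, y}\<close>. As \<open>H\<close> identifies only points of that arc, and any other edge
  meets it in at most one end, arcs stay arcs and new intersections occur only at the merged
  vertex.\<close>

lemma planar_graph_contract:
  assumes pl: "planar_graph V E" and sg: "simple_graph V E" and xy: "{x, y} \<in> E"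
  shows "planar_graph (V - {y}) (contract E x y)"
proof -
  obtain p \<gamma> where d: "planar_drawing V E p \<gamma>" using pl planar_graph_def by blast
  have inj: "inj_on p V" using d by (simp add: planar_drawing_def)
  have ne: "x \<noteq> y" "x \<in> V" "y \<in> V" using sg xy by (auto simp: simple_graph_def)
  have EV: "e \<subseteq> V" "card e = 2" if "e \<in> E" for e using sg that by (auto simp: simple_graph_def)
  define K where "K = path_image (\<gamma> {x, y})"
  obtain H where H: "continuous_on UNIV H" "\<And>z. H z = (0::complex) \<longleftrightarrow> z \<in> K" "inj_on H (- K)"
    using collapse_arc[OF planar_drawing_edge(1)[OF d xy]] unfolding K_def by metis
  have Heq: "s = t \<or> (s \<in> K \<and> t \<in> K)" if "H s = H t" for s t
  proof (cases "s \<in> K")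
    case True then show ?thesis using H(2) that by metis
  next
    case False
    then have "t \<notin> K" using H(2) that by metis
    then show ?thesis using H(3) False that by (auto simp: inj_on_def)
  qed
  have pK: "p v \<in> K \<longleftrightarrow> v = x \<or> v = y" if "v \<in> V" for v
  proof -
    have "K \<inter> p ` V = {p x, p y}" using planar_drawing_edge(3)[OF d xy] by (simp add: K_def)
    then have "p v \<in> K \<longleftrightarrow> p v = p x \<or> p v = p y" using that by blast
    then show ?thesis using inj ne that by (auto simp: inj_on_def)
  qed
  have eK: "path_image (\<gamma> e) \<inter> K = p ` (e \<inter> {x, y})" if "e \<in> E" "e \<noteq> {x, y}" for e
    using planar_drawing_edges_Int[OF d that(1) xy that(2)] by (simp add: K_def)
  define r where "r = (\<lambda>v. if v = y then x else v)"
  \<comment> \<open>An edge of \<open>E\<close> over each edge of the contraction. Where a common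
    neighbour of \<open>x\<close> and \<open>y\<close> yields two parallel edges, the one at
    \<open>x\<close> is drawn.\<close>
  define orig where "orig = (\<lambda>f. if f \<in> E \<and> y \<notin> f then f else insert y (f - {x}))"
  have orig: "orig f \<in> E" "orig f \<noteq> {x, y}" "r ` orig f = f" if f: "f \<in> contract E x y" for f
  proof -
    have "orig f \<in> E \<and> orig f \<noteq> {x, y} \<and> r ` orig f = f"
    proof (cases "f \<in> E \<and> y \<notin> f")
      case True
      then show ?thesis by (auto simp: orig_def r_def)
    next
      case False
      then obtain z where z: "f = {x, z}" "{y, z} \<in> E" "z \<noteq> x" using f by (auto simp: contract_def)
      then have "z \<noteq> y" using EV(2)[of "{y, z}"] by auto
      then have "orig f = {y, z}" using z False by (auto simp: orig_def)
      then show ?thesis using z \<open>z \<noteq> y\<close> ne by (auto simp: r_def doubleton_eq_iff)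
    qed
    then show "orig f \<in> E" "orig f \<noteq> {x, y}" "r ` orig f = f" by auto
  qed
  have rV: "r v \<in> V - {y}" if "v \<in> V" for v using that ne by (auto simp: r_def)
  have Hr: "H (p (r v)) = H (p v)" if "v \<in> V" for v
    using H(2) pK that ne by (auto simp: r_def) (metis pK)
  have im: "(H \<circ> p) ` r ` A = H ` p ` A" if "A \<subseteq> V" for A
    using Hr that by (force simp: image_iff)
  have imf: "(H \<circ> p) ` f = H ` p ` orig f" if "f \<in> contract E x y" for f
    using im[OF EV(1)[OF orig(1)[OF that]]] orig(3)[OF that] by simp
  have one: "a = b" if "a \<in> e" "b \<in> e" "a = x \<or> a = y" "b = x \<or> b = y" "e \<in> E" "e \<noteq> {x, y}" for a b e
  proof (rule ccontr)
    assume "a \<noteq> b"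
    then have "{x, y} \<subseteq> e" using that by auto
    moreover have "card {x, y} = 2" using ne by simp
    ultimately have "{x, y} = e" using EV(2)[OF that(5)]
      by (metis card_subset_eq card.infinite zero_neq_numeral)
    then show False using that by simp
  qed
  have "planar_drawing (V - {y}) (contract E x y) (H \<circ> p) (\<lambda>f. H \<circ> \<gamma> (orig f))"
    unfolding planar_drawing_def
  proof (intro conjI ballI impI)
    show "inj_on (H \<circ> p) (V - {y})"
    proof (rule inj_onI)
      fix a b assume ab: "a \<in> V - {y}" "b \<in> V - {y}" "(H \<circ> p) a = (H \<circ> p) b"
      then have "p a = p b \<or> (p a \<in> K \<and> p b \<in> K)" using Heq by simp
      then show "a = b" using ab inj pK by (auto simp: inj_on_def)
    qed
    fix f assume f: "f \<in> contract E x y"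
    let ?o = "orig f"
    note de = planar_drawing_edge[OF d orig(1)[OF f]]
    show "arc (H \<circ> \<gamma> ?o)"
    proof -
      have "inj_on H (path_image (\<gamma> ?o))"
      proof (rule inj_onI)
        fix s t assume st: "s \<in> path_image (\<gamma> ?o)" "t \<in> path_image (\<gamma> ?o)" "H s = H t"
        from Heq[OF st(3)] show "s = t"
        proof
          assume "s \<in> K \<and> t \<in> K"
          then have "s \<in> p ` (?o \<inter> {x, y})" "t \<in> p ` (?o \<inter> {x, y})"
            using st eK[OF orig(1,2)[OF f]] by auto
          then show "s = t" using one[OF _ _ _ _ orig(1,2)[OF f]] by blast
        qed
      qed
      moreover have "inj_on (\<gamma> ?o) {0..1}" "path (\<gamma> ?o)" using de(1) by (auto simp: arc_def)
      ultimately show ?thesis unfolding arc_def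
        using H(1) by (auto intro!: path_continuous_image comp_inj_on simp: path_image_def intro: continuous_on_subset)
    qed
    show "{pathstart (H \<circ> \<gamma> ?o), pathfinish (H \<circ> \<gamma> ?o)} = (H \<circ> p) ` f"
      unfolding imf[OF f] using de(2) by (simp add: pathstart_compose pathfinish_compose flip: de(2))
    have pim: "path_image (H \<circ> \<gamma> (orig g)) = H ` path_image (\<gamma> (orig g))" for g
      by (simp add: path_image_compose)
    show "path_image (H \<circ> \<gamma> ?o) \<inter> (H \<circ> p) ` (V - {y}) = (H \<circ> p) ` f"
    proof
      show "(H \<circ> p) ` f \<subseteq> path_image (H \<circ> \<gamma> ?o) \<inter> (H \<circ> p) ` (V - {y})"
      proof -
        have "r ` orig f \<subseteq> V - {y}" using rV EV(1)[OF orig(1)[OF f]] by blast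
        then have "f \<subseteq> V - {y}" by (simp only: orig(3)[OF f])
        then have "(H \<circ> p) ` f \<subseteq> (H \<circ> p) ` (V - {y})" by (rule image_mono)
        then show ?thesis unfolding pim imf[OF f] using image_mono[OF de(4), of H] by simp
      qed
      show "path_image (H \<circ> \<gamma> ?o) \<inter> (H \<circ> p) ` (V - {y}) \<subseteq> (H \<circ> p) ` f"
      proof
        fix q assume "q \<in> path_image (H \<circ> \<gamma> ?o) \<inter> (H \<circ> p) ` (V - {y})"
        then obtain s v where sv: "s \<in> path_image (\<gamma> ?o)" "q = H s" "v \<in> V" "H s = H (p v)"
          unfolding pim by auto
        from Heq[OF sv(4)] have "s = p v \<or> s \<in> K" by auto
        then have "s \<in> p ` ?o"
        proof
          assume "s = p v" then show ?thesis using sv de(3) by blast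
        next
          assume "s \<in> K" then show ?thesis using sv eK[OF orig(1,2)[OF f]] by blast
        qed
        then show "q \<in> (H \<circ> p) ` f" using imf[OF f] sv(2) by blast
      qed
    qed
    fix f' assume f': "f' \<in> contract E x y" "f \<noteq> f'"
    then have "?o \<noteq> orig f'" using orig(3) f by metis
    note I = planar_drawing_edges_Int[OF d orig(1)[OF f] orig(1)[OF f'(1)] this]
    show "path_image (H \<circ> \<gamma> ?o) \<inter> path_image (H \<circ> \<gamma> (orig f')) = (H \<circ> p) ` (f \<inter> f')"
    proof
      have "(H \<circ> p) ` f \<subseteq> path_image (H \<circ> \<gamma> ?o)" "(H \<circ> p) ` f' \<subseteq> path_image (H \<circ> \<gamma> (orig f'))"
        unfolding pim imf[OF f] imf[OF f'(1)] using de(4) planar_drawing_edge(4)[OF d orig(1)[OF f'(1)]]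
        by (auto intro: image_mono)
      then show "(H \<circ> p) ` (f \<inter> f') \<subseteq> path_image (H \<circ> \<gamma> ?o) \<inter> path_image (H \<circ> \<gamma> (orig f'))" by blast
      show "path_image (H \<circ> \<gamma> ?o) \<inter> path_image (H \<circ> \<gamma> (orig f')) \<subseteq> (H \<circ> p) ` (f \<inter> f')"
      proof
        fix q assume "q \<in> path_image (H \<circ> \<gamma> ?o) \<inter> path_image (H \<circ> \<gamma> (orig f'))"
        then obtain s t where st: "s \<in> path_image (\<gamma> ?o)" "t \<in> path_image (\<gamma> (orig f'))" "q = H s" "H s = H t"
          unfolding pim by auto
        from Heq[OF st(4)] show "q \<in> (H \<circ> p) ` (f \<inter> f')"
        proof
          assume "s = t"
          then obtain a where a: "a \<in> ?o" "a \<in> orig f'" "s = p a" using st I by blast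
          then have "a \<in> V" "r a \<in> f \<inter> f'" using EV(1)[OF orig(1)[OF f]] orig(3)[OF f] orig(3)[OF f'(1)] by blast+
          then show ?thesis using Hr[of a] a st(3) by (metis comp_apply image_eqI)
        next
          assume K: "s \<in> K \<and> t \<in> K"
          then have "?o \<inter> {x, y} \<noteq> {}" "orig f' \<inter> {x, y} \<noteq> {}"
            using st eK[OF orig(1,2)[OF f]] eK[OF orig(1,2)[OF f'(1)]] by blast+
          then have "x \<in> r ` ?o" "x \<in> r ` orig f'" by (auto simp: r_def image_iff)
          then have "x \<in> f \<inter> f'" using orig(3) f f' by simp
          moreover have "q = H (p x)" using K st(3) H(2) pK[OF ne(2)] by metis
          ultimately show ?thesis by auto
        qed
      qed
    qed
  qed
  then show ?thesis unfolding planar_graph_def by blast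
qed

text \<open>An arc may be wild at its end \<open>v\<close>, so a leaf cannot be drawn at \<open>v\<close> directly.  It is drawn at the
  point \<open>t\<close> of an edge that is nearest to some point off the drawing, and \<open>t\<close> is contracted into \<open>v\<close>
  afterwards.\<close>

lemma planar_graph_subdivide_leaf:
  assumes pl: "planar_graph V E" and sg: "simple_graph V E" and vw: "{v, w} \<in> E"
    and tu: "t \<notin> V" "u \<notin> V" "t \<noteq> u"
  shows "planar_graph (V \<union> {t, u}) (E - {{v, w}} \<union> {{v, t}, {t, w}, {t, u}})"
proof -
  obtain p \<gamma> where d: "planar_drawing V E p \<gamma>" using pl planar_graph_def by blast
  have inj: "inj_on p V" using d by (simp add: planar_drawing_def)
  have ne: "v \<noteq> w" "v \<in> V" "w \<in> V" using sg vw by (auto simp: simple_graph_def)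
  have EV: "e \<subseteq> V" if "e \<in> E" for e using sg that by (auto simp: simple_graph_def)
  have fin: "finite V" "finite E"
    using sg finite_subset[of E "Pow V"] by (auto simp: simple_graph_def)
  obtain g where g: "arc g" "pathstart g = p v" "pathfinish g = p w" "path_image g = path_image (\<gamma> {v, w})"
    using arc_orient[OF planar_drawing_edge(1)[OF d vw], of "p v" "p w"] planar_drawing_edge(2)[OF d vw] by auto
  have g01: "g 0 = p v" "g 1 = p w" using g by (auto simp: pathstart_def pathfinish_def)
  have ginj: "g a = g b \<longleftrightarrow> a = b" if "a \<in> {0..1}" "b \<in> {0..1}" for a b
    using g(1) that by (auto simp: arc_def inj_on_def)
  define E0 where "E0 = E - {{v, w}}"
  define M where "M = (\<Union>e\<in>E0. path_image (\<gamma> e)) \<union> p ` V"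
  have clM: "closed M" unfolding M_def
    using fin d by (intro closed_Un closed_UN) (auto simp: E0_def planar_drawing_def closed_arc_image finite_imp_closed)
  have gV: "path_image g \<inter> p ` V = {p v, p w}" using planar_drawing_edge(3)[OF d vw] g(4) by simp
  have ge: "path_image (\<gamma> e) \<inter> path_image g = p ` (e \<inter> {v, w})" if "e \<in> E0" for e
    using planar_drawing_edges_Int[OF d _ vw, of e] that by (simp add: E0_def g(4))
  have gM: "path_image g \<inter> M \<subseteq> {p v, p w}" using gV ge unfolding M_def by blast
  have inim: "g a \<in> path_image g" if "a \<in> {0..1}" for a using that by (auto simp: path_image_def)
  have "g (1/2) \<notin> {p v, p w}" using ginj[of "1/2" 0] ginj[of "1/2" 1] by (auto simp: g01)
  then have "g (1/2) \<in> - M" using gM inim[of "1/2"] by auto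
  then obtain \<delta> where \<delta>: "\<delta> > 0" "ball (g (1/2)) \<delta> \<subseteq> - M"
    using clM open_contains_ball by (metis open_Compl)
  \<comment> \<open>With \<open>z\<close> within \<delta>/2 of the midpoint, its nearest point
    \<open>s\<close> on the arc is within \<delta>/2 of \<open>z\<close>, so the segment from
    \<open>s\<close> to \<open>z\<close> stays in the ball of radius \<delta>, off the rest of the
    drawing. Minimality of the distance makes it meet the arc in \<open>s\<close> only.\<close>
  have "\<not> ball (g (1/2)) (\<delta>/2) \<subseteq> path_image g"
    using interior_arc_image[OF g(1)] \<delta>(1) by (metis ball_eq_empty half_gt_zero interior_maximal linorder_not_less open_ball subset_empty)
  then obtain z where z: "dist (g (1/2)) z < \<delta>/2" "z \<notin> path_image g"
    unfolding subset_iff mem_ball by blast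
  obtain s where s: "s \<in> path_image g" "\<And>y. y \<in> path_image g \<Longrightarrow> dist z s \<le> dist z y"
    using distance_attains_inf[of "path_image g" z] g(1) closed_arc_image[OF g(1)] by (metis path_image_nonempty)
  have zs: "dist z s < \<delta>/2" using s(2)[OF inim[of "1/2"]] z(1) by (simp add: dist_commute)
  have segM: "closed_segment s z \<inter> M = {}"
  proof -
    have "closed_segment s z \<subseteq> ball (g (1/2)) \<delta>"
    proof
      fix y assume "y \<in> closed_segment s z"
      then have "dist z y \<le> dist z s" using dist_in_closed_segment[of y s z] by (simp add: dist_commute)
      then show "y \<in> ball (g (1/2)) \<delta>" using zs z(1) dist_triangle[of "g (1/2)" y z] by simp
    qed
    then show ?thesis using \<delta>(2) by blast
  qed
  have segg: "closed_segment s z \<inter> path_image g = {s}"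
  proof -
    have "y = s" if "y \<in> closed_segment s z" "y \<in> path_image g" for y
    proof (rule ccontr)
      assume "y \<noteq> s"
      moreover have "y \<noteq> z" using that z by auto
      ultimately have "y \<in> open_segment s z" using that by (simp add: open_segment_def)
      then have "dist z y < dist z s" using dist_in_open_segment[of y s z] by (simp add: dist_commute)
      then show False using s(2)[OF that(2)] by simp
    qed
    then show ?thesis using s(1) by auto
  qed
  have "s \<notin> M" using segM by auto
  obtain \<tau> where \<tau>: "\<tau> \<in> {0..1}" "s = g \<tau>" using s(1) by (auto simp: path_image_def)
  have "s \<noteq> p v" "s \<noteq> p w" using \<open>s \<notin> M\<close> ne by (auto simp: M_def)
  then have \<tau>': "0 < \<tau>" "\<tau> < 1" using \<tau> g01 by (auto simp: less_le)
  define A B where "A = subpath 0 \<tau> g" and "B = subpath \<tau> 1 g"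
  have A: "arc A" "pathstart A = p v" "pathfinish A = s" "path_image A = g ` {0..\<tau>}"
    and B: "arc B" "pathstart B = s" "pathfinish B = p w" "path_image B = g ` {\<tau>..1}"
    using g(1) \<tau> \<tau>' g01 by (auto simp: A_def B_def arc_subpath_arc path_image_subpath)
  have AB: "path_image A \<inter> path_image B = {s}"
  proof -
    have "g a = s" if "a \<in> {0..\<tau>}" "b \<in> {\<tau>..1}" "g a = g b" for a b
    proof -
      have "a = b" using ginj[of a b] that \<tau>' by simp
      then show ?thesis using that \<tau> by auto
    qed
    then show ?thesis using \<tau> \<tau>' by (auto simp: A(4) B(4))
  qed
  have sub: "path_image A \<subseteq> path_image g" "path_image B \<subseteq> path_image g"
    unfolding A(4) B(4) using \<tau>' by (auto simp: path_image_def)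
  have Aw: "p w \<notin> path_image A" and Bv: "p v \<notin> path_image B"
  proof -
    have "g 1 \<noteq> g a" if "a \<in> {0..\<tau>}" for a using ginj[of 1 a] that \<tau>' by auto
    then show "p w \<notin> path_image A" unfolding A(4) g01(2)[symmetric] by blast
    have "g 0 \<noteq> g a" if "a \<in> {\<tau>..1}" for a using ginj[of 0 a] that \<tau>' by auto
    then show "p v \<notin> path_image B" unfolding B(4) g01(1)[symmetric] by blast
  qed
  have ends: "p v \<in> path_image A" "s \<in> path_image A" "s \<in> path_image B" "p w \<in> path_image B"
    using A B by (metis pathstart_in_path_image pathfinish_in_path_image)+
  have zM: "z \<notin> M" "z \<noteq> s" using segM z s by auto
  define q where "q = p(t := s, u := z)"
  have qV: "q x = p x" if "x \<in> V" for x using that tu by (auto simp: q_def)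
  have qi: "q ` e = p ` e" if "e \<subseteq> V" for e using qV that by (force simp: image_iff)
  have q: "q v = p v" "q w = p w" "q t = s" "q u = z" using qV ne tu by (auto simp: q_def)
  have e0: "e \<subseteq> V" "e \<inter> {v, t} = e \<inter> {v}" "e \<inter> {t, w} = e \<inter> {w}" "e \<inter> {t, u} = {}" if "e \<in> E0" for e
    using EV[of e] that tu by (auto simp: E0_def)
  have qVtu: "q ` (V \<union> {t, u}) = p ` V \<union> {s, z}" using qi[of V] q by (simp add: image_Un)
  have pVM: "p ` V \<subseteq> M" by (simp add: M_def)
  have d0: "planar_drawing (V \<union> {t, u}) E0 q \<gamma>"
    unfolding planar_drawing_def
  proof (intro conjI ballI impI)
    show "inj_on q (V \<union> {t, u})"
    proof -
      have "inj_on q V" using inj qV by (auto simp: inj_on_def)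
      moreover have "s \<notin> q ` V" "z \<notin> insert s (q ` V)" using pVM \<open>s \<notin> M\<close> zM qi[of V] by auto
      ultimately have "inj_on q (insert u (insert t V))"
        using tu q by (simp add: inj_on_insert)
      then show ?thesis by (simp add: insert_commute)
    qed
    fix e assume e: "e \<in> E0"
    then have "e \<in> E" by (simp add: E0_def)
    note dd = planar_drawing_edge[OF d this]
    have "path_image (\<gamma> e) \<subseteq> M" using e by (auto simp: M_def)
    then show "path_image (\<gamma> e) \<inter> q ` (V \<union> {t, u}) = q ` e"
      using dd(3) \<open>s \<notin> M\<close> zM unfolding qVtu qi[OF e0(1)[OF e]] by blast
    show "arc (\<gamma> e)" "{pathstart (\<gamma> e), pathfinish (\<gamma> e)} = q ` e" using dd qi[OF e0(1)[OF e]] by auto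
    fix e' assume "e' \<in> E0" "e \<noteq> e'"
    then show "path_image (\<gamma> e) \<inter> path_image (\<gamma> e') = q ` (e \<inter> e')"
      using planar_drawing_edges_Int[OF d \<open>e \<in> E\<close>, of e'] qi[of "e \<inter> e'"] e0(1)[OF e]
      by (simp add: E0_def le_infI1)
  qed
  have eA: "path_image (\<gamma> e) \<inter> path_image A = p ` (e \<inter> {v})" "path_image (\<gamma> e) \<inter> path_image B = p ` (e \<inter> {w})"
    if "e \<in> E0" for e
    using ge[OF that] sub Aw Bv ends by auto
  have eM: "path_image (\<gamma> e) \<subseteq> M" if "e \<in> E0" for e using that by (auto simp: M_def)
  have nE: "{v, t} \<notin> E0" "{t, w} \<notin> insert {v, t} E0" "{t, u} \<notin> insert {t, w} (insert {v, t} E0)"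
    using e0(1) tu ne by (auto simp: doubleton_eq_iff)
  have d1: "planar_drawing (V \<union> {t, u}) (insert {v, t} E0) q (\<gamma>({v, t} := A))"
  proof (rule planar_drawing_insert_edge[OF d0 nE(1) A(1)])
    show "path_image A \<inter> q ` (V \<union> {t, u}) = q ` {v, t}"
    proof -
      have "path_image A \<inter> p ` V \<subseteq> {p v, p w}" using gV sub(1) by blast
      then have "path_image A \<inter> p ` V = {p v}" using Aw ends(1) ne by auto
      moreover have "z \<notin> path_image A" using sub z by blast
      ultimately show ?thesis unfolding qVtu using ends q by auto
    qed
    show "path_image (\<gamma> e) \<inter> path_image A = q ` (e \<inter> {v, t})" if "e \<in> E0" for e
      using eA(1)[OF that] e0[OF that] qi[of "e \<inter> {v}"] by (metis inf.coboundedI1)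
  qed (simp add: A q)
  have d2: "planar_drawing (V \<union> {t, u}) (insert {t, w} (insert {v, t} E0)) q (\<gamma>({v, t} := A, {t, w} := B))"
  proof (rule planar_drawing_insert_edge[OF d1 nE(2) B(1)])
    show "path_image B \<inter> q ` (V \<union> {t, u}) = q ` {t, w}"
    proof -
      have "path_image B \<inter> p ` V \<subseteq> {p v, p w}" using gV sub(2) by blast
      then have "path_image B \<inter> p ` V = {p w}" using Bv ends(4) ne by auto
      moreover have "z \<notin> path_image B" using sub z by blast
      ultimately show ?thesis unfolding qVtu using ends q by auto
    qed
    fix e assume "e \<in> insert {v, t} E0"
    then consider "e = {v, t}" | "e \<in> E0" "e \<noteq> {v, t}" using nE by blast
    then show "path_image ((\<gamma>({v, t} := A)) e) \<inter> path_image B = q ` (e \<inter> {t, w})"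
    proof cases
      case 1
      have "{v, t} \<inter> {t, w} = {t}" using ne tu by auto
      moreover have "(\<gamma>({v, t} := A)) e = A" using 1 by simp
      ultimately show ?thesis using 1 AB q by (simp only: image_insert image_empty)
    next
      case 2
      then show ?thesis using eA(2)[OF 2(1)] e0[OF 2(1)] qi[of "e \<inter> {w}"] by (simp add: le_infI1)
    qed
  qed (simp add: B q)
  have "planar_drawing (V \<union> {t, u}) (insert {t, u} (insert {t, w} (insert {v, t} E0))) q
     (\<gamma>({v, t} := A, {t, w} := B, {t, u} := linepath s z))"
  proof (rule planar_drawing_insert_edge[OF d2 nE(3)])
    show "arc (linepath s z)" using zM by (simp add: arc_linepath)
    show "path_image (linepath s z) \<inter> q ` (V \<union> {t, u}) = q ` {t, u}"
      unfolding qVtu using segM pVM q by auto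
    fix e assume "e \<in> insert {t, w} (insert {v, t} E0)"
    then consider "e = {v, t}" | "e = {t, w}" | "e \<in> E0" "e \<noteq> {v, t}" "e \<noteq> {t, w}" using nE by blast
    then show "path_image ((\<gamma>({v, t} := A, {t, w} := B)) e) \<inter> path_image (linepath s z) = q ` (e \<inter> {t, u})"
    proof cases
      case 1
      have "{v, t} \<inter> {t, u} = {t}" "{v, t} \<noteq> {t, w}" using ne tu by auto
      then show ?thesis using 1 segg sub ends q by auto
    next
      case 2
      have "{t, w} \<inter> {t, u} = {t}" using ne tu by auto
      then show ?thesis using 2 segg sub ends q by auto
    next
      case 3
      then show ?thesis using eM[OF 3(1)] e0[OF 3(1)] segM by auto
    qed
  qed (simp add: q)
  moreover have "insert {t, u} (insert {t, w} (insert {v, t} E0)) = E - {{v, w}} \<union> {{v, t}, {t, w}, {t, u}}"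
    unfolding E0_def by auto
  ultimately show ?thesis unfolding planar_graph_def by metis
qed

lemma planar_graph_add_leaf:
  fixes V :: "'a set"
  assumes pl: "planar_graph V E" and sg: "simple_graph V E" and vw: "{v, w} \<in> E"
    and u: "u \<notin> V" and inf: "infinite (UNIV :: 'a set)"
  shows "planar_graph (insert u V) (insert {v, u} E)"
proof -
  have fin: "finite V" using sg by (simp add: simple_graph_def)
  obtain t where t: "t \<notin> V" "t \<noteq> u"
    using ex_new_if_finite[OF inf, of "insert u V"] fin by auto
  have ne: "v \<noteq> w" "v \<in> V" "w \<in> V" using sg vw by (auto simp: simple_graph_def)
  have EV: "e \<subseteq> V" "card e = 2" if "e \<in> E" for e using sg that by (auto simp: simple_graph_def)
  let ?E = "E - {{v, w}} \<union> {{v, t}, {t, w}, {t, u}}"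
  have "planar_graph (V \<union> {t, u}) ?E"
    by (rule planar_graph_subdivide_leaf[OF pl sg vw t(1) u t(2)])
  moreover have "simple_graph (V \<union> {t, u}) ?E"
  proof -
    have "t \<noteq> v" "t \<noteq> w" using ne t by auto
    then have "card {v, t} = 2" "card {t, w} = 2" "card {t, u} = 2" using t by auto
    then show ?thesis using fin EV ne t u by (auto simp: simple_graph_def)
  qed
  ultimately have "planar_graph (V \<union> {t, u} - {t}) (contract ?E v t)"
    by (rule planar_graph_contract) simp
  moreover have "V \<union> {t, u} - {t} = insert u V" using t u by auto
  moreover have "contract ?E v t = insert {v, u} E"
  proof -
    have tE: "{t, z} \<in> ?E \<longleftrightarrow> z \<in> {v, w, u}" for z
      using EV(1)[of "{t, z}"] t by (auto simp: doubleton_eq_iff)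
    have "{{v, z} | z. {t, z} \<in> ?E \<and> z \<noteq> v} = {{v, w}, {v, u}}"
      unfolding tE using ne u by auto
    moreover have "{e \<in> ?E. t \<notin> e} = E - {{v, w}}" using EV(1) t by auto
    ultimately show ?thesis unfolding contract_def using vw by auto
  qed
  ultimately show ?thesis by simp
qed

section \<open>Sparsity of planar graphs\<close>

definition nbrs :: "'a set set \<Rightarrow> 'a \<Rightarrow> 'a set" where
  "nbrs E v = {u. {v, u} \<in> E}"

lemma in_nbrs_iff: "u \<in> nbrs E v \<longleftrightarrow> {v, u} \<in> E"
  by (simp add: nbrs_def)

lemma nbrs_sym: "u \<in> nbrs E v \<longleftrightarrow> v \<in> nbrs E u"
  by (simp add: nbrs_def insert_commute)

lemma simple_graph_finite:
  assumes "simple_graph V E"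
  shows "finite V" "finite E"
  using assms finite_subset[of E "Pow V"] by (auto simp: simple_graph_def)

lemma simple_graph_edge:
  assumes "simple_graph V E" "{x, y} \<in> E"
  shows "x \<in> V" "y \<in> V" "x \<noteq> y"
  using assms by (auto simp: simple_graph_def)

lemma simple_graph_edgeE:
  assumes "simple_graph V E" "e \<in> E"
  obtains x y where "e = {x, y}" "x \<noteq> y" "x \<in> V" "y \<in> V"
  using assms by (auto simp: simple_graph_def card_2_iff)

lemma nbrs_subset:
  assumes "simple_graph V E"
  shows "nbrs E v \<subseteq> V - {v}" "finite (nbrs E v)"
proof -
  show *: "nbrs E v \<subseteq> V - {v}"
    unfolding nbrs_def using simple_graph_edge[OF assms] by blast
  show "finite (nbrs E v)"
    using finite_subset[OF *] simple_graph_finite(1)[OF assms] by blast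
qed

lemma simple_graph_subgraph:
  assumes "simple_graph V E" "V' \<subseteq> V" "E' \<subseteq> E" "\<And>e. e \<in> E' \<Longrightarrow> e \<subseteq> V'"
  shows "simple_graph V' E'"
  using assms finite_subset[of V' V] by (auto simp: simple_graph_def)

lemma vertex_degree_nbrs:
  assumes "simple_graph V E"
  shows "vertex_degree E v = card (nbrs E v)"
proof -
  have "bij_betw (\<lambda>u. {v, u}) (nbrs E v) {e \<in> E. v \<in> e}"
    unfolding bij_betw_def
  proof
    show "inj_on (\<lambda>u. {v, u}) (nbrs E v)" by (auto simp: inj_on_def doubleton_eq_iff)
    show "(\<lambda>u. {v, u}) ` nbrs E v = {e \<in> E. v \<in> e}"
    proof
      show "{e \<in> E. v \<in> e} \<subseteq> (\<lambda>u. {v, u}) ` nbrs E v"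
      proof
        fix e assume e: "e \<in> {e \<in> E. v \<in> e}"
        then obtain x y where "e = {x, y}" using simple_graph_edgeE[OF assms] by (metis mem_Collect_eq)
        then show "e \<in> (\<lambda>u. {v, u}) ` nbrs E v" using e by (auto simp: nbrs_def insert_commute)
      qed
    qed (auto simp: nbrs_def)
  qed
  then show ?thesis unfolding vertex_degree_def by (rule bij_betw_same_card[symmetric])
qed

lemma sum_vertex_degree:
  assumes "simple_graph V E"
  shows "(\<Sum>v\<in>V. vertex_degree E v) = 2 * card E"
proof -
  have "(\<Sum>v\<in>V. vertex_degree E v) = (\<Sum>v\<in>V. \<Sum>e\<in>E. if v \<in> e then 1 else 0)"
    unfolding vertex_degree_def using simple_graph_finite[OF assms]
    by (intro sum.cong refl) (simp add: sum.If_cases Int_def)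
  also have "\<dots> = (\<Sum>e\<in>E. \<Sum>v\<in>V. if v \<in> e then 1 else 0)" by (rule sum.swap)
  also have "\<dots> = (\<Sum>e\<in>E. 2)"
  proof (rule sum.cong)
    fix e assume "e \<in> E"
    then have "e \<subseteq> V" "card e = 2" using assms by (auto simp: simple_graph_def)
    then show "(\<Sum>v\<in>V. if v \<in> e then 1 else 0) = (2::nat)"
      using simple_graph_finite(1)[OF assms] by (simp add: sum.If_cases Int_absorb1)
  qed simp
  finally show ?thesis by simp
qed

lemma nbrs_contract:
  assumes "simple_graph V E" "{x, y} \<in> E"
  shows "nbrs (contract E x y) x = (nbrs E x \<union> nbrs E y) - {x, y}"
proof -
  have "x \<noteq> y" using simple_graph_edge[OF assms] by simp
  moreover have "{x, x} \<notin> E" "{y, y} \<notin> E" using simple_graph_edge[OF assms(1)] by blast+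
  ultimately show ?thesis by (auto simp: contract_def nbrs_def doubleton_eq_iff)
qed

lemma simple_graph_contract:
  assumes "simple_graph V E" "{x, y} \<in> E"
  shows "simple_graph (V - {y}) (contract E x y)"
proof -
  have "z \<in> V \<and> z \<noteq> y" if "{y, z} \<in> E" for z using simple_graph_edge[OF assms(1) that] by auto
  then show ?thesis
    using assms simple_graph_edge[OF assms] by (auto simp: simple_graph_def contract_def)
qed

text \<open>Lost are the edge \<open>{x, y}\<close> and, for each common neighbour, one of two edges
  that become parallel.\<close>

lemma card_contract:
  assumes "simple_graph V E" "{x, y} \<in> E"
  shows "card E \<le> card (contract E x y) + 1 + card (nbrs E x \<inter> nbrs E y)"
proof -
  let ?A = "{e \<in> E. y \<notin> e}" let ?N = "nbrs E y - {x}" let ?T = "nbrs E x \<inter> nbrs E y"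
  have fin: "finite E" "finite ?A" "finite (nbrs E y)" "finite (contract E x y)"
    using simple_graph_finite[OF assms(1)] nbrs_subset[OF assms(1)]
      simple_graph_finite[OF simple_graph_contract[OF assms]] by auto
  have "E = ?A \<union> {e \<in> E. y \<in> e}" by auto
  then have "card E = card ?A + vertex_degree E y"
    unfolding vertex_degree_def using fin(1)
    by (metis (no_types, lifting) card_Un_disjoint disjoint_iff finite_Un mem_Collect_eq)
  also have "vertex_degree E y = card (nbrs E y)" by (rule vertex_degree_nbrs[OF assms(1)])
  also have "\<dots> \<le> card (?N - ?T) + card ?T + 1"
  proof -
    have "nbrs E y = insert x ((?N - ?T) \<union> ?T)" using assms(2) by (auto simp: nbrs_def insert_commute)
    then have "card (nbrs E y) \<le> Suc (card ((?N - ?T) \<union> ?T))" by (metis card_insert_le_m1 card_insert_if fin(3) finite_insert le_SucI order_refl)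
    also have "card ((?N - ?T) \<union> ?T) \<le> card (?N - ?T) + card ?T" by (rule card_Un_le)
    finally show ?thesis by simp
  qed
  finally have 1: "card E \<le> card ?A + card (?N - ?T) + card ?T + 1" by simp
  have inj: "inj_on (\<lambda>z. {x, z}) (?N - ?T)" by (auto simp: inj_on_def doubleton_eq_iff)
  have "?A \<inter> (\<lambda>z. {x, z}) ` (?N - ?T) = {}" by (auto simp: nbrs_def)
  then have "card ?A + card (?N - ?T) = card (?A \<union> (\<lambda>z. {x, z}) ` (?N - ?T))"
    using fin by (simp add: card_Un_disjoint card_image[OF inj])
  also have "\<dots> \<le> card (contract E x y)"
    using fin(4) by (intro card_mono) (auto simp: contract_def nbrs_def)
  finally show ?thesis using 1 by simp
qed

text \<open>Contracting an edge that lies in fewer than \<open>k\<close> triangles does not lower the excess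
  \<open>|E| - k |V|\<close>.\<close>

lemma dense_minor:
  assumes simple: "\<And>V E. P V E \<Longrightarrow> simple_graph V E"
    and contract: "\<And>V E x y. P V E \<Longrightarrow> {x, y} \<in> E \<Longrightarrow> P (V - {y}) (contract E x y)"
    and "P V E" "V \<noteq> {}" "k * card V \<le> card E" "0 < k"
  obtains V' E' where "P V' E'" "E' \<noteq> {}" "\<And>x y. {x, y} \<in> E' \<Longrightarrow> k \<le> card (nbrs E' x \<inter> nbrs E' y)"
  using assms(3-5)
proof (induction "card V" arbitrary: V E thesis rule: less_induct)
  case less
  note sg = simple[OF less.prems(2)]
  have fin: "finite V" "finite E" using simple_graph_finite[OF sg] by auto
  show thesis
  proof (cases "\<forall>x y. {x, y} \<in> E \<longrightarrow> k \<le> card (nbrs E x \<inter> nbrs E y)")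
    case True
    have "card E > 0" using less.prems(3,4) \<open>0 < k\<close> fin by (metis card_gt_0_iff le_trans mult_pos_pos not_gr_zero le_zero_eq)
    then show thesis using less.prems(1)[of V E] less.prems(2) True by (metis card.empty less_irrefl)
  next
    case False
    then obtain x y where xy: "{x, y} \<in> E" "card (nbrs E x \<inter> nbrs E y) < k" by force
    note ne = simple_graph_edge[OF sg xy(1)]
    have c: "card (V - {y}) = card V - 1" "card V > 0" using ne fin by (auto simp: card_gt_0_iff)
    have "card E \<le> card (contract E x y) + k" using card_contract[OF sg xy(1)] xy(2) by simp
    then have "k * card (V - {y}) \<le> card (contract E x y)"
      using less.prems(4) c by (simp add: diff_mult_distrib2)
    moreover have "card (V - {y}) < card V" "V - {y} \<noteq> {}" using c ne by auto
    moreover have "P (V - {y}) (contract E x y)" using contract less.prems(2) xy(1) by blast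
    ultimately show thesis using less.hyps less.prems(1) by blast
  qed
qed

definition star :: "'a \<Rightarrow> 'a set \<Rightarrow> 'a set set" where
  "star v S = (\<lambda>x. {v, x}) ` S"

lemma simple_graph_star:
  assumes "simple_graph W F" "v \<notin> W" "S \<subseteq> W"
  shows "simple_graph (insert v W) (F \<union> star v S)"
  using assms by (auto simp: simple_graph_def star_def card_insert_if)

text \<open>A minor in which every edge lies in six triangles has a vertex \<open>v\<close> whose link is dense enough for a
  minor with an edge \<open>xy\<close> in three triangles; together with \<open>v\<close> these form a \<open>K\<^bsub>3,3\<^esub>\<close>.\<close>

lemma planar_card_edges_less:
  fixes V :: "'a set"
  assumes sg: "simple_graph V E" and pl: "planar_graph V E" and ne: "V \<noteq> {}"
  shows "card E < 6 * card V"
proof (rule ccontr)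
  assume "\<not> card E < 6 * card V"
  then have "6 * card V \<le> card E" by simp
  obtain V1 :: "'a set" and E1 where 1: "simple_graph V1 E1 \<and> planar_graph V1 E1" "E1 \<noteq> {}"
    "\<And>x y. {x, y} \<in> E1 \<Longrightarrow> 6 \<le> card (nbrs E1 x \<inter> nbrs E1 y)"
  proof (rule dense_minor[of "\<lambda>V E. simple_graph V E \<and> planar_graph V E" V E 6])
    fix V' E' assume "simple_graph V' E' \<and> planar_graph V' (E' :: 'a set set)" "E' \<noteq> {}"
      "\<And>x y. {x, y} \<in> E' \<Longrightarrow> 6 \<le> card (nbrs E' x \<inter> nbrs E' y)"
    then show thesis by (rule that)
  qed (use sg pl ne \<open>6 * card V \<le> card E\<close> in \<open>auto simp: simple_graph_contract planar_graph_contract\<close>)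
  note sg1 = conjunct1[OF 1(1)] and pl1 = conjunct2[OF 1(1)]
  obtain v w where vw: "{v, w} \<in> E1" using 1(2) simple_graph_edgeE[OF sg1] by (metis ex_in_conv)
  define N where "N = nbrs E1 v"
  define F where "F = {e \<in> E1. e \<subseteq> N}"
  have "w \<in> N" using vw by (simp add: N_def in_nbrs_iff)
  then have N: "finite N" "v \<notin> N" "N \<subseteq> V1" "N \<noteq> {}"
    using nbrs_subset[OF sg1, of v] unfolding N_def by blast+
  have sgF: "simple_graph N F" by (rule simple_graph_subgraph[OF sg1]) (use N in \<open>auto simp: F_def\<close>)
  \<comment> \<open>Triangles on \<open>{v, x}\<close> become neighbours of \<open>x\<close> in the
    link. Six are asked for because the handshake lemma halves them, and \<open>3 * card N\<close>
    edges is the density needed for the second minor.\<close>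
  have "6 \<le> vertex_degree F x" if "x \<in> N" for x
  proof -
    have "nbrs E1 v \<inter> nbrs E1 x \<subseteq> nbrs F x" using that by (auto simp: F_def N_def nbrs_def)
    then have "card (nbrs E1 v \<inter> nbrs E1 x) \<le> card (nbrs F x)"
      using nbrs_subset[OF sgF] by (intro card_mono) auto
    then show ?thesis using 1(3)[of v x] that vertex_degree_nbrs[OF sgF, of x] by (simp add: N_def in_nbrs_iff)
  qed
  then have "6 * card N \<le> 2 * card F"
    using sum_vertex_degree[OF sgF] sum_bounded_below[of N 6 "vertex_degree F"] by simp
  then have cF: "3 * card N \<le> card F" by simp
  \<comment> \<open>The second minor is formed in the link alone, but planarity is tracked for the
    cone with apex \<open>v\<close>: contracting \<open>y\<close> into \<open>x\<close> in the cone
    merges their two spokes, so the result is again a cone.\<close>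
  define P where "P = (\<lambda>W F. simple_graph W F \<and> v \<notin> W \<and> planar_graph (insert v W) (F \<union> star v W))"
  have P1: "P N F" unfolding P_def
  proof (intro conjI)
    have "v \<in> V1" using simple_graph_edge[OF sg1 vw] by simp
    then show "planar_graph (insert v N) (F \<union> star v N)"
      using N by (intro planar_graph_subgraph[OF pl1]) (auto simp: F_def star_def N_def nbrs_def)
  qed (use sgF N in auto)
  have P2: "P (W - {y}) (contract F x y)" if "P W F" "{x, y} \<in> F" for W F x y
  proof -
    have W: "simple_graph W F" "v \<notin> W" "planar_graph (insert v W) (F \<union> star v W)" using that by (auto simp: P_def)
    note ne = simple_graph_edge[OF W(1) that(2)]
    have "contract (F \<union> star v W) x y = contract F x y \<union> star v (W - {y})"
    proof -
      have "{e \<in> F \<union> star v W. y \<notin> e} = {e \<in> F. y \<notin> e} \<union> star v (W - {y})"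
        using W(2) ne by (auto simp: star_def)
      moreover have "{y, z} \<in> F \<union> star v W \<longleftrightarrow> {y, z} \<in> F \<or> z = v" for z
        using W(2) ne by (auto simp: star_def doubleton_eq_iff)
      moreover have "{x, v} \<in> star v (W - {y})" using ne by (auto simp: star_def)
      ultimately show ?thesis unfolding contract_def by auto
    qed
    moreover have "planar_graph (insert v W - {y}) (contract (F \<union> star v W) x y)"
      using simple_graph_star[OF W(1,2)] W(3) that(2) by (intro planar_graph_contract) auto
    moreover have "insert v W - {y} = insert v (W - {y})" using W(2) ne by auto
    ultimately show ?thesis unfolding P_def using simple_graph_contract[OF W(1) that(2)] W(2) by auto
  qed
  obtain W F' where 2: "P W F'" "F' \<noteq> {}" "\<And>x y. {x, y} \<in> F' \<Longrightarrow> 3 \<le> card (nbrs F' x \<inter> nbrs F' y)"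
    by (rule dense_minor[of P N F 3]) (use P1 P2 N cF in \<open>auto simp: P_def\<close>)
  then have W: "simple_graph W F'" "v \<notin> W" "planar_graph (insert v W) (F' \<union> star v W)" by (auto simp: P_def)
  obtain x y where xy: "{x, y} \<in> F'" using 2(2) simple_graph_edgeE[OF W(1)] by (metis ex_in_conv)
  obtain B where B: "B \<subseteq> nbrs F' x \<inter> nbrs F' y" "card B = 3" "finite B"
    using obtain_subset_with_card_n[OF 2(3)[OF xy]] by metis
  obtain b where b: "bij_betw b {0..<3::nat} B" using ex_bij_betw_nat_finite[OF B(3)] B(2) by metis
  then have bB: "b i \<in> nbrs F' x \<inter> nbrs F' y" if "i < 3" for i
    using B(1) that by (auto simp: bij_betw_def)
  note ne = simple_graph_edge[OF W(1) xy]
  have b': "{x, b i} \<in> F'" "{y, b i} \<in> F'" "b i \<in> W - {x, y}" if "i < 3" for i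
    using bB[OF that] nbrs_subset[OF W(1), of x] nbrs_subset[OF W(1), of y]
    unfolding in_nbrs_iff[symmetric] by blast+
  show False
  proof (rule K33_not_planar[OF W(3), of x y v b])
    show "inj_on b {..<3}" using b by (simp add: bij_betw_def lessThan_atLeast0)
    show "b i \<notin> {x, y, v}" if "i < 3" for i using b'(3)[OF that] W(2) by auto
    show "{s, b i} \<in> F' \<union> star v W" if "i < 3" "s \<in> {x, y, v}" for i s
      using b'[OF that(1)] that(2) by (auto simp: star_def)
  qed (use simple_graph_star[OF W(1,2)] ne W(2) in auto)
qed

lemma planar_card_edges_le:
  assumes "simple_graph V E" "planar_graph V E"
  shows "card E \<le> 6 * card V"
proof (cases "V = {}")
  case True
  then have "E = {}" using assms(1) by (auto simp: simple_graph_def)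
  then show ?thesis by simp
qed (use planar_card_edges_less[OF assms] in simp)

definition cliques :: "'a set \<Rightarrow> 'a set set \<Rightarrow> 'a set set" where
  "cliques V E = {C. C \<subseteq> V \<and> (\<forall>x\<in>C. \<forall>y\<in>C. x \<noteq> y \<longrightarrow> {x, y} \<in> E)}"

text \<open>By the edge bound the average degree is below 12, so some vertex has degree at most 11.
  It lies in at most \<open>2 ^ 11\<close> cliques, one for each subset of its neighbourhood, and is
  then deleted. The summand 1 is the empty clique.\<close>

lemma planar_card_cliques_le:
  assumes "simple_graph V E" "planar_graph V E"
  shows "card (cliques V E) \<le> 2 ^ 11 * card V + 1"
  using assms
proof (induction "card V" arbitrary: V E)
  case 0
  then have "V = {}" using simple_graph_finite by force
  then have "cliques V E = {{}}" by (auto simp: cliques_def)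
  then show ?case by simp
next
  case (Suc n)
  note fin = simple_graph_finite[OF Suc.prems(1)]
  have "V \<noteq> {}" using Suc.hyps(2) by auto
  have "\<exists>v\<in>V. vertex_degree E v \<le> 11"
  proof (rule ccontr)
    assume "\<not> (\<exists>v\<in>V. vertex_degree E v \<le> 11)"
    then have "12 \<le> vertex_degree E v" if "v \<in> V" for v using that by force
    then have "12 * card V \<le> 2 * card E"
      using sum_vertex_degree[OF Suc.prems(1)] sum_bounded_below[of V 12 "vertex_degree E"] by simp
    then show False using planar_card_edges_less[OF Suc.prems \<open>V \<noteq> {}\<close>] by simp
  qed
  then obtain v where v: "v \<in> V" "vertex_degree E v \<le> 11" by blast
  let ?E = "{e \<in> E. v \<notin> e}"
  have EV: "e \<subseteq> V - {v}" if "e \<in> ?E" for e using Suc.prems(1) that by (auto simp: simple_graph_def)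
  have sg': "simple_graph (V - {v}) ?E" and pl': "planar_graph (V - {v}) ?E"
    by (rule simple_graph_subgraph[OF Suc.prems(1)] planar_graph_subgraph[OF Suc.prems(2)];
        use EV in blast)+
  have IH: "card (cliques (V - {v}) ?E) \<le> 2 ^ 11 * card (V - {v}) + 1"
    using Suc.hyps(2) v(1) fin by (intro Suc.hyps(1)[OF _ sg' pl']) simp
  have "cliques V E \<subseteq> cliques (V - {v}) ?E \<union> insert v ` Pow (nbrs E v)"
  proof
    fix C assume C: "C \<in> cliques V E"
    show "C \<in> cliques (V - {v}) ?E \<union> insert v ` Pow (nbrs E v)"
    proof (cases "v \<in> C")
      case True
      then have "C = insert v (C - {v})" "C - {v} \<subseteq> nbrs E v" using C by (auto simp: cliques_def nbrs_def)
      then show ?thesis by blast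
    next
      case False
      then show ?thesis using C by (auto simp: cliques_def)
    qed
  qed
  moreover have "finite (cliques (V - {v}) ?E)" using fin by (auto simp: cliques_def intro: finite_subset[of _ "Pow V"])
  moreover have "finite (insert v ` Pow (nbrs E v))" using nbrs_subset[OF Suc.prems(1)] by simp
  ultimately have "card (cliques V E) \<le> card (cliques (V - {v}) ?E) + card (insert v ` Pow (nbrs E v))"
    by (meson card_Un_le card_mono finite_UnI order_trans)
  also have "card (insert v ` Pow (nbrs E v)) \<le> 2 ^ vertex_degree E v"
    using card_image_le[of "Pow (nbrs E v)" "insert v"] nbrs_subset[OF Suc.prems(1)]
    by (simp add: vertex_degree_nbrs[OF Suc.prems(1)] card_Pow)
  also have "(2::nat) ^ vertex_degree E v \<le> 2 ^ 11" using v(2) by (rule power_increasing) simp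
  finally show ?case using IH Suc.hyps(2) v(1) fin by simp
qed

text \<open>As long as some \<open>u \<in> I\<close> has non-adjacent neighbours, contracting \<open>u\<close> into one of them creates an edge
  inside \<open>H\<close>; afterwards the neighbourhoods are distinct cliques of \<open>H\<close>.\<close>

lemma card_distinct_nbrs_le:
  assumes "simple_graph (H \<union> I) E" "planar_graph (H \<union> I) E" "H \<inter> I = {}"
    "\<And>u. u \<in> I \<Longrightarrow> nbrs E u \<subseteq> H" "inj_on (nbrs E) I"
  shows "card I + card {e \<in> E. e \<subseteq> H} \<le> 6 * card H + (2 ^ 11 * card H + 1)"
  using assms
proof (induction "card I" arbitrary: I E rule: less_induct)
  case less
  note sg = less.prems(1) and pl = less.prems(2)
  have fin: "finite H" "finite I" using simple_graph_finite[OF sg] by auto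
  let ?EH = "\<lambda>E. {e \<in> E. e \<subseteq> H}"
  have sgH: "simple_graph H (?EH E)" and plH: "planar_graph H (?EH E)"
    using sg pl by (auto intro: simple_graph_subgraph planar_graph_subgraph)
  show ?case
  proof (cases "\<forall>u\<in>I. nbrs E u \<in> cliques H (?EH E)")
    case True
    have "finite (cliques H (?EH E))"
      using fin by (auto simp: cliques_def intro: finite_subset[of _ "Pow H"])
    then have "card I \<le> card (cliques H (?EH E))"
      using True less.prems(5) by (intro card_inj_on_le) auto
    then show ?thesis using planar_card_cliques_le[OF sgH plH] planar_card_edges_le[OF sgH plH] by simp
  next
    case False
    then obtain u where u: "u \<in> I" "nbrs E u \<notin> cliques H (?EH E)" by blast
    then obtain x y where xy: "x \<in> nbrs E u" "y \<in> nbrs E u" "x \<noteq> y" "{x, y} \<notin> E"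
      using less.prems(4)[OF u(1)] by (auto simp: cliques_def)
    have xH: "x \<in> H" "y \<in> H" using xy less.prems(4)[OF u(1)] by auto
    have xu: "{x, u} \<in> E" using xy by (simp add: nbrs_def insert_commute)
    let ?E = "contract E x u"
    have V: "H \<union> I - {u} = H \<union> (I - {u})" using less.prems(3) u by auto
    have nb: "nbrs ?E w = nbrs E w" if "w \<in> I - {u}" for w
    proof -
      have "w \<notin> H" "w \<noteq> x" using that less.prems(3) xH by auto
      moreover have "z \<in> H" if "{u, z} \<in> E" for z using less.prems(4)[OF u(1)] that by (auto simp: nbrs_def)
      moreover have "u \<notin> nbrs E w" using less.prems(4)[of w] that less.prems(3) u by auto
      ultimately show ?thesis using that by (auto simp: nbrs_def contract_def doubleton_eq_iff)
    qed
    have IH: "card (I - {u}) + card (?EH ?E) \<le> 6 * card H + (2 ^ 11 * card H + 1)"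
    proof (rule less.hyps)
      show "card (I - {u}) < card I" using u fin by (meson card_Diff1_less)
      show "simple_graph (H \<union> (I - {u})) ?E" using simple_graph_contract[OF sg xu] V by simp
      show "planar_graph (H \<union> (I - {u})) ?E" using planar_graph_contract[OF pl sg xu] V by simp
      show "H \<inter> (I - {u}) = {}" using less.prems(3) by auto
      show "nbrs ?E w \<subseteq> H" if "w \<in> I - {u}" for w using nb[OF that] less.prems(4) that by auto
      show "inj_on (nbrs ?E) (I - {u})" using nb less.prems(5) by (auto simp: inj_on_def)
    qed
    \<comment> \<open>One vertex of \<open>I\<close> is traded for at least one new edge inside
      \<open>H\<close>, so the left-hand side of the claim does not drop.\<close>
    have "insert {x, y} (?EH E) \<subseteq> ?EH ?E"
      using xH xy u less.prems(3) by (auto simp: contract_def nbrs_def)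
    moreover have "finite (?EH ?E)" using simple_graph_finite[OF simple_graph_contract[OF sg xu]] by simp
    ultimately have "card (insert {x, y} (?EH E)) \<le> card (?EH ?E)" by (rule card_mono[rotated])
    moreover have "card (insert {x, y} (?EH E)) = Suc (card (?EH E))"
      using xy simple_graph_finite[OF sg] by simp
    moreover have "Suc (card (I - {u})) = card I" using u fin by (metis card_Suc_Diff1)
    ultimately show ?thesis using IH by simp
  qed
qed

section \<open>The growth of the number of connected planar graphs\<close>

text \<open>Here \<open>u\<close> is the vertex that disappears into \<open>w\<close>. Both degrees
  are bounded so that the merged vertex has at most \<open>2 * D\<close> neighbours, which bounds
  the number of ways to split it again.\<close>

definition contractible_into :: "nat \<Rightarrow> 'a set set \<Rightarrow> 'a \<Rightarrow> 'a \<Rightarrow> bool" where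
  "contractible_into D E u w \<longleftrightarrow> {w, u} \<in> E \<and> card (nbrs E u) \<le> D \<and> card (nbrs E w) \<le> D"

text \<open>In a simple graph this forces \<open>u\<close> and \<open>w\<close> to be non-adjacent,
  so deleting \<open>u\<close> leaves the neighbourhood of \<open>w\<close> intact.\<close>

definition twins :: "'a set set \<Rightarrow> 'a \<Rightarrow> 'a \<Rightarrow> bool" where
  "twins E u w \<longleftrightarrow> u \<noteq> w \<and> nbrs E u = nbrs E w"

text \<open>The bound on \<open>D\<close> makes at most one vertex in \<open>10000\<close> have degree above \<open>D\<close>, which beats the factor
  \<open>6 + 2\<^sup>1\<^sup>1\<close> from the previous estimate.\<close>

lemma card_reducible_vertices_ge:
  assumes sg: "simple_graph V E" and pl: "planar_graph V E" and n: "100 \<le> card V" and D: "120000 \<le> D"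
  shows "card V \<le> 2 * card {u \<in> V. \<exists>w\<in>V. contractible_into D E u w \<or> twins E u w}"
proof -
  define M where "M = {u \<in> V. \<exists>w\<in>V. contractible_into D E u w \<or> twins E u w}"
  define H where "H = {v \<in> V. D < card (nbrs E v)}"
  define I where "I = V - H - M"
  have fin: "finite V" "finite M" "finite H" "finite I"
    using simple_graph_finite[OF sg] by (auto simp: M_def H_def I_def)
  have "(\<Sum>v\<in>H. D) \<le> (\<Sum>v\<in>H. card (nbrs E v))" by (intro sum_mono) (auto simp: H_def)
  also have "\<dots> \<le> (\<Sum>v\<in>V. card (nbrs E v))" using fin by (intro sum_mono2) (auto simp: H_def)
  also have "\<dots> = 2 * card E" using sum_vertex_degree[OF sg] by (simp add: vertex_degree_nbrs[OF sg])
  also have "\<dots> \<le> 12 * card V" using planar_card_edges_le[OF sg pl] by simp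
  finally have "card H * D \<le> 12 * card V" by simp
  moreover have "card H * 120000 \<le> card H * D" using D by simp
  ultimately have h: "10000 * card H \<le> card V" by linarith
  let ?W = "H \<union> I" let ?E = "{e \<in> E. e \<subseteq> H \<union> I}"
  \<comment> \<open>A vertex of \<open>I\<close> has degree at most \<open>D\<close>, so a neighbour
    of degree at most \<open>D\<close> would make it reducible. Likewise the absence of twins will
    make the neighbourhoods distinct.\<close>
  have nI: "nbrs E u \<subseteq> H" if "u \<in> I" for u
  proof
    fix w assume "w \<in> nbrs E u"
    then have wu: "{w, u} \<in> E" by (simp add: nbrs_def insert_commute)
    moreover have "w \<in> V" using simple_graph_edge[OF sg wu] by simp
    ultimately show "w \<in> H" using that by (auto simp: I_def H_def M_def contractible_into_def)
  qed
  then have nI': "nbrs ?E u = nbrs E u" if "u \<in> I" for u using that by (auto simp: nbrs_def)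
  have "card I + card {e \<in> ?E. e \<subseteq> H} \<le> 6 * card H + (2 ^ 11 * card H + 1)"
  proof (rule card_distinct_nbrs_le)
    show "simple_graph ?W ?E" by (rule simple_graph_subgraph[OF sg]) (auto simp: H_def I_def)
    show "planar_graph ?W ?E" by (rule planar_graph_subgraph[OF pl]) (auto simp: H_def I_def)
    show "inj_on (nbrs ?E) I" using nI' by (auto simp: inj_on_def I_def M_def twins_def)
  qed (use nI nI' in \<open>auto simp: I_def\<close>)
  then have "card I \<le> 2054 * card H + 1" by simp
  moreover have "card V \<le> card H + card I + card M"
  proof -
    have "V \<subseteq> H \<union> I \<union> M" by (auto simp: I_def)
    then have "card V \<le> card (H \<union> I \<union> M)" using fin by (intro card_mono) auto
    also have "\<dots> \<le> card H + card I + card M" by (meson card_Un_le add_le_mono1 order_trans)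
    finally show ?thesis .
  qed
  \<comment> \<open>\<open>H\<close> and \<open>I\<close> together have at most
    \<open>2055 * card H + 1\<close> elements, where \<open>card H\<close> is at most a 10000th of
    \<open>card V\<close>; this is less than half of \<open>card V\<close> once
    \<open>card V\<close> is 100 or more.\<close>
  ultimately show ?thesis using h n unfolding M_def by linarith
qed

text \<open>The map \<open>r\<close> carries walks to walks, with some steps possibly becoming
  stationary. Contraction and deletion of a twin are both retractions of this kind.\<close>

lemma connected_graph_retract:
  assumes conn: "connected_graph V E" and V': "V' \<subseteq> V" "V' \<noteq> {}"
    and r: "\<And>v. v \<in> V' \<Longrightarrow> r v = v" "\<And>x y. {x, y} \<in> E \<Longrightarrow> r x = r y \<or> {r x, r y} \<in> E'"
  shows "connected_graph V' E'"
  unfolding connected_graph_def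
proof (intro conjI ballI)
  fix u v assume uv: "u \<in> V'" "v \<in> V'"
  then have "(u, v) \<in> {(x, y). {x, y} \<in> E}\<^sup>*" using conn V' by (auto simp: connected_graph_def)
  then have "(r u, r v) \<in> {(x, y). {x, y} \<in> E'}\<^sup>*"
  proof (induction rule: rtrancl_induct)
    case (step y z)
    then have "r y = r z \<or> (r y, r z) \<in> {(x, y). {x, y} \<in> E'}" using r(2) by auto
    then show ?case
    proof
      assume "(r y, r z) \<in> {(x, y). {x, y} \<in> E'}"
      with step.IH show ?thesis by (rule rtrancl_into_rtrancl)
    qed (use step.IH in simp)
  qed simp
  then show "(u, v) \<in> {(x, y). {x, y} \<in> E'}\<^sup>*" using r(1) uv by simp
qed (rule V'(2))

lemma connected_graph_contract:
  assumes "connected_graph V E" "simple_graph V E" "{x, y} \<in> E"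
  shows "connected_graph (V - {y}) (contract E x y)"
proof (rule connected_graph_retract[OF assms(1), of _ "\<lambda>v. if v = y then x else v"])
  note ne = simple_graph_edge[OF assms(2,3)]
  show "V - {y} \<noteq> {}" using ne by auto
  show "(if a = y then x else a) = (if b = y then x else b) \<or>
      {if a = y then x else a, if b = y then x else b} \<in> contract E x y" if "{a, b} \<in> E" for a b
    using that ne by (auto simp: contract_def insert_commute)
qed auto

lemma connected_graph_delete_twin:
  assumes "connected_graph V E" "simple_graph V E" "twins E u w" "w \<in> V"
  shows "connected_graph (V - {u}) {e \<in> E. u \<notin> e}"
proof (rule connected_graph_retract[OF assms(1), of _ "\<lambda>v. if v = u then w else v"])
  have ne: "u \<noteq> w" "nbrs E u = nbrs E w" using assms(3) by (auto simp: twins_def)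
  show "V - {u} \<noteq> {}" using ne assms(4) by auto
  show "(if a = u then w else a) = (if b = u then w else b) \<or>
      {if a = u then w else a, if b = u then w else b} \<in> {e \<in> E. u \<notin> e}" if ab: "{a, b} \<in> E" for a b
  proof -
    have *: "{w, b} \<in> E" if "{u, b} \<in> E" for b using ne that by (auto simp: nbrs_def)
    have "a \<noteq> b" using simple_graph_edge[OF assms(2) ab] by simp
    then show ?thesis using ab *[of b] *[of a] ne by (auto simp: insert_commute)
  qed
qed auto

lemma connected_graph_add_leaf:
  assumes "connected_graph V E" "v \<in> V"
  shows "connected_graph (insert s V) (insert {v, s} E)"
proof -
  let ?R = "{(x, y). {x, y} \<in> insert {v, s} E}"
  have mono: "{(x, y). {x, y} \<in> E}\<^sup>* \<subseteq> ?R\<^sup>*" by (rule rtrancl_mono) auto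
  have tov: "(a, v) \<in> ?R\<^sup>* \<and> (v, a) \<in> ?R\<^sup>*" if "a \<in> insert s V" for a
  proof (cases "a = s")
    case True
    then show ?thesis by (auto simp: insert_commute)
  next
    case False
    then show ?thesis using assms that mono by (auto simp: connected_graph_def)
  qed
  then show ?thesis unfolding connected_graph_def by (meson insert_not_empty rtrancl_trans)
qed

text \<open>Indexed by the vertex set instead of its size, since the reductions delete an arbitrary
  vertex; relabelling leads back to \<open>{1..n}\<close>.\<close>

definition conn_planar :: "'a set \<Rightarrow> 'a set set set" where
  "conn_planar V = {E. simple_graph V E \<and> connected_graph V E \<and> planar_graph V E}"

lemma finite_conn_planar: "finite V \<Longrightarrow> finite (conn_planar V)"
  by (rule finite_subset[of _ "Pow (Pow V)"]) (auto simp: conn_planar_def simple_graph_def)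

lemma card_le_fibers:
  assumes "finite B" "f ` A \<subseteq> B" "\<And>b. b \<in> B \<Longrightarrow> finite {a \<in> A. f a = b} \<and> card {a \<in> A. f a = b} \<le> k"
  shows "card A \<le> k * card B"
proof -
  have "A = (\<Union>b\<in>B. {a \<in> A. f a = b})" using assms(2) by auto
  then have "card A \<le> (\<Sum>b\<in>B. card {a \<in> A. f a = b})" using card_UN_le[OF assms(1)] by metis
  also have "\<dots> \<le> (\<Sum>b\<in>B. k)" by (intro sum_mono) (use assms in auto)
  finally show ?thesis by (simp add: mult.commute)
qed

text \<open>A member of the fibre over \<open>E'\<close> is determined by its edges at
  \<open>u\<close> or \<open>w\<close>. Besides \<open>{u, w}\<close> these join \<open>u\<close> or
  \<open>w\<close> to one of the at most \<open>2 * D\<close> neighbours of \<open>w\<close> in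
  \<open>E'\<close>, which leaves at most \<open>4 * D + 1\<close> candidate pairs.\<close>

lemma card_contractible_le:
  assumes "finite V"
  shows "card {E \<in> conn_planar V. contractible_into D E u w} \<le> 2 ^ (4 * D + 2) * card (conn_planar (V - {u}))"
proof (rule card_le_fibers[where f = "\<lambda>E. contract E w u"])
  show "finite (conn_planar (V - {u}))" using assms finite_conn_planar[of "V - {u}"] by simp
  show "(\<lambda>E. contract E w u) ` {E \<in> conn_planar V. contractible_into D E u w} \<subseteq> conn_planar (V - {u})"
    by (auto simp: conn_planar_def contractible_into_def simple_graph_contract planar_graph_contract connected_graph_contract)
  fix E' assume "E' \<in> conn_planar (V - {u})"
  let ?A = "{E \<in> {E \<in> conn_planar V. contractible_into D E u w}. contract E w u = E'}"
  show "finite ?A \<and> card ?A \<le> 2 ^ (4 * D + 2)"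
  proof
    show "finite ?A" using finite_conn_planar[OF assms] by simp
    show "card ?A \<le> 2 ^ (4 * D + 2)"
    proof (cases "?A = {}")
      case False
      \<comment> \<open>A single member of the fibre bounds the degree of \<open>w\<close> in
        \<open>E'\<close>, and with it the choices for all members.\<close>
      then obtain E0 where E0: "E0 \<in> conn_planar V" "contractible_into D E0 u w" "contract E0 w u = E'" by blast
      have sg0: "simple_graph V E0" using E0 by (simp add: conn_planar_def)
      have "nbrs E' w \<subseteq> nbrs E0 w \<union> nbrs E0 u"
        using nbrs_contract[OF sg0, of w u] E0 by (auto simp: contractible_into_def)
      then have "card (nbrs E' w) \<le> card (nbrs E0 w \<union> nbrs E0 u)"
        using nbrs_subset[OF sg0] by (intro card_mono) auto
      also have "\<dots> \<le> card (nbrs E0 w) + card (nbrs E0 u)" by (rule card_Un_le)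
      finally have cN: "card (nbrs E' w) \<le> 2 * D" using E0(2) by (simp add: contractible_into_def)
      have finN: "finite (nbrs E' w)"
        using \<open>E' \<in> conn_planar (V - {u})\<close> nbrs_subset by (auto simp: conn_planar_def)
      let ?S = "insert {u, w} ((\<lambda>z. {w, z}) ` nbrs E' w \<union> (\<lambda>z. {u, z}) ` nbrs E' w)"
      have "card ?S \<le> Suc (card ((\<lambda>z. {w, z}) ` nbrs E' w \<union> (\<lambda>z. {u, z}) ` nbrs E' w))"
        by (rule card_insert_le_m1) auto
      also have "\<dots> \<le> Suc (card (nbrs E' w) + card (nbrs E' w))"
        by (meson Suc_le_mono add_mono card_Un_le card_image_le finN order_trans)
      finally have cS: "card ?S \<le> 4 * D + 1" using cN by simp
      have finS: "finite ?S" using finN by simp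
      let ?f = "\<lambda>E. {e \<in> E. u \<in> e \<or> w \<in> e}"
      have "card ?A \<le> card (Pow ?S)"
      proof (rule card_inj_on_le[of ?f])
        show "finite (Pow ?S)" using finS by simp
        show "?f ` ?A \<subseteq> Pow ?S"
        proof (intro image_subsetI PowI subsetI)
          fix E e assume "E \<in> ?A" and "e \<in> ?f E"
          then have E: "E \<in> conn_planar V" "contractible_into D E u w" "contract E w u = E'"
            and e: "e \<in> E" "u \<in> e \<or> w \<in> e" by auto
          have sg: "simple_graph V E" using E by (simp add: conn_planar_def)
          have wu: "{w, u} \<in> E" using E by (simp add: contractible_into_def)
          note nc = nbrs_contract[OF sg wu]
          obtain a b where ab: "e = {a, b}" "a = u \<or> a = w"
          proof -
            obtain x y where "e = {x, y}" using simple_graph_edgeE[OF sg e(1)] .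
            then show thesis using that[of x y] that[of y x] e(2) by auto
          qed
          then have "b \<in> nbrs E u \<or> b \<in> nbrs E w" using e(1) by (auto simp: nbrs_def)
          then have "b \<in> {w, u} \<or> b \<in> nbrs E' w" using nc E(3) by auto
          moreover have "a \<noteq> b" using simple_graph_edge(3)[OF sg, of a b] e(1) ab by simp
          ultimately show "e \<in> ?S" using ab by auto
        qed
        show "inj_on ?f ?A"
        proof (rule inj_onI)
          fix E1 E2 assume E: "E1 \<in> ?A" "E2 \<in> ?A" "?f E1 = ?f E2"
          have eq: "E = {e \<in> E'. w \<notin> e} \<union> ?f E" if "E \<in> ?A" for E
            using that by (auto simp: contract_def)
          show "E1 = E2" using eq[OF E(1)] eq[OF E(2)] E(3) by simp
        qed
      qed
      also have "\<dots> = 2 ^ card ?S" by (rule card_Pow[OF finS])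
      also have "\<dots> \<le> 2 ^ (4 * D + 2)" using cS by (intro power_increasing) auto
      finally show ?thesis .
    next
      case True
      show ?thesis unfolding True by simp
    qed
  qed
qed

text \<open>The edges at \<open>u\<close> can be read off from those at \<open>w\<close>, so the
  deletion of \<open>u\<close> is injective for a fixed partner.\<close>

lemma card_twins_le:
  assumes "finite V" "w \<in> V"
  shows "card {E \<in> conn_planar V. twins E u w} \<le> card (conn_planar (V - {u}))"
proof (rule card_inj_on_le[where f = "\<lambda>E. {e \<in> E. u \<notin> e}"])
  show "finite (conn_planar (V - {u}))" using assms finite_conn_planar[of "V - {u}"] by simp
  show "(\<lambda>E. {e \<in> E. u \<notin> e}) ` {E \<in> conn_planar V. twins E u w} \<subseteq> conn_planar (V - {u})"
  proof safe
    fix E assume E: "E \<in> conn_planar V" "twins E u w"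
    then have "simple_graph V E" "planar_graph V E" "connected_graph V E" by (auto simp: conn_planar_def)
    moreover from this have "e \<subseteq> V - {u}" if "e \<in> E" "u \<notin> e" for e using that by (auto simp: simple_graph_def)
    ultimately show "{e \<in> E. u \<notin> e} \<in> conn_planar (V - {u})" unfolding conn_planar_def
      using connected_graph_delete_twin[OF _ _ E(2) assms(2)]
      by (auto intro!: simple_graph_subgraph[of V E "V - {u}"] planar_graph_subgraph[of V E "V - {u}"])
  qed
  show "inj_on (\<lambda>E. {e \<in> E. u \<notin> e}) {E \<in> conn_planar V. twins E u w}"
  proof (rule inj_onI)
    fix E1 E2 assume E: "E1 \<in> {E \<in> conn_planar V. twins E u w}" "E2 \<in> {E \<in> conn_planar V. twins E u w}"
      "{e \<in> E1. u \<notin> e} = {e \<in> E2. u \<notin> e}"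
    have eq: "E = {e \<in> E. u \<notin> e} \<union> (\<lambda>z. {u, z}) ` nbrs {e \<in> E. u \<notin> e} w" if "E \<in> {E \<in> conn_planar V. twins E u w}" for E
    proof -
      have sg: "simple_graph V E" and t: "u \<noteq> w" "nbrs E u = nbrs E w"
        using that by (auto simp: conn_planar_def twins_def)
      have "u \<notin> nbrs E w" using t nbrs_subset[OF sg, of u] by auto
      then have nb: "nbrs {e \<in> E. u \<notin> e} w = nbrs E u" using t by (auto simp: nbrs_def)
      have "{e \<in> E. u \<in> e} = (\<lambda>z. {u, z}) ` nbrs E u"
      proof safe
        fix e assume e: "e \<in> E" "u \<in> e"
        obtain x y where "e = {x, y}" using simple_graph_edgeE[OF sg e(1)] .
        then obtain z where "e = {u, z}" using e(2) by auto
        then show "e \<in> (\<lambda>z. {u, z}) ` nbrs E u" using e by (auto simp: nbrs_def)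
      qed (auto simp: nbrs_def)
      moreover have "E = {e \<in> E. u \<notin> e} \<union> {e \<in> E. u \<in> e}" by auto
      ultimately show ?thesis unfolding nb by simp
    qed
    have "E1 = {e \<in> E2. u \<notin> e} \<union> (\<lambda>z. {u, z}) ` nbrs {e \<in> E2. u \<notin> e} w"
      using eq[OF E(1)] unfolding E(3) .
    also have "\<dots> = E2" using eq[OF E(2)] by (rule sym)
    finally show "E1 = E2" .
  qed
qed

text \<open>Double counting of the pairs of a graph and a reducible vertex \<open>u\<close>. Each
  graph has at least \<open>card V / 2\<close> of them, and each choice of \<open>u\<close> and its
  partner \<open>w\<close> accounts for at most \<open>2 ^ (4 * D + 2) + 1\<close> times
  \<open>C\<close>; one factor \<open>card V\<close> cancels.\<close>

lemma card_conn_planar_reduce: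
  assumes "finite V" "100 \<le> card V" "120000 \<le> D"
    and C: "\<And>u. u \<in> V \<Longrightarrow> card (conn_planar (V - {u})) = C"
  shows "card (conn_planar V) \<le> 2 * (2 ^ (4 * D + 2) + 1) * card V * C"
proof -
  let ?K = "2 ^ (4 * D + 2) :: nat"
  let ?M = "\<lambda>E. {u \<in> V. \<exists>w\<in>V. contractible_into D E u w \<or> twins E u w}"
  let ?B = "\<lambda>u w. {E \<in> conn_planar V. contractible_into D E u w} \<union> {E \<in> conn_planar V. twins E u w}"
  have fin: "finite (conn_planar V)" by (rule finite_conn_planar[OF assms(1)])
  have "card (conn_planar V) * card V = (\<Sum>E\<in>conn_planar V. card V)" by simp
  also have "\<dots> \<le> (\<Sum>E\<in>conn_planar V. 2 * card (?M E))"
    using card_reducible_vertices_ge assms by (intro sum_mono) (auto simp: conn_planar_def)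
  also have "\<dots> = 2 * card (Sigma (conn_planar V) ?M)"
    using fin assms(1) by (simp add: card_SigmaI flip: sum_distrib_left)
  also have "card (Sigma (conn_planar V) ?M) \<le> card (\<Union>u\<in>V. \<Union>w\<in>V. (\<lambda>E. (E, u)) ` ?B u w)"
    using assms(1) fin by (intro card_mono) auto
  also have "\<dots> \<le> (\<Sum>u\<in>V. card (\<Union>w\<in>V. (\<lambda>E. (E, u)) ` ?B u w))" by (rule card_UN_le[OF assms(1)])
  also have "\<dots> \<le> (\<Sum>u\<in>V. \<Sum>w\<in>V. card ((\<lambda>E. (E, u)) ` ?B u w))"
    by (intro sum_mono card_UN_le[OF assms(1)])
  also have "\<dots> \<le> (\<Sum>u\<in>V. \<Sum>w\<in>V. (?K + 1) * C)"
  proof (intro sum_mono)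
    fix u w assume uw: "u \<in> V" "w \<in> V"
    have "card ((\<lambda>E. (E, u)) ` ?B u w) \<le> card (?B u w)" using fin by (intro card_image_le) auto
    also have "\<dots> \<le> card {E \<in> conn_planar V. contractible_into D E u w} + card {E \<in> conn_planar V. twins E u w}"
      by (rule card_Un_le)
    also have "\<dots> \<le> ?K * C + C"
      using card_contractible_le[OF assms(1), of D u w] card_twins_le[OF assms(1) uw(2), of u] C[OF uw(1)]
      by (intro add_mono) auto
    finally show "card ((\<lambda>E. (E, u)) ` ?B u w) \<le> (?K + 1) * C" by simp
  qed
  also have "\<dots> = card V * card V * ((?K + 1) * C)" by simp
  finally have "card (conn_planar V) * card V \<le> 2 * (card V * card V * ((?K + 1) * C))" by simp
  also have "\<dots> = (2 * (?K + 1) * card V * C) * card V" by (simp only: mult_ac)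
  finally have "card (conn_planar V) * card V \<le> (2 * (?K + 1) * card V * C) * card V" .
  moreover have "0 < card V" using assms(2) by simp
  ultimately show ?thesis using mult_le_cancel2 by blast
qed

section \<open>Kemeny's constant and pendant stars\<close>

text \<open>The probability that the walk from \<open>i\<close> avoids \<open>j\<close> in steps 1
  to \<open>t\<close>. First passage probabilities are differences of these tails, and summability
  of the tails gives finite means.\<close>

primrec survival_prob :: "'a set \<Rightarrow> 'a set set \<Rightarrow> 'a \<Rightarrow> nat \<Rightarrow> 'a \<Rightarrow> real" where
  "survival_prob V E j 0 i = 1"
| "survival_prob V E j (Suc t) i = (\<Sum>k\<in>V - {j}. transition_prob E i k * survival_prob V E j t k)"

text \<open>The symmetric operator D - A. Unlike those of I - D^(-1) A, its values sum to zero over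
  the vertices.\<close>

definition laplacian :: "'a set set \<Rightarrow> ('a \<Rightarrow> real) \<Rightarrow> 'a \<Rightarrow> real" where
  "laplacian E x i = (\<Sum>k\<in>nbrs E i. x i - x k)"

text \<open>The value at the target is 0, where \<open>mean_first_passage\<close> would give the
  mean return time. The target comes first so that \<open>hitting_time V E j\<close> is a function
  on the vertices to which \<open>laplacian\<close> applies.\<close>

definition hitting_time :: "'a set \<Rightarrow> 'a set set \<Rightarrow> 'a \<Rightarrow> 'a \<Rightarrow> real" where
  "hitting_time V E j i = (if i = j then 0 else mean_first_passage V E i j)"

lemma laplacian_sum:
  "laplacian E (\<lambda>i. \<Sum>j\<in>A. c j * x j i) i = (\<Sum>j\<in>A. c j * laplacian E (x j) i)"
proof -
  have "laplacian E (\<lambda>i. \<Sum>j\<in>A. c j * x j i) i = (\<Sum>k\<in>nbrs E i. \<Sum>j\<in>A. c j * (x j i - x j k))"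
    by (simp add: laplacian_def sum_subtractf right_diff_distrib)
  also have "\<dots> = (\<Sum>j\<in>A. \<Sum>k\<in>nbrs E i. c j * (x j i - x j k))" by (rule sum.swap)
  finally show ?thesis by (simp add: laplacian_def sum_distrib_left)
qed

lemma laplacian_cong:
  assumes "x i = y i" "\<And>k. k \<in> nbrs E i \<Longrightarrow> x k = y k"
  shows "laplacian E x i = laplacian E y i"
  unfolding laplacian_def using assms by (intro sum.cong) auto

section \<open>Hitting times as solutions of Laplace equations\<close>

locale connected_simple_graph =
  fixes V :: "'a set" and E :: "'a set set"
  assumes sg: "simple_graph V E" and conn: "connected_graph V E" and card_ge2: "2 \<le> card V"
begin

abbreviation deg :: "'a \<Rightarrow> real" where
  "deg i \<equiv> real (card (nbrs E i))"

lemma fin: "finite V" "finite E" "finite (nbrs E i)"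
  using simple_graph_finite[OF sg] nbrs_subset[OF sg] by auto

lemma nbrs_V: "nbrs E i \<subseteq> V - {i}"
  using nbrs_subset[OF sg] by blast

lemma nbrs_nonempty: assumes "i \<in> V" shows "nbrs E i \<noteq> {}"
proof -
  have "card (V - {i}) > 0" using assms card_ge2 fin by simp
  then obtain k where k: "k \<in> V" "k \<noteq> i" by (metis card.empty Diff_iff ex_in_conv less_irrefl singletonI)
  then have "(i, k) \<in> {(x, y). {x, y} \<in> E}\<^sup>*" using conn assms by (auto simp: connected_graph_def)
  then obtain y where "{i, y} \<in> E" using k(2) by (auto elim: converse_rtranclE)
  then show ?thesis by (auto simp: nbrs_def)
qed

lemma deg_pos: "i \<in> V \<Longrightarrow> deg i \<ge> 1"
  using nbrs_nonempty fin(3)[of i] by (simp add: Suc_le_eq card_gt_0_iff)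

lemma sum_deg: "(\<Sum>i\<in>V. deg i) = 2 * real (card E)"
  using sum_vertex_degree[OF sg] by (simp add: vertex_degree_nbrs[OF sg] flip: of_nat_sum)

lemma transition_nonneg: "transition_prob E i k \<ge> 0"
  by (simp add: transition_prob_def)

lemma sum_transition:
  "(\<Sum>k\<in>V. transition_prob E i k * x k) = (\<Sum>k\<in>nbrs E i. x k) / deg i"
proof -
  have "(\<Sum>k\<in>V. transition_prob E i k * x k) = (\<Sum>k\<in>V. if k \<in> nbrs E i then x k / deg i else 0)"
    by (intro sum.cong) (auto simp: transition_prob_def vertex_degree_nbrs[OF sg] nbrs_def)
  also have "\<dots> = (\<Sum>k\<in>V \<inter> nbrs E i. x k / deg i)" using fin by (simp add: sum.inter_restrict)
  also have "V \<inter> nbrs E i = nbrs E i" using nbrs_V by blast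
  finally show ?thesis by (simp add: sum_divide_distrib)
qed

lemma sum_transition_eq_1: "i \<in> V \<Longrightarrow> (\<Sum>k\<in>V. transition_prob E i k) = 1"
  using sum_transition[of i "\<lambda>_. 1"] deg_pos[of i] by simp

lemma first_passage_survival:
  assumes "j \<in> V" "i \<in> V"
  shows "first_passage_prob V E i j (Suc t) = survival_prob V E j t i - survival_prob V E j (Suc t) i"
  using assms(2)
proof (induction t arbitrary: i)
  case 0
  have "(\<Sum>k\<in>V. transition_prob E i k) = transition_prob E i j + (\<Sum>k\<in>V - {j}. transition_prob E i k)"
    using fin assms(1) by (simp add: sum.remove)
  then show ?case using sum_transition_eq_1[OF 0] by simp
next
  case (Suc t)
  have "first_passage_prob V E i j (Suc (Suc t)) = (\<Sum>k\<in>V - {j}. transition_prob E i k *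
      (survival_prob V E j t k - survival_prob V E j (Suc t) k))"
    using Suc.IH by (auto intro!: sum.cong)
  then show ?case by (simp add: right_diff_distrib sum_subtractf)
qed

lemma survival_nonneg: "survival_prob V E j t i \<ge> 0"
  by (induction t arbitrary: i) (auto intro!: sum_nonneg mult_nonneg_nonneg transition_nonneg)

lemma first_passage_nonneg: "first_passage_prob V E i j t \<ge> 0"
  by (induction V E i j t rule: first_passage_prob.induct)
    (auto intro!: sum_nonneg mult_nonneg_nonneg simp: transition_prob_def)

text \<open>With \<open>\<rho>\<close> the distance to \<open>j\<close> and \<open>\<epsilon>\<close> small, \<open>1 - \<epsilon>\<^sup>\<rho>\<close> drops by a positive
  amount in one step of the walk, because some neighbour is nearer to \<open>j\<close>.\<close>

lemma supersolution:
  assumes j: "j \<in> V"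
  obtains g where "\<And>i. i \<in> V \<Longrightarrow> g i \<ge> (0::real)"
    "\<And>i. i \<in> V - {j} \<Longrightarrow> 1 + (\<Sum>k\<in>V - {j}. transition_prob E i k * g k) \<le> g i"
proof -
  define R where "R = {(x, y). {x, y} \<in> E}"
  define \<rho> where "\<rho> = (\<lambda>i. LEAST n. (i, j) \<in> R ^^ n)"
  define N where "N = real (card V)"
  define \<epsilon> where "\<epsilon> = 1 / (2 * N)"
  define M where "M = (\<Sum>i\<in>V. (1 / \<epsilon>) ^ \<rho> i)"
  define g where "g = (\<lambda>i. M * (1 - \<epsilon> ^ \<rho> i))"
  have N: "N \<ge> 2" using card_ge2 by (simp add: N_def)
  have \<epsilon>: "0 < \<epsilon>" "\<epsilon> \<le> 1" using N by (auto simp: \<epsilon>_def)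
  have M: "M \<ge> 0" unfolding M_def using \<epsilon> by (intro sum_nonneg) simp
  have M1: "1 \<le> M * \<epsilon> ^ \<rho> i" if "i \<in> V" for i
  proof -
    have "(1 / \<epsilon>) ^ \<rho> i \<le> M" unfolding M_def using fin that \<epsilon> by (intro member_le_sum) auto
    then show ?thesis using \<epsilon> by (simp add: field_simps)
  qed
  have \<rho>j: "\<rho> j = 0" by (simp add: \<rho>_def)
  have nearer: "\<exists>k\<in>nbrs E i. \<rho> i = Suc (\<rho> k) \<or> \<rho> k < \<rho> i" if i: "i \<in> V" "i \<noteq> j" for i
  proof -
    have "(i, j) \<in> R\<^sup>*" using conn i j by (auto simp: connected_graph_def R_def)
    then have ex: "(i, j) \<in> R ^^ \<rho> i" unfolding \<rho>_def by (metis LeastI rtrancl_imp_relpow)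
    then obtain m where m: "\<rho> i = Suc m" using i by (cases "\<rho> i") auto
    then obtain k where k: "(i, k) \<in> R" "(k, j) \<in> R ^^ m" using ex by (metis relpow_Suc_E2)
    then have "\<rho> k \<le> m" unfolding \<rho>_def by (intro Least_le)
    then show ?thesis using k m by (auto simp: R_def nbrs_def)
  qed
  show thesis
  proof (rule that[of g])
    fix i assume "i \<in> V"
    have "\<epsilon> ^ \<rho> i \<le> 1" using \<epsilon> by (intro power_le_one) auto
    then show "g i \<ge> 0" using M by (simp add: g_def)
  next
    fix i assume i: "i \<in> V - {j}"
    then obtain k0 where k0: "k0 \<in> nbrs E i" "\<rho> k0 < \<rho> i" using nearer[of i] by auto
    let ?P = "transition_prob E i"
    have "k0 \<in> V" using k0 nbrs_V by blast
    have "deg i \<le> N" using card_mono[OF fin(1), of "nbrs E i"] nbrs_V[of i] by (auto simp: N_def)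
    have "2 * \<epsilon> ^ \<rho> i = 2 * \<epsilon> * \<epsilon> ^ (\<rho> i - 1)" using k0(2) by (cases "\<rho> i") auto
    also have "\<dots> = 1 / N * \<epsilon> ^ (\<rho> i - 1)" by (simp add: \<epsilon>_def)
    also have "\<dots> \<le> 1 / deg i * \<epsilon> ^ \<rho> k0"
      using \<open>deg i \<le> N\<close> deg_pos[of i] i k0(2) \<epsilon> N
      by (intro mult_mono power_decreasing divide_left_mono) auto
    also have "\<dots> = ?P k0 * \<epsilon> ^ \<rho> k0"
      using k0(1) by (simp add: transition_prob_def nbrs_def vertex_degree_nbrs[OF sg])
    also have "\<dots> \<le> (\<Sum>k\<in>V. ?P k * \<epsilon> ^ \<rho> k)"
      using \<open>k0 \<in> V\<close> fin transition_nonneg[of i] \<epsilon> by (intro member_le_sum) auto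
    finally have step: "2 * \<epsilon> ^ \<rho> i \<le> (\<Sum>k\<in>V. ?P k * \<epsilon> ^ \<rho> k)" .
    have "(\<Sum>k\<in>V - {j}. ?P k * g k) = (\<Sum>k\<in>V. ?P k * g k)"
      using fin j by (simp add: sum.remove[of V j] g_def \<rho>j)
    also have "\<dots> = M * (\<Sum>k\<in>V. ?P k) - M * (\<Sum>k\<in>V. ?P k * \<epsilon> ^ \<rho> k)"
      by (simp add: g_def sum_distrib_left right_diff_distrib sum_subtractf mult_ac)
    also have "\<dots> \<le> M - M * (2 * \<epsilon> ^ \<rho> i)"
      using mult_left_mono[OF step M] sum_transition_eq_1[of i] i by simp
    finally show "1 + (\<Sum>k\<in>V - {j}. ?P k * g k) \<le> g i"
      using M1[of i] i by (simp add: g_def algebra_simps)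
  qed
qed

text \<open>Comparison principle: the partial sums obey with equality the recursion that
  \<open>g\<close> obeys with an inequality.\<close>

lemma sum_survival_le:
  assumes "\<And>i. i \<in> V \<Longrightarrow> g i \<ge> (0::real)"
    "\<And>i. i \<in> V - {j} \<Longrightarrow> 1 + (\<Sum>k\<in>V - {j}. transition_prob E i k * g k) \<le> g i"
    and "i \<in> V - {j}"
  shows "(\<Sum>t<n. survival_prob V E j t i) \<le> g i"
  using assms(3)
proof (induction n arbitrary: i)
  case (Suc n)
  have "(\<Sum>t<Suc n. survival_prob V E j t i) = 1 + (\<Sum>t<n. \<Sum>k\<in>V - {j}. transition_prob E i k * survival_prob V E j t k)"
    by (simp only: sum.lessThan_Suc_shift survival_prob.simps)
  also have "\<dots> = 1 + (\<Sum>k\<in>V - {j}. transition_prob E i k * (\<Sum>t<n. survival_prob V E j t k))"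
    by (subst sum.swap) (simp add: sum_distrib_left)
  also have "\<dots> \<le> 1 + (\<Sum>k\<in>V - {j}. transition_prob E i k * g k)"
    using Suc.IH by (intro add_left_mono sum_mono mult_left_mono transition_nonneg) auto
  also have "\<dots> \<le> g i" by (rule assms(2)[OF Suc.prems])
  finally show ?case .
qed (use assms(1) in auto)

text \<open>Bounded partial sums make the survival probabilities summable. So they tend to 0, which
  gives total mass 1 by telescoping, and summation by parts bounds the mean.\<close>

lemma first_passage_sums:
  assumes j: "j \<in> V" and i: "i \<in> V - {j}"
  shows "(\<lambda>t. first_passage_prob V E i j (Suc t)) sums 1"
    "summable (\<lambda>t. real (Suc t) * first_passage_prob V E i j (Suc t))"
proof -
  let ?s = "\<lambda>t. survival_prob V E j t i"
  obtain g where g: "\<And>i. i \<in> V \<Longrightarrow> g i \<ge> (0::real)"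
    "\<And>i. i \<in> V - {j} \<Longrightarrow> 1 + (\<Sum>k\<in>V - {j}. transition_prob E i k * g k) \<le> g i"
    using supersolution[OF j] by metis
  note le = sum_survival_le[OF g i]
  have "summable ?s" using le survival_nonneg by (intro summableI_nonneg_bounded)
  then have "?s \<longlonglongrightarrow> 0" by (rule summable_LIMSEQ_zero)
  then have "(\<lambda>t. ?s t - ?s (Suc t)) sums (?s 0 - 0)" by (rule telescope_sums')
  then show "(\<lambda>t. first_passage_prob V E i j (Suc t)) sums 1"
    using first_passage_survival[OF j] i by simp
  have part: "(\<Sum>t<n. real (Suc t) * first_passage_prob V E i j (Suc t)) = (\<Sum>t<n. ?s t) - n * ?s n" for n
  proof (induction n)
    case (Suc n)
    have step: "first_passage_prob V E i j (Suc n) = ?s n - ?s (Suc n)"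
      using first_passage_survival[OF j] i by blast
    show ?case unfolding sum.lessThan_Suc Suc.IH step by (simp add: algebra_simps del: survival_prob.simps)
  qed simp
  show "summable (\<lambda>t. real (Suc t) * first_passage_prob V E i j (Suc t))"
  proof (rule summableI_nonneg_bounded)
    show "(\<Sum>t<n. real (Suc t) * first_passage_prob V E i j (Suc t)) \<le> g i" for n
      using part[of n] le[of n] mult_nonneg_nonneg[OF of_nat_0_le_iff survival_nonneg, of n j n i] by linarith
  qed (use first_passage_nonneg in auto)
qed

lemma mean_first_passage_sums:
  assumes "j \<in> V" "i \<in> V - {j}"
  shows "(\<lambda>t. real (Suc t) * first_passage_prob V E i j (Suc t)) sums mean_first_passage V E i j"
proof -
  have "summable (\<lambda>t. real t * first_passage_prob V E i j t)"
    using first_passage_sums(2)[OF assms] by (subst (asm) summable_Suc_iff)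
  from suminf_split_head[OF this] show ?thesis
    using first_passage_sums(2)[OF assms] by (simp add: sums_iff mean_first_passage_def)
qed

lemma mean_first_passage_step:
  assumes j: "j \<in> V" and i: "i \<in> V - {j}"
  shows "mean_first_passage V E i j = 1 + (\<Sum>k\<in>V - {j}. transition_prob E i k * mean_first_passage V E k j)"
proof -
  let ?f = "\<lambda>i t. first_passage_prob V E i j (Suc t)"
  let ?P = "transition_prob E i" and ?m = "\<lambda>k. mean_first_passage V E k j"
  \<comment> \<open>A passage through \<open>k\<close> takes one step more than the passage from
    \<open>k\<close>; as the latter has total mass 1, the extra step contributes the summand 1. The
    direct step to \<open>j\<close> is the first term of the series and is added by the index
    shift.\<close>
  have "(\<lambda>t. \<Sum>k\<in>V - {j}. ?P k * (real (Suc t) * ?f k t + ?f k t)) sums (\<Sum>k\<in>V - {j}. ?P k * (?m k + 1))"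
    using mean_first_passage_sums[OF j] first_passage_sums(1)[OF j]
    by (intro sums_sum sums_mult sums_add) auto
  moreover have "(\<Sum>k\<in>V - {j}. ?P k * (real (Suc t) * ?f k t + ?f k t)) = real (Suc (Suc t)) * ?f i (Suc t)" for t
    by (simp add: sum_distrib_left algebra_simps)
  ultimately have "(\<lambda>t. real (Suc (Suc t)) * ?f i (Suc t)) sums (\<Sum>k\<in>V - {j}. ?P k * (?m k + 1))" by simp
  then have "(\<lambda>t. real (Suc t) * ?f i t) sums ((\<Sum>k\<in>V - {j}. ?P k * (?m k + 1)) + ?P j)"
    by (subst (asm) sums_Suc_iff) simp
  then have "?m i = (\<Sum>k\<in>V - {j}. ?P k * (?m k + 1)) + ?P j"
    using mean_first_passage_sums[OF j i] sums_unique2 by blast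
  also have "\<dots> = (\<Sum>k\<in>V - {j}. ?P k * ?m k) + (\<Sum>k\<in>V. ?P k)"
    using fin j by (simp add: distrib_left sum.distrib sum.remove[of V j])
  finally show ?thesis using sum_transition_eq_1[of i] i by simp
qed

lemma hitting_time_nonneg:
  assumes "j \<in> V" "i \<in> V"
  shows "hitting_time V E j i \<ge> 0"
proof (cases "i = j")
  case False
  then have "(\<lambda>t. real (Suc t) * first_passage_prob V E i j (Suc t)) sums mean_first_passage V E i j"
    using mean_first_passage_sums assms by auto
  then have "mean_first_passage V E i j = (\<Sum>t. real (Suc t) * first_passage_prob V E i j (Suc t))"
    "summable (\<lambda>t. real (Suc t) * first_passage_prob V E i j (Suc t))"
    by (simp_all only: sums_iff)
  then have "0 \<le> mean_first_passage V E i j"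
    using suminf_nonneg[of "\<lambda>t. real (Suc t) * first_passage_prob V E i j (Suc t)"] first_passage_nonneg
    by (metis mult_nonneg_nonneg of_nat_0_le_iff)
  then show ?thesis using False by (simp add: hitting_time_def)
qed (simp add: hitting_time_def)

lemma sum_laplacian: "(\<Sum>i\<in>V. laplacian E x i) = 0"
proof -
  have "laplacian E x i = (\<Sum>k\<in>V. if {i, k} \<in> E then x i - x k else 0)" for i
  proof -
    have "(\<Sum>k\<in>V. if {i, k} \<in> E then x i - x k else 0) = (\<Sum>k\<in>V \<inter> nbrs E i. x i - x k)"
      using fin by (simp add: sum.inter_restrict nbrs_def)
    also have "V \<inter> nbrs E i = nbrs E i" using nbrs_V by blast
    finally show ?thesis by (simp add: laplacian_def)
  qed
  then have eq: "(\<Sum>i\<in>V. laplacian E x i) = (\<Sum>i\<in>V. \<Sum>k\<in>V. if {i, k} \<in> E then x i - x k else 0)" by simp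
  also have "\<dots> = (\<Sum>k\<in>V. \<Sum>i\<in>V. if {i, k} \<in> E then x i - x k else 0)" by (rule sum.swap)
  also have "\<dots> = (\<Sum>k\<in>V. \<Sum>i\<in>V. - (if {k, i} \<in> E then x k - x i else 0))"
    by (intro sum.cong) (auto simp: insert_commute)
  also have "\<dots> = - (\<Sum>i\<in>V. laplacian E x i)" unfolding eq by (simp add: sum_negf)
  finally show ?thesis by simp
qed

text \<open>Off the target this is the first-step equation multiplied by the degree. At the target
  the value is forced, because a Laplacian sums to zero.\<close>

lemma laplacian_hitting_time:
  assumes j: "j \<in> V" and i: "i \<in> V"
  shows "laplacian E (hitting_time V E j) i = deg i - (if i = j then 2 * real (card E) else 0)"
proof -
  let ?h = "hitting_time V E j"
  have ne: "laplacian E ?h i = deg i" if i: "i \<in> V - {j}" for i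
  proof -
    have "?h i = 1 + (\<Sum>k\<in>V - {j}. transition_prob E i k * ?h k)"
      using mean_first_passage_step[OF j i] i by (simp add: hitting_time_def)
    also have "(\<Sum>k\<in>V - {j}. transition_prob E i k * ?h k) = (\<Sum>k\<in>V. transition_prob E i k * ?h k)"
      using fin j by (simp add: sum.remove[of V j] hitting_time_def)
    finally have "?h i = 1 + (\<Sum>k\<in>nbrs E i. ?h k) / deg i" by (simp add: sum_transition)
    then have "deg i * ?h i = deg i + (\<Sum>k\<in>nbrs E i. ?h k)"
      using deg_pos[of i] i by (simp add: field_simps)
    then show ?thesis by (simp add: laplacian_def sum_subtractf)
  qed
  have "(\<Sum>i\<in>V. laplacian E ?h i) = laplacian E ?h j + (\<Sum>i\<in>V - {j}. deg i)"
    using fin j ne by (simp add: sum.remove[of V j])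
  moreover have "(\<Sum>i\<in>V. deg i) = deg j + (\<Sum>i\<in>V - {j}. deg i)" using fin j by (simp add: sum.remove)
  ultimately have "laplacian E ?h j = deg j - 2 * real (card E)" using sum_laplacian[of ?h] sum_deg by simp
  then show ?thesis using ne i by auto
qed

text \<open>Maximum principle: the maximum spreads to all neighbours and, by connectedness, to the
  whole graph.\<close>

lemma harmonic_constant:
  assumes harm: "\<And>i. i \<in> V \<Longrightarrow> laplacian E x i = 0" and "a \<in> V" "b \<in> V"
  shows "x a = x b"
proof -
  define m where "m = Max (x ` V)"
  have le: "x i \<le> m" if "i \<in> V" for i using fin that by (simp add: m_def)
  obtain c where c: "c \<in> V" "x c = m"
  proof -
    have "m \<in> x ` V" unfolding m_def using fin assms(2) by (intro Max_in) auto
    then show thesis using that by auto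
  qed
  have step: "x k = m" if "i \<in> V" "x i = m" "k \<in> nbrs E i" for i k
  proof -
    have "(\<Sum>k\<in>nbrs E i. x i - x k) = 0" using harm[OF that(1)] by (simp add: laplacian_def)
    moreover have "\<forall>k\<in>nbrs E i. x i - x k \<ge> 0" using le nbrs_V that(2) by auto
    ultimately have "x i - x k = 0" using that(3) fin(3) by (meson sum_nonneg_eq_0_iff)
    then show ?thesis using that(2) by simp
  qed
  have all: "x i = m" if "i \<in> V" for i
  proof -
    have "(c, i) \<in> {(x, y). {x, y} \<in> E}\<^sup>*" using conn c that by (auto simp: connected_graph_def)
    then have "i \<in> V \<and> x i = m"
    proof (induction rule: rtrancl_induct)
      case (step y z)
      then have "z \<in> nbrs E y" by (simp add: nbrs_def)
      then show ?case using step \<open>\<And>i k. \<lbrakk>i \<in> V; x i = m; k \<in> nbrs E i\<rbrakk> \<Longrightarrow> x k = m\<close> nbrs_V by blast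
    qed (use c in simp)
    then show ?thesis by simp
  qed
  then show ?thesis using assms by simp
qed

text \<open>Averaged over the stationary distribution of targets, the two terms of the Laplacian of
  a hitting time cancel. So the average is harmonic in the starting vertex, hence constant, and the
  definite description in \<open>kemeny_constant\<close> is justified.\<close>

lemma kemeny_constant_eq:
  assumes v: "v \<in> V"
  shows "2 * real (card E) * kemeny_constant V E = (\<Sum>j\<in>V. deg j * hitting_time V E j v)"
proof -
  define m where "m = 2 * real (card E)"
  have "(\<Sum>i\<in>V. 1) \<le> (\<Sum>i\<in>V. deg i)" using deg_pos by (intro sum_mono)
  then have m: "m > 0" using sum_deg card_ge2 by (simp add: m_def)
  define \<kappa> where "\<kappa> = (\<lambda>i. \<Sum>j\<in>V. (deg j / m) * hitting_time V E j i)"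
  have \<kappa>: "(\<Sum>j\<in>V - {i}. stationary_prob E j * mean_first_passage V E i j) = \<kappa> i" if "i \<in> V" for i
  proof -
    have "\<kappa> i = (\<Sum>j\<in>V - {i}. (deg j / m) * hitting_time V E j i)"
      using fin that by (simp add: \<kappa>_def sum.remove[of V i] hitting_time_def)
    also have "\<dots> = (\<Sum>j\<in>V - {i}. stationary_prob E j * mean_first_passage V E i j)"
      by (intro sum.cong) (auto simp: hitting_time_def stationary_prob_def m_def vertex_degree_nbrs[OF sg])
    finally show ?thesis by simp
  qed
  have "laplacian E \<kappa> i = 0" if i: "i \<in> V" for i
  proof -
    have "laplacian E \<kappa> i = (\<Sum>j\<in>V. (deg j / m) * (deg i - (if i = j then m else 0)))"
      unfolding \<kappa>_def laplacian_sum using laplacian_hitting_time i by (intro sum.cong) (auto simp: m_def)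
    also have "\<dots> = (\<Sum>j\<in>V. deg j) * deg i / m - (\<Sum>j\<in>V. if i = j then deg j else 0)"
      using m by (simp add: right_diff_distrib sum_subtractf sum_divide_distrib sum_distrib_right
          if_distrib[of "\<lambda>x. _ * x"] cong: if_cong)
    also have "\<dots> = 0"
    proof -
      have "(\<Sum>j\<in>V. deg j) = m" by (simp add: m_def sum_deg)
      then show ?thesis using i fin m by simp
    qed
    finally show ?thesis .
  qed
  then have const: "\<kappa> i = \<kappa> v" if "i \<in> V" for i using harmonic_constant that v by blast
  have "(\<forall>i\<in>V. k = (\<Sum>j\<in>V - {i}. stationary_prob E j * mean_first_passage V E i j)) \<longleftrightarrow> k = \<kappa> v" for k
  proof (intro iffI ballI)
    assume "\<forall>i\<in>V. k = (\<Sum>j\<in>V - {i}. stationary_prob E j * mean_first_passage V E i j)"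
    then show "k = \<kappa> v" using \<kappa>[OF v] v by simp
  next
    fix i assume "k = \<kappa> v" "i \<in> V"
    then show "k = (\<Sum>j\<in>V - {i}. stationary_prob E j * mean_first_passage V E i j)"
      using \<kappa>[of i] const[of i] by simp
  qed
  then have "kemeny_constant V E = \<kappa> v" unfolding kemeny_constant_def by simp
  then have "m * kemeny_constant V E = (\<Sum>j\<in>V. deg j * hitting_time V E j v)"
    using m by (simp add: \<kappa>_def sum_distrib_left)
  then show ?thesis by (simp add: m_def)
qed

end


section \<open>The effect of a clique on the leaves of one vertex\<close>

lemma nbrs_add_clique:
  assumes "\<And>s. s \<in> S \<Longrightarrow> nbrs E s = {v}" "v \<notin> S"
  shows "i \<in> S \<Longrightarrow> nbrs (add_clique E S) i = insert v (S - {i})"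
    "i \<notin> S \<Longrightarrow> nbrs (add_clique E S) i = nbrs E i"
proof -
  have *: "{i, k} \<in> add_clique E S \<longleftrightarrow> {i, k} \<in> E \<or> (i \<in> S \<and> k \<in> S \<and> i \<noteq> k)" for i k
    by (auto simp: add_clique_def card_2_iff doubleton_eq_iff)
  show "i \<notin> S \<Longrightarrow> nbrs (add_clique E S) i = nbrs E i" by (auto simp: nbrs_def *)
  assume i: "i \<in> S"
  have "{i, k} \<in> E \<longleftrightarrow> k = v" for k using assms(1)[OF i] by (auto simp: nbrs_def)
  then show "nbrs (add_clique E S) i = insert v (S - {i})" using i assms(2) by (auto simp: nbrs_def *)
qed

locale pendant_star = connected_simple_graph +
  fixes v :: 'a and S :: "'a set" and l :: nat
  assumes v: "v \<in> V" and S: "S \<subseteq> V" "card S = l" "2 \<le> l"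
    and pendant: "\<And>s. s \<in> S \<Longrightarrow> nbrs E s = {v}"
begin

abbreviation "E' \<equiv> add_clique E S"

lemma finS: "finite S" using S fin finite_subset by blast

lemma v_notin_S: "v \<notin> S"
  using pendant[of v] nbrs_V[of v] by auto

lemma S_nbrs_v: "S \<subseteq> nbrs E v"
  using pendant by (auto simp: nbrs_def insert_commute)

lemma nbrs_off_S:
  assumes "i \<in> V - S - {v}"
  shows "nbrs E i \<inter> S = {}"
proof (rule ccontr)
  assume "nbrs E i \<inter> S \<noteq> {}"
  then obtain k where k: "k \<in> nbrs E i" "k \<in> S" by blast
  then have "i \<in> nbrs E k" using nbrs_sym[of k E i] by simp
  then show False using pendant[OF k(2)] assms by simp
qed

sublocale clique: connected_simple_graph V E'
proof
  show "simple_graph V E'"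
    using sg S by (auto simp: simple_graph_def add_clique_def)
  have "{(x, y). {x, y} \<in> E}\<^sup>* \<subseteq> {(x, y). {x, y} \<in> E'}\<^sup>*"
    by (rule rtrancl_mono) (auto simp: add_clique_def)
  then show "connected_graph V E'" using conn by (auto simp: connected_graph_def)
qed (rule card_ge2)

lemma nbrs': "i \<in> S \<Longrightarrow> nbrs E' i = insert v (S - {i})" "i \<notin> S \<Longrightarrow> nbrs E' i = nbrs E i"
  using nbrs_add_clique[of S E v i] pendant v_notin_S by simp_all

lemma deg'_S: "s \<in> S \<Longrightarrow> clique.deg s = real l"
  using finS v_notin_S S(2,3) by (simp add: nbrs' card_Diff_singleton card_insert_if of_nat_diff)

lemma sum_V_split: "(\<Sum>i\<in>V. f i) = (\<Sum>i\<in>V - S. f i) + (\<Sum>i\<in>S. f i)" for f :: "'a \<Rightarrow> real"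
  using sum.subset_diff[OF S(1) fin(1)] .

lemma card_E': "2 * real (card E') = 2 * real (card E) + (real l ^ 2 - real l)"
proof -
  have "2 * real (card E') = (\<Sum>i\<in>V - S. deg i) + real l * real l"
    unfolding clique.sum_deg[symmetric] sum_V_split using deg'_S S(2) by (simp add: nbrs')
  moreover have "2 * real (card E) = (\<Sum>i\<in>V - S. deg i) + real l"
    unfolding sum_deg[symmetric] sum_V_split using pendant S(2) by simp
  ultimately show ?thesis by (simp add: power2_eq_square)
qed

text \<open>At a leaf the Laplacian sees only \<open>v\<close>, so the equation at the target
  already is the answer.\<close>

lemma hitting_time_leaf:
  assumes "s \<in> S"
  shows "hitting_time V E s v = 2 * real (card E) - 1"
proof -
  have s: "s \<in> V" using assms S by blast
  have "laplacian E (hitting_time V E s) s = - hitting_time V E s v"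
    using pendant[OF assms] by (simp add: laplacian_def hitting_time_def)
  then show ?thesis using laplacian_hitting_time[OF s s] pendant[OF assms] by simp
qed

lemma laplacian_clique_S:
  assumes "i \<in> S"
  shows "laplacian E' x i = (x i - x v) + (real l * x i - (\<Sum>k\<in>S. x k))"
proof -
  have "laplacian E' x i = (x i - x v) + (\<Sum>k\<in>S - {i}. x i - x k)"
    unfolding laplacian_def nbrs'(1)[OF assms] using finS v_notin_S by simp
  also have "(\<Sum>k\<in>S - {i}. x i - x k) = (\<Sum>k\<in>S. x i - x k)"
    using finS assms by (simp add: sum.remove[of S i])
  finally show ?thesis using S(2) by (simp add: sum_subtractf)
qed

text \<open>The equations at \<open>S\<close> involve only \<open>h v\<close> and the values on
  \<open>S\<close>. Their sum and the one at \<open>s\<close> eliminate \<open>X\<close>, so the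
  answer depends on the graph only through \<open>l\<close> and the number of edges.\<close>

lemma hitting_time_clique:
  assumes "s \<in> S"
  shows "hitting_time V E' s v = 4 * real (card E') / (real l + 1) - real l"
proof -
  have s: "s \<in> V" using assms S by blast
  define h where "h = hitting_time V E' s"
  define X where "X = (\<Sum>k\<in>S. h k)"
  define m where "m = real (card E')"
  have hs: "h s = 0" by (simp add: h_def hitting_time_def)
  have L: "(h i - h v) + (real l * h i - X) = real l - (if i = s then 2 * m else 0)" if "i \<in> S" for i
  proof -
    have "laplacian E' h i = real l - (if i = s then 2 * m else 0)"
      using clique.laplacian_hitting_time[OF s, of i] deg'_S[OF that] that S by (auto simp: h_def m_def)
    then show ?thesis using laplacian_clique_S[OF that, of h] by (simp add: X_def)
  qed
  have "(\<Sum>i\<in>S. (h i - h v) + (real l * h i - X)) = (\<Sum>i\<in>S. real l - (if i = s then 2 * m else 0))"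
    using L by (intro sum.cong) auto
  then have "X - real l * h v + (real l * X - real l * X) = real l * real l - 2 * m"
    using finS assms S(2) by (simp add: sum.distrib sum_subtractf X_def flip: sum_distrib_left)
  moreover have "- h v - X = real l - 2 * m" using L[OF assms] hs by simp
  ultimately have "(real l + 1) * h v = 4 * m - real l * (real l + 1)" by (simp add: algebra_simps)
  then have "h v = (4 * m - real l * (real l + 1)) / (real l + 1)" by (simp add: field_simps)
  then show ?thesis by (simp add: h_def m_def diff_divide_distrib)
qed

text \<open>Both differences \<open>h'\<^sub>j - h\<^sub>j\<close> and \<open>h\<^sub>j - h\<^sub>v\<close> become multiples of the potential
  of a unit current from \<open>v\<close> to \<open>j\<close> once they are made constant on the leaves; at \<open>v\<close> the second one
  is a commute time.\<close>

lemma hitting_time_increase: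
  assumes j: "j \<in> V - S - {v}"
  shows "2 * real (card E) * (hitting_time V E' j v - hitting_time V E j v)
     \<ge> (real l ^ 2 - real l) * hitting_time V E j v"
proof -
  define \<alpha> \<beta> \<gamma> where "\<alpha> = hitting_time V E j" and "\<beta> = hitting_time V E' j" and "\<gamma> = hitting_time V E v"
  define m q where "m = 2 * real (card E)" and "q = real l ^ 2 - real l"
  have jV: "j \<in> V" "j \<noteq> v" "j \<notin> S" using j by auto
  have L\<alpha>: "laplacian E \<alpha> i = deg i - (if i = j then m else 0)" if "i \<in> V" for i
    using laplacian_hitting_time[OF jV(1) that] by (simp add: \<alpha>_def m_def)
  have L\<beta>: "laplacian E' \<beta> i = clique.deg i - (if i = j then m + q else 0)" if "i \<in> V" for i
    using clique.laplacian_hitting_time[OF jV(1) that] card_E' by (simp add: \<beta>_def m_def q_def)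
  have L\<gamma>: "laplacian E \<gamma> i = deg i - (if i = v then m else 0)" if "i \<in> V" for i
    using laplacian_hitting_time[OF v that] by (simp add: \<gamma>_def m_def)
  \<comment> \<open>The flow of \<open>x\<close> out of \<open>v\<close> along the edges that do not
    lead to \<open>S\<close>. Only this part matters at \<open>v\<close>, because the values on the
    leaves are later overwritten by the value at \<open>v\<close>.\<close>
  define T :: "('a \<Rightarrow> real) \<Rightarrow> real" where "T = (\<lambda>x. \<Sum>k\<in>nbrs E v - S. x v - x k)"
  have split: "laplacian E x v = T x + (\<Sum>s\<in>S. x v - x s)" for x
    unfolding laplacian_def T_def using sum.subset_diff[OF S_nbrs_v fin(3)] .
  have leaf: "laplacian E x s = x s - x v" if "s \<in> S" for x s
    using pendant[OF that] by (simp add: laplacian_def)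
  have "T \<alpha> = deg v + l"
  proof -
    have "\<alpha> v - \<alpha> s = -1" if "s \<in> S" for s
    proof -
      have "s \<in> V" "s \<noteq> j" using that S jV by auto
      then show ?thesis using leaf[OF that, of \<alpha>] L\<alpha>[of s] pendant[OF that] by simp
    qed
    then have "(\<Sum>s\<in>S. \<alpha> v - \<alpha> s) = - real l" using S(2) by simp
    then show ?thesis using split[of \<alpha>] L\<alpha>[OF v] jV by simp
  qed
  moreover have "T \<beta> = deg v + l ^ 2"
  proof -
    have "(\<beta> s - \<beta> v) + (real l * \<beta> s - (\<Sum>k\<in>S. \<beta> k)) = real l" if "s \<in> S" for s
      using laplacian_clique_S[OF that, of \<beta>] L\<beta>[of s] that S deg'_S[OF that] jV by auto
    then have "(\<Sum>s\<in>S. (\<beta> s - \<beta> v) + (real l * \<beta> s - (\<Sum>k\<in>S. \<beta> k))) = (\<Sum>s\<in>S. real l)"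
      by (intro sum.cong) auto
    then have "(\<Sum>s\<in>S. \<beta> v - \<beta> s) = - real (l ^ 2)"
      using S(2) by (simp add: sum.distrib sum_subtractf power2_eq_square flip: sum_distrib_left)
    moreover have "laplacian E' \<beta> v = laplacian E \<beta> v"
      using nbrs'(2)[OF v_notin_S] by (simp add: laplacian_def)
    ultimately show ?thesis using split[of \<beta>] L\<beta>[OF v] jV nbrs'(2)[OF v_notin_S] by simp
  qed
  moreover have "T \<gamma> = deg v + l - m"
  proof -
    have "\<gamma> v - \<gamma> s = -1" if "s \<in> S" for s
    proof -
      have "s \<in> V" "s \<noteq> v" using that S v_notin_S by auto
      then show ?thesis using leaf[OF that, of \<gamma>] L\<gamma>[of s] pendant[OF that] by simp
    qed
    then have "(\<Sum>s\<in>S. \<gamma> v - \<gamma> s) = - real l" using S(2) by simp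
    then show ?thesis using split[of \<gamma>] L\<gamma>[OF v] by simp
  qed
  ultimately have T: "T \<beta> - T \<alpha> = q" "T \<alpha> - T \<gamma> = m" by (auto simp: q_def)
  \<comment> \<open>The differences have strengths \<open>q\<close> and \<open>m\<close>, so the
    crosswise coefficients make them cancel, at \<open>v\<close> and at \<open>j\<close> alike. In
    \<open>z\<close> the leaves copy \<open>v\<close>, which makes their own equations
    trivial.\<close>
  define z0 where "z0 = (\<lambda>i. m * (\<beta> i - \<alpha> i) - q * (\<alpha> i - \<gamma> i))"
  define z where "z = (\<lambda>i. if i \<in> S then z0 v else z0 i)"
  have z0_lin: "laplacian E z0 i = m * (laplacian E \<beta> i - laplacian E \<alpha> i) - q * (laplacian E \<alpha> i - laplacian E \<gamma> i)" for i
    unfolding z0_def laplacian_def by (simp add: algebra_simps sum_subtractf sum.distrib sum_distrib_left)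
  have "laplacian E z i = 0" if i: "i \<in> V" for i
  proof -
    consider "i \<in> S" | "i = v" | "i \<in> V - S - {v}" using i by blast
    then show ?thesis
    proof cases
      case 1
      then show ?thesis using leaf[OF 1, of z] v_notin_S by (simp add: z_def)
    next
      case 2
      have "laplacian E z v = T z" using split[of z] v_notin_S by (simp add: z_def)
      also have "T z = T z0" unfolding T_def using v_notin_S by (intro sum.cong) (auto simp: z_def)
      also have "T z0 = m * (T \<beta> - T \<alpha>) - q * (T \<alpha> - T \<gamma>)"
        unfolding T_def z0_def by (simp add: algebra_simps sum_subtractf sum.distrib sum_distrib_left)
      finally show ?thesis using 2 T by simp
    next
      case 3
      have nS: "k \<notin> S" if "k \<in> nbrs E i" for k using nbrs_off_S[OF 3] that by blast
      have z: "laplacian E z i = laplacian E z0 i"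
        using 3 nS by (intro laplacian_cong) (auto simp: z_def)
      have \<beta>: "laplacian E \<beta> i = deg i - (if i = j then m + q else 0)"
        using L\<beta>[OF i] nbrs'(2)[of i] 3 by (simp add: laplacian_def)
      show ?thesis unfolding z z0_lin L\<alpha>[OF i] L\<gamma>[OF i] \<beta> using 3
        by (cases "i = j") (simp_all add: algebra_simps)
    qed
  qed
  \<comment> \<open>As \<alpha> and \<beta> vanish at \<open>j\<close> and \<gamma> vanishes at
    \<open>v\<close>, this equation is the claim with slack \<open>q * \<gamma> j\<close>, where
    \<open>\<gamma> j\<close> is the hitting time from \<open>j\<close> back to
    \<open>v\<close>.\<close>
  from harmonic_constant[OF this v jV(1)] have "z v = z j" .
  then have "m * (\<beta> v - \<alpha> v) - q * \<alpha> v = q * \<gamma> j"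
    using v_notin_S jV by (simp add: z_def z0_def \<alpha>_def \<beta>_def \<gamma>_def hitting_time_def)
  moreover have "0 \<le> q * \<gamma> j"
    unfolding q_def \<gamma>_def using hitting_time_nonneg[OF v jV(1)] S(3)
    by (intro mult_nonneg_nonneg) (auto simp: power2_eq_square)
  ultimately show ?thesis by (simp add: \<alpha>_def \<beta>_def m_def q_def)
qed

text \<open>Based at \<open>v\<close>, the vertices off the leaves contribute no less than before.
  The leaves contribute L - L/n before and 2 L^2 / (L + 1) - L^3 / (n + q) after. The gain in the
  main term is L (L - 1) / (L + 1), at least L / (L + 1), and the bound on \<open>card V\<close>
  keeps the error L^3 / (n + q) within that; strictness comes from L/n.\<close>

lemma kemeny_constant_increases:
  assumes big: "l ^ 2 * (l + 1) \<le> card V"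
  shows "kemeny_constant V E < kemeny_constant V E'"
proof -
  \<comment> \<open>\<open>n\<close> is the degree sum of the graph, not the number of vertices;
    \<open>q\<close> is its growth when the clique is added.\<close>
  define n q L where "n = 2 * real (card E)" and "q = real l ^ 2 - real l" and "L = real l"
  define A B where "A = (\<Sum>j\<in>V - S - {v}. deg j * hitting_time V E j v)"
    and "B = (\<Sum>j\<in>V - S - {v}. deg j * hitting_time V E' j v)"
  have L: "L \<ge> 2" "q = L * (L - 1)" using S(3) by (auto simp: L_def q_def power2_eq_square algebra_simps)
  then have q: "q \<ge> 0" by simp
  have "real (card V) \<le> n"
  proof -
    have "(\<Sum>i\<in>V. 1) \<le> (\<Sum>i\<in>V. deg i)" using deg_pos by (intro sum_mono)
    then show ?thesis using sum_deg by (simp add: n_def)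
  qed
  moreover have "L ^ 2 * (L + 1) \<le> real (card V)"
  proof -
    have "real (l ^ 2 * (l + 1)) \<le> real (card V)" using big by (simp only: of_nat_le_iff)
    then show ?thesis by (simp add: L_def algebra_simps)
  qed
  ultimately have n: "L ^ 2 * (L + 1) \<le> n" by simp
  moreover have "0 < L ^ 2 * (L + 1)" using L by simp
  ultimately have n0: "n > 0" by linarith
  have decomp: "(\<Sum>j\<in>V. f j) = (\<Sum>j\<in>V - S - {v}. f j) + f v + (\<Sum>j\<in>S. f j)" for f :: "'a \<Rightarrow> real"
    unfolding sum_V_split using fin v v_notin_S by (simp add: sum.remove[of "V - S" v])
  have K: "n * kemeny_constant V E = A + L * (n - 1)"
  proof -
    have "(\<Sum>j\<in>S. deg j * hitting_time V E j v) = (\<Sum>j\<in>S. n - 1)"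
      using hitting_time_leaf pendant by (intro sum.cong) (auto simp: n_def)
    then show ?thesis using kemeny_constant_eq[OF v] decomp[of "\<lambda>j. deg j * hitting_time V E j v"] S(2)
      by (simp add: n_def A_def L_def hitting_time_def)
  qed
  have K': "(n + q) * kemeny_constant V E' = B + L * (L * (2 * (n + q) / (L + 1) - L))"
  proof -
    have nq: "2 * real (card E') = n + q" using card_E' by (simp add: n_def q_def)
    have "(\<Sum>j\<in>S. clique.deg j * hitting_time V E' j v) = (\<Sum>j\<in>S. L * (2 * (n + q) / (L + 1) - L))"
      using hitting_time_clique deg'_S by (intro sum.cong) (auto simp: L_def nq[symmetric])
    moreover have "(\<Sum>j\<in>V - S - {v}. clique.deg j * hitting_time V E' j v) = B"
      unfolding B_def by (intro sum.cong) (auto simp: nbrs')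
    ultimately show ?thesis
      using clique.kemeny_constant_eq[OF v] decomp[of "\<lambda>j. clique.deg j * hitting_time V E' j v"] S(2)
      by (simp add: nq L_def hitting_time_def)
  qed
  have "q * A \<le> n * (B - A)"
    unfolding A_def B_def sum_distrib_left sum_subtractf[symmetric]
  proof (rule sum_mono)
    fix j assume "j \<in> V - S - {v}"
    from mult_left_mono[OF hitting_time_increase[OF this], of "deg j"]
    show "q * (deg j * hitting_time V E j v) \<le> n * (deg j * hitting_time V E' j v - deg j * hitting_time V E j v)"
      by (simp add: n_def q_def algebra_simps)
  qed
  then have "(n + q) * A / n \<le> B" using n0 by (simp add: field_simps)
  then have "(n + q) * (A / n) + L * (L * (2 * (n + q) / (L + 1) - L)) \<le> (n + q) * kemeny_constant V E'"
    using K' by simp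
  then have "((n + q) * (A / n) + L * (L * (2 * (n + q) / (L + 1) - L))) / (n + q) \<le> kemeny_constant V E'"
    using n0 q by (simp add: pos_divide_le_eq mult.commute)
  moreover have "((n + q) * (A / n) + L * (L * (2 * (n + q) / (L + 1) - L))) / (n + q)
      = A / n + 2 * L ^ 2 / (L + 1) - L ^ 3 / (n + q)"
  proof -
    have *: "(N * a + L * (L * (2 * N / (L + 1) - L))) / N = a + 2 * L ^ 2 / (L + 1) - L ^ 3 / N"
      if "N > 0" for N a :: real
    proof -
      have "(N * a + L * (L * (2 * N / (L + 1) - L))) / N = N * a / N + L * L * 2 / (L + 1) * (N / N) - L * L * L / N"
        by (simp add: add_divide_distrib diff_divide_distrib right_diff_distrib)
      then show ?thesis using that by (simp add: power2_eq_square power3_eq_cube mult_ac)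
    qed
    have "n + q > 0" using n0 q by linarith
    from *[OF this] show ?thesis .
  qed
  ultimately have K'_ge: "A / n + 2 * L ^ 2 / (L + 1) - L ^ 3 / (n + q) \<le> kemeny_constant V E'" by simp
  have K_eq: "kemeny_constant V E = A / n + L - L / n"
  proof -
    have "kemeny_constant V E = (A + L * (n - 1)) / n" using K n0 by (metis less_irrefl nonzero_mult_div_cancel_left)
    also have "\<dots> = A / n + L - L / n"
      using n0 by (simp add: add_divide_distrib diff_divide_distrib right_diff_distrib)
    finally show ?thesis .
  qed
  have "0 \<le> L ^ 3" using L(1) by simp
  then have "L ^ 3 / (n + q) \<le> L ^ 3 / n" using n0 q by (intro frac_le) linarith+
  also have "\<dots> \<le> L ^ 3 / (L ^ 2 * (L + 1))"
    using n \<open>0 < L ^ 2 * (L + 1)\<close> \<open>0 \<le> L ^ 3\<close> by (intro frac_le) linarith+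
  also have "\<dots> = L / (L + 1)" using L by (simp add: power2_eq_square power3_eq_cube)
  also have "\<dots> \<le> L * (L - 1) / (L + 1)" using L by (intro divide_right_mono) auto
  also have "\<dots> = 2 * L ^ 2 / (L + 1) - L" using L by (simp add: field_simps power2_eq_square)
  finally have "L ^ 3 / (n + q) \<le> 2 * L ^ 2 / (L + 1) - L" .
  moreover have "L / n > 0" using L n0 by simp
  ultimately show ?thesis using K'_ge K_eq by linarith
qed

end

section \<open>Graphs with few leaves at each vertex\<close>

definition pendants :: "'a set set \<Rightarrow> 'a \<Rightarrow> 'a set" where
  "pendants E v = {s. nbrs E s = {v}}"

definition few_pendants :: "nat \<Rightarrow> 'a set \<Rightarrow> 'a set set set" where
  "few_pendants l V = {E \<in> conn_planar V. \<forall>v\<in>V. card (pendants E v) < l}"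

lemma pendants_subset:
  assumes "simple_graph V E"
  shows "pendants E v \<subseteq> nbrs E v"
  unfolding pendants_def by (auto simp: nbrs_sym[of _ E v])

section \<open>Invariance of the counts under relabelling\<close>

lemma connected_graph_image:
  assumes "connected_graph V E"
  shows "connected_graph (f ` V) ((`) f ` E)"
  unfolding connected_graph_def
proof (intro conjI ballI)
  show "f ` V \<noteq> {}" using assms by (simp add: connected_graph_def)
  fix a b assume "a \<in> f ` V" "b \<in> f ` V"
  then obtain u v where uv: "u \<in> V" "v \<in> V" "a = f u" "b = f v" by blast
  then have "(u, v) \<in> {(x, y). {x, y} \<in> E}\<^sup>*" using assms by (auto simp: connected_graph_def)
  then have "(f u, f v) \<in> {(x, y). {x, y} \<in> (`) f ` E}\<^sup>*"
  proof (induction rule: rtrancl_induct)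
    case (step y z)
    then have "(f y, f z) \<in> {(x, y). {x, y} \<in> (`) f ` E}" by (auto intro: image_eqI[of _ _ "{y, z}"])
    with step.IH show ?case by (rule rtrancl_into_rtrancl)
  qed simp
  then show "(a, b) \<in> {(x, y). {x, y} \<in> (`) f ` E}\<^sup>*" using uv by simp
qed

lemma simple_graph_image:
  assumes "simple_graph V E" "inj_on f V"
  shows "simple_graph (f ` V) ((`) f ` E)"
  using assms by (auto simp: simple_graph_def) (metis card_image inj_on_subset)

lemma nbrs_image:
  assumes "simple_graph V E" "inj_on f V" "v \<in> V"
  shows "nbrs ((`) f ` E) (f v) = f ` nbrs E v"
proof
  show "nbrs ((`) f ` E) (f v) \<subseteq> f ` nbrs E v"
  proof
    fix k assume "k \<in> nbrs ((`) f ` E) (f v)"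
    then obtain e where e: "e \<in> E" "{f v, k} = f ` e" by (auto simp: nbrs_def)
    obtain x y where xy: "e = {x, y}" "x \<in> V" "y \<in> V" using simple_graph_edgeE[OF assms(1) e(1)] by metis
    then have "f v = f x \<and> k = f y \<or> f v = f y \<and> k = f x" using e(2) by (auto simp: doubleton_eq_iff)
    then have "v = x \<and> k = f y \<or> v = y \<and> k = f x" using assms(2,3) xy by (auto simp: inj_on_def)
    then show "k \<in> f ` nbrs E v" using e(1) xy(1) by (auto simp: nbrs_def insert_commute)
  qed
  show "f ` nbrs E v \<subseteq> nbrs ((`) f ` E) (f v)"
  proof
    fix k assume "k \<in> f ` nbrs E v"
    then obtain u where "{v, u} \<in> E" "k = f u" by (auto simp: nbrs_def)
    then show "k \<in> nbrs ((`) f ` E) (f v)" by (auto simp: nbrs_def intro: image_eqI[of _ _ "{v, u}"])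
  qed
qed

lemma conn_planar_image:
  assumes "E \<in> conn_planar V" "inj_on f V"
  shows "(`) f ` E \<in> conn_planar (f ` V)"
proof -
  have sg: "simple_graph V E" and cn: "connected_graph V E" and pl: "planar_graph V E"
    using assms(1) by (auto simp: conn_planar_def)
  have EV: "e \<subseteq> V" if "e \<in> E" for e using sg that by (simp add: simple_graph_def)
  show ?thesis unfolding conn_planar_def
    using simple_graph_image[OF sg assms(2)] connected_graph_image[OF cn] planar_graph_image[OF pl assms(2) EV]
    by simp
qed

lemma few_pendants_image:
  assumes "E \<in> few_pendants l V" "inj_on f V"
  shows "(`) f ` E \<in> few_pendants l (f ` V)"
proof -
  have gcp: "E \<in> conn_planar V" and few: "\<And>v. v \<in> V \<Longrightarrow> card (pendants E v) < l"
    using assms(1) by (auto simp: few_pendants_def)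
  have sg: "simple_graph V E" using gcp by (simp add: conn_planar_def)
  have gcp': "(`) f ` E \<in> conn_planar (f ` V)" by (rule conn_planar_image[OF gcp assms(2)])
  have sg': "simple_graph (f ` V) ((`) f ` E)" using gcp' by (simp add: conn_planar_def)
  have "card (pendants ((`) f ` E) (f v)) < l" if v: "v \<in> V" for v
  proof -
    have "pendants ((`) f ` E) (f v) \<subseteq> f ` pendants E v"
    proof
      fix s assume s: "s \<in> pendants ((`) f ` E) (f v)"
      then have "s \<in> f ` V" using pendants_subset[OF sg'] nbrs_subset(1)[OF sg'] by blast
      then obtain t where t: "t \<in> V" "s = f t" by blast
      then have "f ` nbrs E t = {f v}" using s nbrs_image[OF sg assms(2) t(1)] by (simp add: pendants_def)
      moreover have "nbrs E t \<subseteq> V" using nbrs_subset(1)[OF sg] by blast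
      ultimately have "nbrs E t = {v}"
        using inj_on_image_eq_iff[OF assms(2), of "nbrs E t" "{v}"] v by simp
      then show "s \<in> f ` pendants E v" using t by (auto simp: pendants_def)
    qed
    moreover have "finite (pendants E v)"
      using pendants_subset[OF sg] nbrs_subset(2)[OF sg] finite_subset by blast
    ultimately have "card (pendants ((`) f ` E) (f v)) \<le> card (pendants E v)"
      by (meson card_image_le card_mono finite_imageI order_trans)
    then show ?thesis using few[OF v] by simp
  qed
  then show ?thesis using gcp' by (auto simp: few_pendants_def)
qed

text \<open>Stated for an arbitrary family closed under relabelling, so that it serves both counts;
  equality comes from exchanging the two vertex sets.\<close>

lemma card_relabel_le:
  fixes F :: "'a set \<Rightarrow> 'a set set set"
  assumes fin: "finite V" "finite W" "card V = card W"
    and FPow: "\<And>V E. E \<in> F V \<Longrightarrow> E \<subseteq> Pow V"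
    and F: "\<And>V f E. E \<in> F V \<Longrightarrow> inj_on f V \<Longrightarrow> (`) f ` E \<in> F (f ` V)"
  shows "card (F V) \<le> card (F W)"
proof -
  obtain f where f: "bij_betw f V W" using finite_same_card_bij[OF fin] by blast
  then have inj: "inj_on f V" and im: "f ` V = W" by (auto simp: bij_betw_def)
  show ?thesis
  proof (rule card_inj_on_le[of "\<lambda>E. (`) f ` E"])
    have "inj_on ((`) f) (Pow V)" by (rule inj_on_image_Pow[OF inj])
    then have "inj_on ((`) ((`) f)) (Pow (Pow V))" by (rule inj_on_image_Pow)
    then show "inj_on (\<lambda>E. (`) f ` E) (F V)" using FPow by (rule_tac inj_on_subset) auto
    show "(\<lambda>E. (`) f ` E) ` F V \<subseteq> F W" using F inj im by blast
    show "finite (F W)" using FPow fin(2) finite_subset[of "F W" "Pow (Pow W)"] by auto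
  qed
qed

lemma conn_planar_Pow: "E \<in> conn_planar V \<Longrightarrow> E \<subseteq> Pow V"
  by (auto simp: conn_planar_def simple_graph_def)

lemma card_conn_planar_cong:
  assumes "finite V" "finite W" "card V = card W"
  shows "card (conn_planar (V :: 'a set)) = card (conn_planar (W :: 'a set))"
  by (intro antisym card_relabel_le conn_planar_image conn_planar_Pow) (use assms in auto)

lemma card_few_pendants_cong:
  assumes "finite V" "finite W" "card V = card W"
  shows "card (few_pendants l (V :: 'a set)) = card (few_pendants l (W :: 'a set))"
  by (intro antisym card_relabel_le few_pendants_image)
    (use assms conn_planar_Pow in \<open>auto simp: few_pendants_def\<close>)

section \<open>Attaching leaves and reading them off again\<close>

lemma conn_planar_add_leaf:
  assumes "E \<in> conn_planar (V :: nat set)" "v \<in> V" "2 \<le> card V" "s \<notin> V"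
  shows "insert {v, s} E \<in> conn_planar (insert s V)"
proof -
  have sg: "simple_graph V E" and cn: "connected_graph V E" and pl: "planar_graph V E"
    using assms(1) by (auto simp: conn_planar_def)
  interpret connected_simple_graph V E by unfold_locales (use sg cn assms in auto)
  obtain w where "{v, w} \<in> E" using nbrs_nonempty[OF assms(2)] by (auto simp: nbrs_def)
  then have "planar_graph (insert s V) (insert {v, s} E)"
    using planar_graph_add_leaf[OF pl sg _ assms(4)] by simp
  moreover have "simple_graph (insert s V) (insert {v, s} E)"
    using sg assms by (auto simp: simple_graph_def card_insert_if)
  ultimately show ?thesis using connected_graph_add_leaf[OF cn assms(2)] by (simp add: conn_planar_def)
qed

lemma conn_planar_add_star:
  assumes "finite S" "E \<in> conn_planar (V :: nat set)" "v \<in> V" "2 \<le> card V" "S \<inter> V = {}"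
  shows "E \<union> star v S \<in> conn_planar (V \<union> S)"
  using assms(1,5)
proof (induction S)
  case empty
  then show ?case using assms by (simp add: star_def)
next
  case (insert s S)
  have "finite V" using assms(4) by (metis card.infinite not_numeral_le_zero)
  then have "card V \<le> card (V \<union> S)" using insert by (intro card_mono) auto
  then have "insert {v, s} (E \<union> star v S) \<in> conn_planar (insert s (V \<union> S))"
    using insert assms by (intro conn_planar_add_leaf) auto
  then show ?case by (simp add: star_def)
qed

text \<open>These facts make the attachment almost reversible: \<open>v\<close> is the only vertex
  with \<open>l\<close> or more leaves, \<open>S\<close> is one of the subsets of its fewer than
  \<open>2 * l\<close> leaves, and \<open>E\<close> is what remains when the edges at
  \<open>S\<close> are removed.\<close>

lemma few_pendants_star:
  assumes l: "2 \<le> l" and E: "E \<in> few_pendants l (V - S)" and S: "S \<subseteq> V" "card S = l" "finite V"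
    and v: "v \<in> V - S"
  shows "S \<subseteq> pendants (E \<union> star v S) v" "card (pendants (E \<union> star v S) v) < 2 * l"
    "\<And>w. w \<in> V \<Longrightarrow> l \<le> card (pendants (E \<union> star v S) w) \<Longrightarrow> w = v"
    "E = {e \<in> E \<union> star v S. e \<inter> S = {}}"
proof -
  let ?E = "E \<union> star v S"
  have sg: "simple_graph (V - S) E" and few: "\<And>w. w \<in> V - S \<Longrightarrow> card (pendants E w) < l"
    using E by (auto simp: few_pendants_def conn_planar_def)
  have finS: "finite S" using S finite_subset by blast
  have EV: "x \<in> V - S" "y \<in> V - S" if "{x, y} \<in> E" for x y using simple_graph_edge[OF sg that] by auto
  have st: "{x, y} \<in> star v S \<longleftrightarrow> x = v \<and> y \<in> S \<or> y = v \<and> x \<in> S" for x y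
    by (auto simp: star_def doubleton_eq_iff)
  have nS: "nbrs ?E s = {v}" if "s \<in> S" for s
    using that EV v by (auto simp: nbrs_def st)
  have nV: "nbrs ?E x = nbrs E x" if "x \<notin> S" "x \<noteq> v" for x
    using that by (auto simp: nbrs_def st)
  have nv: "S \<subseteq> nbrs ?E v" by (auto simp: nbrs_def st)
  show "S \<subseteq> pendants ?E v" using nS by (auto simp: pendants_def)
  have fin: "finite (pendants E w)" for w
    using pendants_subset[OF sg] nbrs_subset(2)[OF sg] finite_subset by blast
  have sub: "pendants ?E w \<subseteq> pendants E w \<union> (if w = v then S else {})" for w
  proof
    fix s assume s: "s \<in> pendants ?E w"
    \<comment> \<open>\<open>v\<close> may have been a leaf of \<open>E\<close>, but with at least
      two new neighbours it is one no longer; so no leaves arise except those in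
      \<open>S\<close>.\<close>
    have "s \<noteq> v"
    proof
      assume "s = v"
      then have "S \<subseteq> {w}" using s nv by (simp add: pendants_def)
      then have "card S \<le> 1" using card_mono[of "{w}" S] by simp
      then show False using S l by simp
    qed
    then show "s \<in> pendants E w \<union> (if w = v then S else {})"
      using s nS[of s] nV[of s] by (cases "s \<in> S") (auto simp: pendants_def)
  qed
  have "card (pendants ?E v) \<le> card (pendants E v \<union> S)"
    using sub[of v] fin finS by (intro card_mono) auto
  also have "\<dots> \<le> card (pendants E v) + card S" by (rule card_Un_le)
  finally show "card (pendants ?E v) < 2 * l" using few[OF v] S by simp
  show "w = v" if w: "w \<in> V" "l \<le> card (pendants ?E w)" for w
  proof (rule ccontr)
    assume ne: "w \<noteq> v"
    then have "card (pendants ?E w) \<le> card (pendants E w)"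
      using sub[of w] fin by (intro card_mono) auto
    moreover have "card (pendants E w) < l"
    proof (cases "w \<in> S")
      case True
      have "{w, s} \<notin> E" for s using EV(1)[of w] True by blast
      then have "nbrs E w = {}" by (auto simp: nbrs_def)
      then have "pendants E w = {}" using pendants_subset[OF sg, of w] by simp
      then show ?thesis using l by simp
    qed (use few w in auto)
    ultimately show False using w(2) by simp
  qed
  show "E = {e \<in> ?E. e \<inter> S = {}}"
    using sg by (auto simp: simple_graph_def star_def)
qed

text \<open>Triples of a leaf set, a graph and an attachment vertex are mapped to the enlarged
  graph. Within a fibre \<open>v\<close> is fixed and \<open>S\<close> determines \<open>E\<close>,
  so a fibre is no larger than the power set of fewer than \<open>2 * l\<close> leaves.\<close>

lemma card_few_pendants_le:
  assumes l: "2 \<le> l" and V: "finite (V :: nat set)" "card V = n + l" and n: "2 \<le> n"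
    and B: "\<And>S. S \<subseteq> V \<Longrightarrow> card S = l \<Longrightarrow> card (few_pendants l (V - S)) = b"
  shows "((n + l) choose l) * (b * n) \<le> 2 ^ (2 * l) * card (conn_planar V)"
proof -
  let ?SS = "{S. S \<subseteq> V \<and> card S = l}"
  let ?T = "Sigma ?SS (\<lambda>S. few_pendants l (V - S) \<times> (V - S))"
  let ?f = "\<lambda>(S, E, v). E \<union> star v S"
  have finSS: "finite ?SS" using V by simp
  have cVS: "finite S" "card (V - S) = n" if "S \<in> ?SS" for S
    using that V finite_subset[of S V] by (auto simp: card_Diff_subset)
  have fin: "finite (few_pendants l (V - S) \<times> (V - S))" for S
    using V finite_conn_planar[of "V - S"] by (auto simp: few_pendants_def)
  have "card ?T = (\<Sum>S\<in>?SS. card (few_pendants l (V - S) \<times> (V - S)))"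
    by (rule card_SigmaI[OF finSS]) (use fin in blast)
  also have "\<dots> = (\<Sum>S\<in>?SS. b * n)"
  proof (rule sum.cong[OF refl])
    fix S assume S: "S \<in> ?SS"
    then have "card (few_pendants l (V - S)) = b" using B by blast
    then show "card (few_pendants l (V - S) \<times> (V - S)) = b * n"
      unfolding card_cartesian_product cVS(2)[OF S] by simp
  qed
  also have "\<dots> = ((n + l) choose l) * (b * n)"
    using n_subsets[OF V(1), of l] V(2) by simp
  finally have cT: "card ?T = ((n + l) choose l) * (b * n)" .
  have "card ?T \<le> 2 ^ (2 * l) * card (conn_planar V)"
  proof (rule card_le_fibers[of _ ?f])
    show "finite (conn_planar V)" by (rule finite_conn_planar[OF V(1)])
    show "?f ` ?T \<subseteq> conn_planar V"
    proof
      fix G assume "G \<in> ?f ` ?T"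
      then obtain S E v where *: "S \<subseteq> V" "card S = l" "E \<in> few_pendants l (V - S)" "v \<in> V - S"
        and G: "G = E \<union> star v S" by auto
      then have "E \<union> star v S \<in> conn_planar ((V - S) \<union> S)"
        using cVS[of S] n by (intro conn_planar_add_star) (auto simp: few_pendants_def)
      moreover have "(V - S) \<union> S = V" using * by auto
      ultimately show "G \<in> conn_planar V" by (simp add: G)
    qed
    fix G assume G: "G \<in> conn_planar V"
    have sgG: "simple_graph V G" using G by (simp add: conn_planar_def)
    let ?A = "{a \<in> ?T. ?f a = G}"
    show "finite ?A \<and> card ?A \<le> 2 ^ (2 * l)"
    proof
      have "finite ?T" using finSS fin by (rule finite_SigmaI)
      then show "finite ?A" by simp
      show "card ?A \<le> 2 ^ (2 * l)"
      proof (cases "?A = {}")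
        case False
        then obtain S0 E0 v0 where 0: "S0 \<subseteq> V" "card S0 = l" "E0 \<in> few_pendants l (V - S0)" "v0 \<in> V - S0"
          "E0 \<union> star v0 S0 = G" by auto
        note f0 = few_pendants_star[OF l 0(3,1,2) V(1) 0(4), unfolded 0(5)]
        have key: "S \<subseteq> pendants G v0 \<and> v = v0 \<and> E = {e \<in> G. e \<inter> S = {}}" if "(S, E, v) \<in> ?A" for S E v
        proof -
          have 1: "S \<subseteq> V" "card S = l" "E \<in> few_pendants l (V - S)" "v \<in> V - S" "E \<union> star v S = G"
            using that by auto
          note f1 = few_pendants_star[OF l 1(3,1,2) V(1) 1(4), unfolded 1(5)]
          have "finite (pendants G v)"
            using pendants_subset[OF sgG] nbrs_subset(2)[OF sgG] finite_subset by blast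
          then have "l \<le> card (pendants G v)" using f1(1) 1(2) card_mono by blast
          then have "v = v0" using f0(3) 1(4) by blast
          then show ?thesis using f1(1,4) by auto
        qed
        have finp: "finite (pendants G v0)"
          using pendants_subset[OF sgG] nbrs_subset(2)[OF sgG] finite_subset by blast
        have "card ?A \<le> card (Pow (pendants G v0))"
        proof (rule card_inj_on_le[of fst])
          show "inj_on fst ?A"
          proof (rule inj_onI)
            fix a a' assume a: "a \<in> ?A" "a' \<in> ?A" "fst a = fst a'"
            obtain S E v S' E' v' where e: "a = (S, E, v)" "a' = (S', E', v')" by (metis prod_cases3)
            show "a = a'" using key[of S E v] key[of S' E' v'] a unfolding e by simp
          qed
          show "fst ` ?A \<subseteq> Pow (pendants G v0)" 
          proof
            fix S assume "S \<in> fst ` ?A"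
            then obtain E v where "(S, E, v) \<in> ?A" by force
            from key[OF this] show "S \<in> Pow (pendants G v0)" by simp
          qed
        qed (use finp in simp)
        also have "\<dots> = 2 ^ card (pendants G v0)" by (rule card_Pow[OF finp])
        also have "\<dots> \<le> 2 ^ (2 * l)" using f0(2) by (intro power_increasing) auto
        finally show ?thesis .
      next
        case True
        show ?thesis unfolding True by simp
      qed
    qed
  qed
  then show ?thesis using cT by simp
qed

lemma has_Braess_clique_if_pendants:
  assumes E: "E \<in> conn_planar V" and v: "v \<in> V" and l: "2 \<le> l" "l \<le> card (pendants E v)"
    and big: "l ^ 2 * (l + 1) \<le> card V"
  shows "has_Braess_clique l V E"
proof -
  have sg: "simple_graph V E" and cn: "connected_graph V E" using E by (auto simp: conn_planar_def)
  obtain S where S: "S \<subseteq> pendants E v" "card S = l" using obtain_subset_with_card_n[OF l(2)] by metis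
  have SV: "S \<subseteq> V" using S(1) pendants_subset[OF sg] nbrs_subset(1)[OF sg] by blast
  have pen: "nbrs E s = {v}" if "s \<in> S" for s using S(1) that by (auto simp: pendants_def)
  have "card S \<le> card V" using SV simple_graph_finite[OF sg] by (intro card_mono)
  interpret pendant_star V E v S l
    by unfold_locales (use sg cn SV S pen v l \<open>card S \<le> card V\<close> in auto)
  have "independent_vertices E S" unfolding independent_vertices_def
  proof (intro ballI)
    fix a b assume "a \<in> S" "b \<in> S"
    then have "b \<notin> nbrs E a" using pen v_notin_S by auto
    then show "{a, b} \<notin> E" by (simp add: nbrs_def)
  qed
  then show ?thesis unfolding has_Braess_clique_def
    using SV S(2) kemeny_constant_increases[OF big] by blast
qed

section \<open>Asymptotic comparison of the counts\<close>

abbreviation "num_conn_planar n \<equiv> card (conn_planar {1..n::nat})"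

text \<open>Positivity permits division by the count. The induction begins at 2 because
  \<open>conn_planar_add_leaf\<close> asks for two vertices.\<close>

lemma num_conn_planar_pos:
  assumes "2 \<le> n"
  shows "0 < num_conn_planar n"
  using assms
proof (induction n rule: dec_induct)
  case base
  have "planar_drawing {1..2::nat} {{1, 2}} of_nat (\<lambda>_. linepath 1 2)"
    unfolding planar_drawing_def
  proof (intro conjI ballI impI)
    show "inj_on (of_nat :: nat \<Rightarrow> complex) {1..2}" by (rule inj_on_of_nat)
    have two: "{1..2} = {1, 2 :: nat}" by auto
    fix e :: "nat set" assume e: "e \<in> {{1, 2}}"
    then show "arc (linepath 1 (2::complex))"
      "{pathstart (linepath 1 (2::complex)), pathfinish (linepath 1 2)} = of_nat ` e"
      "path_image (linepath 1 (2::complex)) \<inter> of_nat ` {1..2} = of_nat ` e"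
    proof -
      have e12: "e = {1, 2}" using e by simp
      have im: "of_nat ` e = {1, 2 :: complex}" "of_nat ` {1..2} = {1, 2 :: complex}"
        unfolding e12 two by simp_all
      show "arc (linepath 1 (2::complex))" by (simp add: arc_linepath)
      show "{pathstart (linepath 1 (2::complex)), pathfinish (linepath 1 2)} = of_nat ` e" by (simp add: im)
      show "path_image (linepath 1 (2::complex)) \<inter> of_nat ` {1..2} = of_nat ` e" unfolding im by auto
    qed
    fix e' :: "nat set" assume "e' \<in> {{1, 2}}" "e \<noteq> e'"
    with e show "path_image (linepath 1 (2::complex)) \<inter> path_image (linepath 1 2) = of_nat ` (e \<inter> e')" by simp
  qed
  then have "planar_graph {1..2::nat} {{1, 2}}" unfolding planar_graph_def by blast
  moreover have "simple_graph {1..2::nat} {{1, 2}}" by (auto simp: simple_graph_def)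
  moreover have "connected_graph {1..2::nat} {{1, 2}}"
  proof -
    have two: "{1..2} = {1, 2 :: nat}" by auto
    have "(1, 2) \<in> {(x, y). {x, y} \<in> {{1, 2 :: nat}}}" "(2, 1) \<in> {(x, y). {x, y} \<in> {{1, 2 :: nat}}}"
      by (auto simp: insert_commute)
    then show ?thesis unfolding connected_graph_def two by blast
  qed
  ultimately have "{{1, 2}} \<in> conn_planar {1..2::nat}" by (simp add: conn_planar_def)
  then show ?case using finite_conn_planar[of "{1..2::nat}"] by (auto simp: card_gt_0_iff)
next
  case (step n)
  then obtain E where "E \<in> conn_planar {1..n}" by (metis card.empty ex_in_conv less_irrefl)
  then have "insert {1, Suc n} E \<in> conn_planar (insert (Suc n) {1..n})"
    using step by (intro conn_planar_add_leaf) auto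
  then have "conn_planar {1..Suc n} \<noteq> {}" by (auto simp: atLeastAtMostSuc_conv)
  then show ?case using finite_conn_planar[of "{1..Suc n}"] by (simp add: card_gt_0_iff)
qed

lemma num_conn_planar_step_le:
  obtains K :: nat where "\<And>n. 100 \<le> n \<Longrightarrow> num_conn_planar n \<le> K * n * num_conn_planar (n - 1)"
proof -
  obtain D :: nat where D: "120000 \<le> D" by blast
  have "num_conn_planar n \<le> 2 * (2 ^ (4 * D + 2) + 1) * n * num_conn_planar (n - 1)" if n: "100 \<le> n" for n
  proof -
    have "card (conn_planar ({1..n} - {u})) = num_conn_planar (n - 1)" if "u \<in> {1..n}" for u
      using that by (intro card_conn_planar_cong) auto
    from card_conn_planar_reduce[OF _ _ D this] show ?thesis using n by simp
  qed
  then show thesis using that by blast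
qed

lemma num_conn_planar_steps_le:
  assumes K: "\<And>n. 100 \<le> n \<Longrightarrow> num_conn_planar n \<le> K * n * num_conn_planar (n - 1)" and n: "100 \<le> n"
  shows "num_conn_planar (n + l) \<le> K ^ l * (n + l) ^ l * num_conn_planar n"
proof (induction l)
  case (Suc l)
  have "num_conn_planar (n + Suc l) \<le> K * (n + Suc l) * num_conn_planar (n + l)" using K[of "n + Suc l"] n by simp
  also have "\<dots> \<le> K * (n + Suc l) * (K ^ l * (n + l) ^ l * num_conn_planar n)" using Suc by (rule mult_left_mono) simp
  also have "\<dots> \<le> K * (n + Suc l) * (K ^ l * (n + Suc l) ^ l * num_conn_planar n)"
    by (intro mult_left_mono mult_right_mono power_mono) auto
  also have "\<dots> = K ^ Suc l * (n + Suc l) ^ Suc l * num_conn_planar n" by (simp only: power_Suc mult_ac)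
  finally show ?case .
qed simp

text \<open>Choosing the labels of the leaves yields at least \<open>((n + l) / l) ^ l\<close>,
  which cancels the growth factor \<open>(n + l) ^ l\<close> of \<open>l\<close> steps. The choice
  of the attachment vertex leaves a factor \<open>n\<close> to spare, and \<open>c\<close> collects
  the constants.\<close>

lemma few_pendants_small:
  assumes l: "2 \<le> l"
  obtains c :: real where
    "\<And>n. 100 \<le> n \<Longrightarrow> real (card (few_pendants l {1..n::nat})) / real (num_conn_planar n) \<le> c / real n"
proof -
  obtain K :: nat where K: "\<And>n. 100 \<le> n \<Longrightarrow> num_conn_planar n \<le> K * n * num_conn_planar (n - 1)" using num_conn_planar_step_le by blast
  define c where "c = real (2 ^ (2 * l) * K ^ l * l ^ l)"
  have "real (card (few_pendants l {1..n::nat})) / real (num_conn_planar n) \<le> c / real n" if n: "100 \<le> n" for n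
  proof -
    define b where "b = card (few_pendants l {1..n::nat})"
    have "card (few_pendants l ({1..n + l} - S)) = b" if "S \<subseteq> {1..n + l}" "card S = l" for S
      unfolding b_def using that finite_subset[OF that(1)]
      by (intro card_few_pendants_cong) (auto simp: card_Diff_subset)
    then have "((n + l) choose l) * (b * n) \<le> 2 ^ (2 * l) * num_conn_planar (n + l)"
      using n by (intro card_few_pendants_le[OF l]) auto
    also have "\<dots> \<le> 2 ^ (2 * l) * (K ^ l * (n + l) ^ l * num_conn_planar n)"
      by (intro mult_left_mono num_conn_planar_steps_le[OF K n]) auto
    finally have 1: "real ((n + l) choose l) * (real b * real n) \<le> 2 ^ (2 * l) * (real K ^ l * real (n + l) ^ l * real (num_conn_planar n))"
      by (metis (mono_tags, opaque_lifting) of_nat_le_iff of_nat_mult of_nat_numeral of_nat_power)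
    have "(real (n + l) / real l) ^ l \<le> real ((n + l) choose l)"
      by (rule binomial_ge_n_over_k_pow_k) simp
    then have "(real (n + l) / real l) ^ l * (real b * real n) \<le> real ((n + l) choose l) * (real b * real n)"
      by (rule mult_right_mono) simp
    with 1 have "(real (n + l) / real l) ^ l * (real b * real n) \<le> 2 ^ (2 * l) * (real K ^ l * real (n + l) ^ l * real (num_conn_planar n))"
      by linarith
    then have "real (n + l) ^ l * (real b * real n) \<le> real (n + l) ^ l * (c * real (num_conn_planar n))"
      using l by (simp add: power_divide divide_simps c_def mult_ac)
    then have "real b * real n \<le> c * real (num_conn_planar n)"
      using n by (simp add: mult_le_cancel_left_pos)
    moreover have "0 < real (num_conn_planar n)" using num_conn_planar_pos[of n] n by simp
    ultimately show ?thesis using n by (simp add: b_def field_simps)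
  qed
  then show thesis using that by blast
qed

theorem corollary4p6:
  fixes l :: nat
  assumes "l \<ge> 2"
  shows "(\<lambda>n. real (card {E \<in> connected_planar_graphs n. has_Braess_clique l {1..n} E})
            / real (card (connected_planar_graphs n))) \<longlonglongrightarrow> 1"
proof -
  have conn_planar: "connected_planar_graphs n = conn_planar {1..n}" for n
    by (simp add: connected_planar_graphs_def conn_planar_def)
  let ?good = "\<lambda>n. {E \<in> conn_planar {1..n::nat}. has_Braess_clique l {1..n} E}"
  obtain c where c: "\<And>n. 100 \<le> n \<Longrightarrow> real (card (few_pendants l {1..n::nat})) / real (num_conn_planar n) \<le> c / real n"
    using few_pendants_small[OF assms] by blast
  have bounds: "1 - c / real n \<le> real (card (?good n)) / real (num_conn_planar n) \<and> real (card (?good n)) / real (num_conn_planar n) \<le> 1"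
    if n: "100 + l ^ 2 * (l + 1) \<le> n" for n
  proof -
    have fin: "finite (conn_planar {1..n})" by (rule finite_conn_planar) simp
    have pos: "0 < real (num_conn_planar n)" using num_conn_planar_pos[of n] n by simp
    \<comment> \<open>Outside \<open>few_pendants\<close> there is a vertex with at least
      \<open>l\<close> leaves, and \<open>n\<close> is large enough for the clique on
      \<open>l\<close> of them to raise Kemeny's constant.\<close>
    have "conn_planar {1..n} \<subseteq> few_pendants l {1..n} \<union> ?good n"
      using has_Braess_clique_if_pendants[of _ "{1..n}" _ l] assms n
      by (force simp: few_pendants_def not_less)
    then have "num_conn_planar n \<le> card (few_pendants l {1..n} \<union> ?good n)"
      using fin by (intro card_mono) (auto simp: few_pendants_def)
    also have "\<dots> \<le> card (few_pendants l {1..n}) + card (?good n)" by (rule card_Un_le)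
    finally have "real (num_conn_planar n) \<le> real (card (few_pendants l {1..n})) + real (card (?good n))" by linarith
    then have one: "1 \<le> real (card (few_pendants l {1..n})) / real (num_conn_planar n) + real (card (?good n)) / real (num_conn_planar n)"
      using pos by (simp add: field_simps)
    have "card (?good n) \<le> num_conn_planar n" using fin by (intro card_mono) auto
    then have "real (card (?good n)) / real (num_conn_planar n) \<le> 1" using pos by (simp add: divide_le_eq)
    moreover have "1 - c / real n \<le> real (card (?good n)) / real (num_conn_planar n)" using c[of n] n one by linarith
    ultimately show ?thesis by simp
  qed
  show ?thesis unfolding conn_planar
  proof (rule tendsto_sandwich)
    show "\<forall>\<^sub>F n in sequentially. 1 - c / real n \<le> real (card (?good n)) / real (num_conn_planar n)"
      "\<forall>\<^sub>F n in sequentially. real (card (?good n)) / real (num_conn_planar n) \<le> 1"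
      by (rule eventually_mono[OF eventually_ge_at_top[of "100 + l ^ 2 * (l + 1)"]]; use bounds in blast)+
    have "(\<lambda>n. 1 - c / real n) \<longlonglongrightarrow> 1 - 0"
      by (intro tendsto_intros lim_const_over_n)
    then show "(\<lambda>n. 1 - c / real n) \<longlonglongrightarrow> 1" by simp
  qed simp
qed

end
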